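(* Let $\mathcal H$ be an infinite-dimensional separable complex Hilbert space, let $A,B\in B(\mathcal H)$ be self-adjoint, let $A\oplus B=\begin{bmatrix}A&0\\0&B\end{bmatrix}\in B(\mathcal H\oplus\mathcal H)$, and let $X\in B(\mathcal H)$. Then $$s(AX-XB)\prec_w \mathrm{Spr}^+(A\oplus B)\cdot s(X).$$
   Context: $\mathbb N=\{1,2,\dots\}$, $\mathbb Z_0=\mathbb Z\setminus\{0\}$. The product $\cdot$ of sequences is entrywise. Spectral scale: for a bounded self-adjoint operator $A$ on an infinite-dimensional separable complex Hilbert space $\mathcal L$, $\lambda(A)=(\lambda_i(A))_{i\in\mathbb Z_0}$ is defined, for $i\in\mathbb N$, by $$\lambda_i(A)=\inf_{\dim\mathcal S=i-1}\ \sup_{\psi\in\mathcal S^\perp,\|\psi\|=1}\langle A\psi,\psi\rangle,\qquad \lambda_{-i}(A)=\sup_{\dim\mathcal S=i-1}\ \inf_{\psi\in\mathcal S^\perp,\|\psi\|=1}\langle A\psi,\psi\rangle,$$ where $\mathcal S$ ranges over $(i-1)$-dimensional subspaces of $\mathcal L$. Spectral spread: $\mathrm{Spr}^+(A)=(\lambda_i(A)-\lambda_{-i}(A))_{i\in\mathbb N}$. Generalized singular values of a bounded operator $T$: $s(T)=(\lambda_i(|T|))_{i\in\mathbb N}$, $|T|=(T^*T)^{1/2}$. Submajorization: for a bounded real sequence $a=(a_i)_{i\in\mathbb M}$, $\mathbb M\in\{\mathbb N,\mathbb Z_0\}$, put $a^\downarrow_i=\lambda_i(D_a)$, $i\in\mathbb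 N$, where $D_a$ is the diagonal operator with diagonal $a$ on $\ell^2(\mathbb M)$; equivalently $\sum_{i=1}^k a_i^\downarrow=\sup\{\sum_{i\in F}a_i: F\subseteq\mathbb M, |F|=k\}$. Then $a\prec_w b$ means $\sum_{i=1}^k a_i^\downarrow\le\sum_{i=1}^k b_i^\downarrow$ for all $k\in\mathbb N$. *)

theory Defs
  imports "HOL-Analysis.Analysis"
begin

section \<open>Complex Hilbert spaces\<close>

text \<open>
  The underlying real inner product of \<^class>\<open>real_inner\<close> is the real part of the complex one.
  Norm, metric and topology are therefore the usual ones, and positive definiteness of \<open>cinner\<close>
  is inherited. The form is linear in the first argument.
\<close>

class complex_inner = real_inner +
  fixes scaleC :: "complex \<Rightarrow> 'a \<Rightarrow> 'a" (infixr \<open>*\<^sub>C\<close> 75)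
    and cinner :: "'a \<Rightarrow> 'a \<Rightarrow> complex"
  assumes scaleC_add_right: "c *\<^sub>C (x + y) = c *\<^sub>C x + c *\<^sub>C y"
    and scaleC_add_left: "(c + d) *\<^sub>C x = c *\<^sub>C x + d *\<^sub>C x"
    and scaleC_scaleC: "c *\<^sub>C d *\<^sub>C x = (c * d) *\<^sub>C x"
    and scaleC_of_real: "complex_of_real r *\<^sub>C x = r *\<^sub>R x"
    and cinner_commute: "cinner x y = cnj (cinner y x)"
    and cinner_add_left: "cinner (x + y) z = cinner x z + cinner y z"
    and cinner_scaleC_left: "cinner (c *\<^sub>C x) y = c * cinner x y"
    and Re_cinner: "Re (cinner x y) = inner x y"

class chilbert_space = complex_inner + complete_space

lemma scaleC_one: "1 *\<^sub>C x = (x :: 'a :: complex_inner)"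
  using scaleC_of_real[of 1 x] by simp

global_interpretation complex_vector:
  vector_space "scaleC :: complex \<Rightarrow> 'a \<Rightarrow> 'a :: complex_inner"
  by unfold_locales (simp_all add: scaleC_add_right scaleC_add_left scaleC_scaleC scaleC_one)

text \<open>The product type is the Hilbert space direct sum.\<close>

instantiation prod :: (complex_inner, complex_inner) complex_inner
begin

definition scaleC_prod :: "complex \<Rightarrow> 'a \<times> 'b \<Rightarrow> 'a \<times> 'b" where
  "scaleC_prod c x = (c *\<^sub>C fst x, c *\<^sub>C snd x)"

definition cinner_prod :: "'a \<times> 'b \<Rightarrow> 'a \<times> 'b \<Rightarrow> complex" where
  "cinner_prod x y = cinner (fst x) (fst y) + cinner (snd x) (snd y)"

instance
proof
  fix x y :: "'a \<times> 'b"
  show "cinner x y = cnj (cinner y x)"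
    using cinner_commute[of "fst x" "fst y"] cinner_commute[of "snd x" "snd y"]
    by (simp add: cinner_prod_def)
qed (auto simp: scaleC_prod_def cinner_prod_def scaleC_add_right scaleC_add_left scaleC_scaleC
      scaleC_of_real scaleR_prod_def cinner_add_left cinner_scaleC_left Re_cinner inner_prod_def
      algebra_simps)

end

instance prod :: (chilbert_space, chilbert_space) chilbert_space ..

definition has_cdim :: "'a :: complex_inner set \<Rightarrow> nat \<Rightarrow> bool" where
  "has_cdim S n \<longleftrightarrow>
     (\<exists>B. finite B \<and> card B = n \<and> complex_vector.independent B \<and> complex_vector.span B = S)"

definition infinite_cdim :: "'a :: complex_inner set \<Rightarrow> bool" where
  "infinite_cdim S \<longleftrightarrow> complex_vector.subspace S \<and> (\<nexists>n. has_cdim S n)"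

definition orth_compl :: "'a :: complex_inner set \<Rightarrow> 'a set" where
  "orth_compl S = {x. \<forall>y\<in>S. cinner x y = 0}"

section \<open>Bounded operators\<close>

definition bounded_clinear :: "('a :: complex_inner \<Rightarrow> 'b :: complex_inner) \<Rightarrow> bool" where
  "bounded_clinear T \<longleftrightarrow> bounded_linear T \<and> (\<forall>c x. T (c *\<^sub>C x) = c *\<^sub>C T x)"

definition selfadjoint :: "('a :: complex_inner \<Rightarrow> 'a) \<Rightarrow> bool" where
  "selfadjoint T \<longleftrightarrow> (\<forall>x y. cinner (T x) y = cinner x (T y))"

definition positive_op :: "('a :: complex_inner \<Rightarrow> 'a) \<Rightarrow> bool" where
  "positive_op T \<longleftrightarrow> selfadjoint T \<and> (\<forall>x. 0 \<le> Re (cinner (T x) x))"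

definition cadjoint :: "('a :: complex_inner \<Rightarrow> 'b :: complex_inner) \<Rightarrow> 'b \<Rightarrow> 'a" where
  "cadjoint T = (THE S. \<forall>x y. cinner (T x) y = cinner x (S y))"

definition sqrt_op :: "('a :: complex_inner \<Rightarrow> 'a) \<Rightarrow> 'a \<Rightarrow> 'a" where
  "sqrt_op T = (THE R. bounded_clinear R \<and> positive_op R \<and> R \<circ> R = T)"

definition abs_op :: "('a :: complex_inner \<Rightarrow> 'b :: complex_inner) \<Rightarrow> 'a \<Rightarrow> 'a" where
  "abs_op T = sqrt_op (cadjoint T \<circ> T)"

text \<open>The block diagonal operator.\<close>

definition dsum_op :: "('a \<Rightarrow> 'a) \<Rightarrow> ('b \<Rightarrow> 'b) \<Rightarrow> 'a \<times> 'b \<Rightarrow> 'a \<times> 'b" (infixr \<open>\<oplus>\<^sub>o\<^sub>p\<close> 65) where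
  "A \<oplus>\<^sub>o\<^sub>p B = (\<lambda>(x, y). (A x, B y))"

section \<open>Spectral scale, spectral spread, singular values\<close>

text \<open>
  Indexed by the nonzero integers; the value at \<open>0\<close> is irrelevant. For bounded selfadjoint \<open>A\<close> the
  form \<open>cinner (A \<psi>) \<psi>\<close> is real. On an infinite-dimensional space all the suprema and infima
  below are over nonempty bounded sets of reals.
\<close>

definition spectral_scale :: "('a :: complex_inner \<Rightarrow> 'a) \<Rightarrow> int \<Rightarrow> real" where
  "spectral_scale A i =
     (if i > 0
      then (INF S\<in>{S. has_cdim S (nat i - 1)}.
              SUP \<psi>\<in>{\<psi> \<in> orth_compl S. norm \<psi> = 1}. Re (cinner (A \<psi>) \<psi>))
      else (SUP S\<in>{S. has_cdim S (nat (- i) - 1)}.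
              INF \<psi>\<in>{\<psi> \<in> orth_compl S. norm \<psi> = 1}. Re (cinner (A \<psi>) \<psi>)))"

text \<open>
  Sequences indexed by \<open>{1, 2, \<dots>}\<close> are functions on \<^typ>\<open>nat\<close>, the value at \<open>n\<close> being
  the entry with index \<open>n + 1\<close>.
\<close>

definition spectral_spread :: "('a :: complex_inner \<Rightarrow> 'a) \<Rightarrow> nat \<Rightarrow> real" where
  "spectral_spread A n = spectral_scale A (int n + 1) - spectral_scale A (- (int n + 1))"

definition singular_values :: "('a :: complex_inner \<Rightarrow> 'b :: complex_inner) \<Rightarrow> nat \<Rightarrow> real" where
  "singular_values T n = spectral_scale (abs_op T) (int n + 1)"

section \<open>The sequence space \<open>\<ell>\<^sup>2\<close>\<close>

typedef 'm ell2 = "{x :: 'm \<Rightarrow> complex. (\<lambda>i. (cmod (x i))\<^sup>2) summable_on UNIV}"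
  morphisms coord Abs_ell2
  by (rule exI[of _ "\<lambda>_. 0"]) simp

lemma coord_summable: "(\<lambda>i. (cmod (coord x i))\<^sup>2) summable_on UNIV"
  using coord[of x] by simp

lemma coord_Abs_ell2: "(\<lambda>i. (cmod (f i))\<^sup>2) summable_on UNIV \<Longrightarrow> coord (Abs_ell2 f) = f"
  by (simp add: Abs_ell2_inverse)

lemma ell2_eqI: "(\<And>i. coord x i = coord y i) \<Longrightarrow> x = y"
  by (metis coord_inject ext)

lemma ell2_add_summable:
  assumes "(\<lambda>i. (cmod (f i))\<^sup>2) summable_on UNIV" "(\<lambda>i. (cmod (g i))\<^sup>2) summable_on UNIV"
  shows "(\<lambda>i. (cmod (f i + g i))\<^sup>2) summable_on UNIV"
proof (rule summable_on_comparison_test)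
  show "(\<lambda>i. 2 * ((cmod (f i))\<^sup>2 + (cmod (g i))\<^sup>2)) summable_on UNIV"
    by (intro summable_on_cmult_right summable_on_add assms)
  fix i
  have "(cmod (f i + g i))\<^sup>2 \<le> (cmod (f i) + cmod (g i))\<^sup>2"
    by (intro power_mono norm_triangle_ineq) auto
  also have "\<dots> \<le> 2 * ((cmod (f i))\<^sup>2 + (cmod (g i))\<^sup>2)"
    using sum_squares_bound[of "cmod (f i)" "cmod (g i)"] by (simp add: power2_sum)
  finally show "(cmod (f i + g i))\<^sup>2 \<le> 2 * ((cmod (f i))\<^sup>2 + (cmod (g i))\<^sup>2)" .
qed auto

lemma ell2_scale_summable:
  assumes "(\<lambda>i. (cmod (f i))\<^sup>2) summable_on UNIV"
  shows "(\<lambda>i. (cmod (c * f i))\<^sup>2) summable_on UNIV"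
  using summable_on_cmult_right[OF assms, of "(cmod c)\<^sup>2"] by (simp add: norm_mult power_mult_distrib)

lemma ell2_inner_summable: "(\<lambda>i. coord x i * cnj (coord y i)) summable_on UNIV"
proof (rule abs_summable_summable, rule summable_on_comparison_test)
  show "(\<lambda>i. (cmod (coord x i))\<^sup>2 + (cmod (coord y i))\<^sup>2) summable_on UNIV"
    by (intro summable_on_add coord_summable)
  fix i
  have "2 * (cmod (coord x i) * cmod (coord y i)) \<le> (cmod (coord x i))\<^sup>2 + (cmod (coord y i))\<^sup>2"
    using sum_squares_bound[of "cmod (coord x i)" "cmod (coord y i)"] by simp
  moreover have "0 \<le> cmod (coord x i) * cmod (coord y i)" by simp
  ultimately show "cmod (coord x i * cnj (coord y i)) \<le> (cmod (coord x i))\<^sup>2 + (cmod (coord y i))\<^sup>2"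
    unfolding norm_mult complex_mod_cnj by linarith
qed auto

instantiation ell2 :: (type) complex_inner
begin

definition zero_ell2 :: "'a ell2" where "0 = Abs_ell2 (\<lambda>i. 0)"
definition plus_ell2 :: "'a ell2 \<Rightarrow> 'a ell2 \<Rightarrow> 'a ell2" where
  "x + y = Abs_ell2 (\<lambda>i. coord x i + coord y i)"
definition scaleC_ell2 :: "complex \<Rightarrow> 'a ell2 \<Rightarrow> 'a ell2" where
  "c *\<^sub>C x = Abs_ell2 (\<lambda>i. c * coord x i)"
definition scaleR_ell2 :: "real \<Rightarrow> 'a ell2 \<Rightarrow> 'a ell2" where
  "r *\<^sub>R x = complex_of_real r *\<^sub>C (x :: 'a ell2)"
definition uminus_ell2 :: "'a ell2 \<Rightarrow> 'a ell2" where "- x = (- 1) *\<^sub>C (x :: 'a ell2)"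
definition minus_ell2 :: "'a ell2 \<Rightarrow> 'a ell2 \<Rightarrow> 'a ell2" where
  "x - y = x + (- (y :: 'a ell2))"
definition cinner_ell2 :: "'a ell2 \<Rightarrow> 'a ell2 \<Rightarrow> complex" where
  "cinner x y = (\<Sum>\<^sub>\<infinity>i. coord x i * cnj (coord y i))"
definition inner_ell2 :: "'a ell2 \<Rightarrow> 'a ell2 \<Rightarrow> real" where
  "inner x y = Re (cinner x (y :: 'a ell2))"
definition norm_ell2 :: "'a ell2 \<Rightarrow> real" where "norm x = sqrt (inner x (x :: 'a ell2))"
definition sgn_ell2 :: "'a ell2 \<Rightarrow> 'a ell2" where "sgn x = inverse (norm x) *\<^sub>R (x :: 'a ell2)"
definition dist_ell2 :: "'a ell2 \<Rightarrow> 'a ell2 \<Rightarrow> real" where "dist x y = norm (x - (y :: 'a ell2))"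
definition uniformity_ell2 :: "('a ell2 \<times> 'a ell2) filter" where
  "uniformity_ell2 = (INF e\<in>{0<..}. principal {(x :: 'a ell2, y). dist x y < e})"
definition open_ell2 :: "'a ell2 set \<Rightarrow> bool" where
  "open_ell2 U = (\<forall>x\<in>(U :: 'a ell2 set). \<forall>\<^sub>F (x', y) in uniformity. x' = x \<longrightarrow> y \<in> U)"

lemma coord_zero: "coord 0 i = 0"
  by (simp add: zero_ell2_def coord_Abs_ell2)

lemma coord_plus: "coord (x + y) i = coord x i + coord y i"
  by (simp add: plus_ell2_def coord_Abs_ell2 ell2_add_summable coord_summable)

lemma coord_scaleC: "coord (c *\<^sub>C x) i = c * coord x i"
  by (simp add: scaleC_ell2_def coord_Abs_ell2 ell2_scale_summable coord_summable)

lemma coord_scaleR: "coord (r *\<^sub>R x) i = r * coord x i"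
  by (simp add: scaleR_ell2_def coord_scaleC)

lemma coord_uminus: "coord (- x) i = - coord x i"
  by (simp add: uminus_ell2_def coord_scaleC)

lemma coord_minus: "coord (x - y) i = coord x i - coord y i"
  by (simp add: minus_ell2_def coord_plus coord_uminus)

lemmas coord_simps =
  coord_zero coord_plus coord_scaleC coord_scaleR coord_uminus coord_minus

lemma cinner_commute_ell2: "cinner (x :: 'a ell2) y = cnj (cinner y x)"
  unfolding cinner_ell2_def infsum_cnj[symmetric] by (simp add: mult.commute)

lemma cinner_add_ell2: "cinner (x + y) z = cinner x z + cinner y (z :: 'a ell2)"
  unfolding cinner_ell2_def coord_simps distrib_right
  by (intro infsum_add ell2_inner_summable)

lemma cinner_scaleC_ell2: "cinner (c *\<^sub>C x) y = c * cinner x (y :: 'a ell2)"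
  unfolding cinner_ell2_def coord_simps mult.assoc
  by (intro infsum_cmult_right ell2_inner_summable)

lemma inner_self_ell2: "inner x x = (\<Sum>\<^sub>\<infinity>i. (cmod (coord x i))\<^sup>2)"
  unfolding inner_ell2_def cinner_ell2_def infsum_Re[OF ell2_inner_summable, symmetric]
  by (intro infsum_cong) (simp add: cmod_power2 flip: power2_eq_square)

instance
proof
  fix x y z :: "'a ell2" and r s :: real and c d :: complex and U :: "'a ell2 set"
  show "x + y + z = x + (y + z)" "x + y = y + x" "0 + x = x" "- x + x = 0" "x - y = x + - y"
    by (auto intro!: ell2_eqI simp: coord_simps)
  show "r *\<^sub>R (x + y) = r *\<^sub>R x + r *\<^sub>R y" "(r + s) *\<^sub>R x = r *\<^sub>R x + s *\<^sub>R x"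
    "r *\<^sub>R s *\<^sub>R x = (r * s) *\<^sub>R x" "1 *\<^sub>R x = x"
    by (auto intro!: ell2_eqI simp: coord_simps algebra_simps)
  show "c *\<^sub>C (x + y) = c *\<^sub>C x + c *\<^sub>C y" "(c + d) *\<^sub>C x = c *\<^sub>C x + d *\<^sub>C x"
    "c *\<^sub>C d *\<^sub>C x = (c * d) *\<^sub>C x" "complex_of_real r *\<^sub>C x = r *\<^sub>R x"
    by (auto intro!: ell2_eqI simp: coord_simps algebra_simps)
  show "cinner x y = cnj (cinner y x)"
    by (rule cinner_commute_ell2)
  show "cinner (x + y) z = cinner x z + cinner y z"
    by (rule cinner_add_ell2)
  show "cinner (c *\<^sub>C x) y = c * cinner x y"
    by (rule cinner_scaleC_ell2)
  show "Re (cinner x y) = inner x y"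
    by (simp add: inner_ell2_def)
  show "inner x y = inner y x"
    unfolding inner_ell2_def by (subst cinner_commute_ell2) simp
  show "inner (x + y) z = inner x z + inner y z"
    by (simp add: inner_ell2_def cinner_add_ell2)
  show "inner (r *\<^sub>R x) y = r * inner x y"
    by (simp add: inner_ell2_def scaleR_ell2_def cinner_scaleC_ell2)
  show "0 \<le> inner x x"
    unfolding inner_self_ell2 by (intro infsum_nonneg) auto
  show "inner x x = 0 \<longleftrightarrow> x = 0"
  proof
    assume "inner x x = 0"
    then have "(cmod (coord x i))\<^sup>2 = 0" for i
      by (intro nonneg_infsum_le_0D[where A = UNIV and f = "\<lambda>i. (cmod (coord x i))\<^sup>2"])
        (auto simp: inner_self_ell2 coord_summable)
    then show "x = 0"
      by (auto intro!: ell2_eqI simp: coord_simps)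
  qed (simp add: inner_self_ell2 coord_simps)
  show "norm x = sqrt (inner x x)" by (rule norm_ell2_def)
  show "sgn x = inverse (norm x) *\<^sub>R x" by (rule sgn_ell2_def)
  show "dist x y = norm (x - y)" by (rule dist_ell2_def)
  show "(uniformity :: ('a ell2 \<times> 'a ell2) filter) =
      (INF e\<in>{0<..}. principal {(x, y). dist x y < e})"
    by (rule uniformity_ell2_def)
  show "open U \<longleftrightarrow> (\<forall>x\<in>U. \<forall>\<^sub>F (x', y) in uniformity. x' = x \<longrightarrow> y \<in> U)"
    by (rule open_ell2_def)
qed

end

lemma norm_ell2_square: "(norm x)\<^sup>2 = (\<Sum>\<^sub>\<infinity>i. (cmod (coord x i))\<^sup>2)"
  by (simp add: power2_norm_eq_inner inner_self_ell2)

lemma sum_coord_le_norm: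
  assumes "finite F"
  shows "(\<Sum>i\<in>F. (cmod (coord x i))\<^sup>2) \<le> (norm x)\<^sup>2"
  unfolding norm_ell2_square using assms by (intro finite_sum_le_infsum coord_summable) auto

lemma coord_le_norm: "cmod (coord x i) \<le> norm x"
  using sum_coord_le_norm[of "{i}" x] by (intro power2_le_imp_le[OF _ norm_ge_zero]) simp

instance ell2 :: (type) chilbert_space
proof
  fix X :: "nat \<Rightarrow> 'a ell2"
  assume X: "Cauchy X"
  have "Cauchy (\<lambda>n. coord (X n) i)" for i
  proof (rule metric_CauchyI)
    fix e :: real assume "e > 0"
    then obtain M where "\<forall>m\<ge>M. \<forall>n\<ge>M. dist (X m) (X n) < e"
      using X by (meson metric_CauchyD)
    moreover have "dist (coord (X m) i) (coord (X n) i) \<le> dist (X m) (X n)" for m n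
      using coord_le_norm[of "X m - X n" i] by (simp add: dist_norm coord_simps)
    ultimately show "\<exists>M. \<forall>m\<ge>M. \<forall>n\<ge>M. dist (coord (X m) i) (coord (X n) i) < e"
      by (meson le_less_trans)
  qed
  then have "\<forall>i. \<exists>l. (\<lambda>n. coord (X n) i) \<longlonglongrightarrow> l"
    using Cauchy_convergent unfolding convergent_def by blast
  then obtain y where y: "\<And>i. (\<lambda>n. coord (X n) i) \<longlonglongrightarrow> y i"
    using choice[of "\<lambda>i l. (\<lambda>n. coord (X n) i) \<longlonglongrightarrow> l"] by blast
  have fin: "\<exists>M. \<forall>m\<ge>M. \<forall>F. finite F \<longrightarrow> (\<Sum>i\<in>F. (cmod (y i - coord (X m) i))\<^sup>2) \<le> e\<^sup>2"
    if "e > 0" for e :: real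
  proof -
    obtain M where M: "\<forall>m\<ge>M. \<forall>n\<ge>M. dist (X m) (X n) < e"
      using X \<open>e > 0\<close> by (meson metric_CauchyD)
    have "(\<Sum>i\<in>F. (cmod (y i - coord (X m) i))\<^sup>2) \<le> e\<^sup>2" if "m \<ge> M" "finite F" for m F
    proof (rule LIMSEQ_le_const2)
      show "(\<lambda>n. \<Sum>i\<in>F. (cmod (coord (X n) i - coord (X m) i))\<^sup>2)
              \<longlonglongrightarrow> (\<Sum>i\<in>F. (cmod (y i - coord (X m) i))\<^sup>2)"
        by (intro tendsto_intros y)
      have "(\<Sum>i\<in>F. (cmod (coord (X n) i - coord (X m) i))\<^sup>2) \<le> e\<^sup>2" if "n \<ge> M" for n
      proof -
        have "(\<Sum>i\<in>F. (cmod (coord (X n - X m) i))\<^sup>2) \<le> (norm (X n - X m))\<^sup>2"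
          by (rule sum_coord_le_norm) fact
        also have "norm (X n - X m) \<le> e"
          using M \<open>m \<ge> M\<close> \<open>n \<ge> M\<close> by (metis dist_norm less_imp_le)
        then have "(norm (X n - X m))\<^sup>2 \<le> e\<^sup>2" by (simp add: power_mono)
        finally show ?thesis by (simp add: coord_simps)
      qed
      then show "\<exists>N. \<forall>n\<ge>N. (\<Sum>i\<in>F. (cmod (coord (X n) i - coord (X m) i))\<^sup>2) \<le> e\<^sup>2"
        by blast
    qed
    then show ?thesis by blast
  qed
  have diff: "(\<lambda>i. (cmod (y i - coord (X m) i))\<^sup>2) summable_on UNIV"
    if "\<forall>F. finite F \<longrightarrow> (\<Sum>i\<in>F. (cmod (y i - coord (X m) i))\<^sup>2) \<le> e\<^sup>2" for m and e :: real
    using that by (intro nonneg_bdd_above_summable_on bdd_aboveI[where M = "e\<^sup>2"]) auto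
  obtain M where "\<forall>F. finite F \<longrightarrow> (\<Sum>i\<in>F. (cmod (y i - coord (X M) i))\<^sup>2) \<le> 1\<^sup>2"
    using fin[of 1] by auto
  from ell2_add_summable[OF diff[OF this] coord_summable[of "X M"]]
  have "coord (Abs_ell2 y) = y"
    by (simp add: coord_Abs_ell2)
  then obtain Y where Y: "coord Y = y" by blast
  have "X \<longlonglongrightarrow> Y"
  proof (rule metric_LIMSEQ_I)
    fix e :: real assume "e > 0"
    then obtain M where M:
      "\<forall>m\<ge>M. \<forall>F. finite F \<longrightarrow> (\<Sum>i\<in>F. (cmod (y i - coord (X m) i))\<^sup>2) \<le> (e / 2)\<^sup>2"
      using fin[of "e / 2"] by auto
    have "dist (X m) Y < e" if "m \<ge> M" for m
    proof -
      have "(norm (Y - X m))\<^sup>2 \<le> (e / 2)\<^sup>2"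
        unfolding norm_ell2_square using M that
        by (intro infsum_le_finite_sums coord_summable) (auto simp: coord_simps Y)
      then have "norm (Y - X m) \<le> e / 2"
        by (rule power2_le_imp_le) (use \<open>e > 0\<close> in simp)
      then show ?thesis
        using \<open>e > 0\<close> by (simp add: dist_norm norm_minus_commute)
    qed
    then show "\<exists>M. \<forall>m\<ge>M. dist (X m) Y < e" by blast
  qed
  then show "convergent X" by (rule convergentI)
qed

section \<open>Submajorization\<close>

text \<open>
  The diagonal operator of \<open>a\<close> is meaningful only for bounded \<open>a\<close>; otherwise \<open>Abs_ell2\<close> may be
  applied outside its domain.
\<close>

definition diag_op :: "('m \<Rightarrow> real) \<Rightarrow> 'm ell2 \<Rightarrow> 'm ell2" where
  "diag_op a x = Abs_ell2 (\<lambda>i. complex_of_real (a i) * coord x i)"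

definition decr_rearr :: "('m \<Rightarrow> real) \<Rightarrow> nat \<Rightarrow> real" where
  "decr_rearr a n = spectral_scale (diag_op a) (int n + 1)"

definition submajorized :: "('m \<Rightarrow> real) \<Rightarrow> ('n \<Rightarrow> real) \<Rightarrow> bool" (infix \<open>\<prec>\<^sub>w\<close> 50) where
  "a \<prec>\<^sub>w b \<longleftrightarrow> (\<forall>k\<ge>1. (\<Sum>i<k. decr_rearr a i) \<le> (\<Sum>i<k. decr_rearr b i))"

end

theory Submission
  imports Defs
begin

text \<open>
  Testing \<open>T = A X - X B\<close> against a contraction \<open>Z\<close> of rank at most \<open>k\<close> gives
  \<open>Re tr (T Z) = Re tr ((A \<oplus> B) (X Z \<oplus> - Z X))\<close>, which involves only finitely many vectors.
  Diagonalize the form of \<open>A \<oplus> B\<close> and the form \<open>\<langle>X x, X y\<rangle>\<close> on finite-dimensional subspaces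
  containing these vectors, with eigenvalues \<open>\<gamma>\<^sub>1 \<ge> \<dots> \<ge> \<gamma>\<^sub>N\<close> and square roots
  \<open>\<sigma>\<^sub>1 \<ge> \<dots> \<ge> \<sigma>\<^sub>n\<close> of the eigenvalues. The trace becomes \<open>\<Sum>\<^sub>r\<^sub>j \<gamma>\<^sub>r \<sigma>\<^sub>j M\<^sub>r\<^sub>j\<close>, where the sum of \<open>M\<close> over
  \<open>r \<le> s\<close>, \<open>j \<le> t\<close> is at most \<open>min {s, N - s, t, k}\<close>, because \<open>Z P - P Z\<close> is half the difference of two
  contractions for a projection \<open>P\<close>. Summation by parts in both indices gives the bound
  \<open>\<Sum>\<^sub>i (\<gamma>\<^sub>i - \<gamma>\<^sub>N\<^sub>+\<^sub>1\<^sub>-\<^sub>i) \<sigma>\<^sub>i\<close> over \<open>i \<le> k\<close>, and by the min-max principle each summand is at most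
  the corresponding entry of \<open>Spr\<^sup>+(A \<oplus> B) \<cdot> s(X)\<close>.
\<close>

section \<open>Complex inner products\<close>


text \<open>The obstacle is that none of the operators need have eigenvectors: on an
  infinite-dimensional space the infima and suprema of the spectral scale may fail to be attained.
  All values computed on finite-dimensional subspaces therefore bound the scales from one side only.
  This is the useful side, because each \<open>g i\<close>, the product of a gap \<gamma> i -
  \<gamma> (N - 1 - i) and \<sigma> i, has nonnegative factors, so enlarging both factors enlarges
  the bound. The direct sum lets one diagonalization serve A and B together. The block operator with
  diagonal X Z and - Z X has trace zero, in accordance with A X - X B being unchanged when the same
  scalar is added to A and to B; hence only differences of the \<gamma> can survive. The constant 1
  is the delicate point. Bounding Z P and P Z separately loses a factor 2; replacing P by the
  reflection 2 P - 1 recovers it, since the identity part cancels in the commutator. For the row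
  sums the same factor is saved by the two components of a unit vector sharing the total mass
  1.\<close>

lemma cinner_add_right: "cinner x (y + z) = cinner x y + cinner x z"
  by (metis cinner_add_left cinner_commute complex_cnj_add)

lemma cinner_scaleC_right: "cinner x (c *\<^sub>C y) = cnj c * cinner x y"
  by (metis cinner_scaleC_left cinner_commute complex_cnj_mult)

lemma cinner_zero_left [simp]: "cinner 0 x = 0"
  using cinner_add_left[of 0 0 x] by simp

lemma cinner_zero_right [simp]: "cinner x 0 = 0"
  using cinner_add_right[of x 0 0] by simp

lemma cinner_minus_left: "cinner (- x) y = - cinner x y"
  using cinner_add_left[of x "- x" y] by (simp add: eq_neg_iff_add_eq_0 add.commute)

lemma cinner_minus_right: "cinner x (- y) = - cinner x y"
  using cinner_add_right[of x y "- y"] by (simp add: eq_neg_iff_add_eq_0 add.commute)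

lemma cinner_diff_left: "cinner (x - y) z = cinner x z - cinner y z"
  using cinner_add_left[of x "- y" z] by (simp add: cinner_minus_left)

lemma cinner_diff_right: "cinner x (y - z) = cinner x y - cinner x z"
  using cinner_add_right[of x y "- z"] by (simp add: cinner_minus_right)

lemma cinner_scaleR_left: "cinner (r *\<^sub>R x) y = r * cinner x y"
  by (metis cinner_scaleC_left scaleC_of_real)

lemma cinner_scaleR_right: "cinner x (r *\<^sub>R y) = r * cinner x y"
  by (metis cinner_scaleC_right scaleC_of_real complex_cnj_complex_of_real)

lemma cinner_sum_left: "cinner (\<Sum>i\<in>I. f i) y = (\<Sum>i\<in>I. cinner (f i) y)"
  by (induction I rule: infinite_finite_induct) (auto simp: cinner_add_left)

lemma cinner_sum_right: "cinner y (\<Sum>i\<in>I. f i) = (\<Sum>i\<in>I. cinner y (f i))"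
  by (induction I rule: infinite_finite_induct) (auto simp: cinner_add_right)

lemmas cinner_simps =
  cinner_add_left cinner_add_right cinner_diff_left cinner_diff_right cinner_minus_left
  cinner_minus_right cinner_scaleC_left cinner_scaleC_right cinner_scaleR_left cinner_scaleR_right
  cinner_sum_left cinner_sum_right

lemma cinner_self: "cinner x x = complex_of_real ((norm x)\<^sup>2)"
proof (rule complex_eqI)
  show "Re (cinner x x) = Re (complex_of_real ((norm x)\<^sup>2))"
    by (simp add: Re_cinner power2_norm_eq_inner)
  show "Im (cinner x x) = Im (complex_of_real ((norm x)\<^sup>2))"
    using cinner_commute[of x x] by (metis Im_complex_of_real Reals_cnj_iff complex_is_Real_iff)
qed

lemma Re_cinner_self: "Re (cinner x x) = (norm x)\<^sup>2"
  by (simp add: cinner_self)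

lemma norm_scaleC: "norm (c *\<^sub>C x) = cmod c * norm x"
proof -
  have "cinner (c *\<^sub>C x) (c *\<^sub>C x) = complex_of_real ((cmod c)\<^sup>2 * (norm x)\<^sup>2)"
    unfolding of_real_mult complex_norm_square[of c] cinner_self[symmetric]
    by (simp add: cinner_simps mult.assoc)
  then have "(norm (c *\<^sub>C x))\<^sup>2 = (cmod c * norm x)\<^sup>2"
    unfolding cinner_self of_real_eq_iff by (simp add: power_mult_distrib)
  then show ?thesis by (simp add: power2_eq_iff_nonneg)
qed

text \<open>A unimodular factor on \<open>x\<close> makes the complex inner product real and
  nonnegative, and the real Cauchy-Schwarz inequality applies.\<close>

lemma cmod_cinner_le: "cmod (cinner x y) \<le> norm x * norm y"
proof (cases "cinner x y = 0")
  case False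
  define \<theta> where "\<theta> = cnj (cinner x y) / cmod (cinner x y)"
  have \<theta>: "cmod \<theta> = 1" using False by (simp add: \<theta>_def norm_divide)
  have "cinner (\<theta> *\<^sub>C x) y = cmod (cinner x y)"
    using False complex_norm_square[of "cinner x y"]
    by (simp add: \<theta>_def cinner_simps power2_eq_square mult.commute nonzero_divide_eq_eq)
  then have "cmod (cinner x y) = inner (\<theta> *\<^sub>C x) y"
    by (metis Re_cinner Re_complex_of_real)
  also have "\<dots> \<le> norm (\<theta> *\<^sub>C x) * norm y"
    by (rule norm_cauchy_schwarz)
  finally show ?thesis by (simp add: norm_scaleC \<theta>)
qed simp

lemma abs_Re_cinner_le: "\<bar>Re (cinner x y)\<bar> \<le> norm x * norm y"
  using abs_Re_le_cmod cmod_cinner_le order_trans by blast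

lemma cinner_eqI: "(\<And>z. cinner x z = cinner y z) \<Longrightarrow> x = y"
  using cinner_self[of "x - y"] by (simp add: cinner_diff_left)

lemma mult_cinner_commute: "cinner x y * cinner y x = complex_of_real ((cmod (cinner x y))\<^sup>2)"
  by (metis cinner_commute complex_norm_square)

section \<open>Operators\<close>

lemma bounded_clinear_add: "bounded_clinear T \<Longrightarrow> T (x + y) = T x + T y"
  by (simp add: bounded_clinear_def bounded_linear.linear linear_add)

lemma bounded_clinear_diff: "bounded_clinear T \<Longrightarrow> T (x - y) = T x - T y"
  by (simp add: bounded_clinear_def bounded_linear.linear linear_diff)

lemma bounded_clinear_minus: "bounded_clinear T \<Longrightarrow> T (- x) = - T x"
  by (simp add: bounded_clinear_def bounded_linear.linear linear_neg)

lemma bounded_clinear_zero: "bounded_clinear T \<Longrightarrow> T 0 = 0"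
  by (simp add: bounded_clinear_def bounded_linear.linear linear_0)

lemma bounded_clinear_sum: "bounded_clinear T \<Longrightarrow> T (\<Sum>i\<in>I. f i) = (\<Sum>i\<in>I. T (f i))"
  by (simp add: bounded_clinear_def bounded_linear.linear linear_sum)

lemma bounded_clinear_scaleR: "bounded_clinear T \<Longrightarrow> T (r *\<^sub>R x) = r *\<^sub>R T x"
  by (simp add: bounded_clinear_def bounded_linear.linear linear_scale)

lemma bounded_clinear_scaleC: "bounded_clinear T \<Longrightarrow> T (c *\<^sub>C x) = c *\<^sub>C T x"
  by (simp add: bounded_clinear_def)

lemmas bounded_clinear_simps =
  bounded_clinear_add bounded_clinear_diff bounded_clinear_minus bounded_clinear_zero
  bounded_clinear_sum bounded_clinear_scaleR bounded_clinear_scaleC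

lemma bounded_clinear_bounded:
  assumes "bounded_clinear T"
  obtains K where "K > 0" "\<And>x. norm (T x) \<le> K * norm x"
proof -
  obtain K where "K > 0" "\<And>x. norm (T x) \<le> norm x * K"
    using assms bounded_linear.pos_bounded unfolding bounded_clinear_def by blast
  then show ?thesis using that by (simp add: mult.commute)
qed

lemma bounded_clinearI:
  assumes "\<And>x y. T (x + y) = T x + T y" "\<And>c x. T (c *\<^sub>C x) = c *\<^sub>C T x"
    "\<And>x. norm (T x) \<le> K * norm x"
  shows "bounded_clinear T"
  unfolding bounded_clinear_def
proof (intro conjI allI assms(2))
  show "bounded_linear T"
  proof (rule bounded_linear_intro)
    show "T (r *\<^sub>R x) = r *\<^sub>R T x" for r x
      using assms(2)[of "complex_of_real r" x] by (simp add: scaleC_of_real)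
    show "norm (T x) \<le> norm x * K" for x using assms(3)[of x] by (simp add: mult.commute)
  qed (rule assms(1))
qed

lemma scaleC_scaleR: "c *\<^sub>C r *\<^sub>R x = r *\<^sub>R c *\<^sub>C x"
  by (metis complex_vector.scale_left_commute scaleC_of_real)

lemma bounded_clinear_compose:
  assumes "bounded_clinear S" "bounded_clinear T"
  shows "bounded_clinear (\<lambda>x. S (T x))"
  using assms bounded_linear_compose unfolding bounded_clinear_def by auto

lemma bounded_clinear_sub:
  assumes "bounded_clinear S" "bounded_clinear T"
  shows "bounded_clinear (\<lambda>x. S x - T x)"
  using assms bounded_linear_sub unfolding bounded_clinear_def
  by (auto simp: complex_vector.scale_right_diff_distrib)

lemma bounded_clinear_scaleR_fun:
  assumes "bounded_clinear T"
  shows "bounded_clinear (\<lambda>x. r *\<^sub>R T x)"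
  using assms bounded_linear_compose[OF bounded_linear_scaleR_right] unfolding bounded_clinear_def
  by (auto simp: scaleC_scaleR)

lemma bounded_clinear_id: "bounded_clinear (\<lambda>x. x)"
  unfolding bounded_clinear_def by auto

lemma selfadjoint_cinner_real:
  assumes "selfadjoint T"
  shows "cinner (T x) x = complex_of_real (Re (cinner (T x) x))"
  using assms cinner_commute[of "T x" x] unfolding selfadjoint_def
  by (metis Reals_cnj_iff of_real_Re)

text \<open>The usual quadratic in a real parameter, with positivity required on \<open>V\<close>
  only. The diagonalization of forms applies this to a form \<gamma> - R that is nonnegative merely
  on the vectors orthogonal to the maximizers already found.\<close>

lemma positive_form_cauchy_schwarz:
  assumes T: "bounded_clinear T" "selfadjoint T"
    and V: "complex_vector.subspace V" "x \<in> V" "y \<in> V"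
    and pos: "\<And>z. z \<in> V \<Longrightarrow> 0 \<le> Re (cinner (T z) z)"
  shows "(cmod (cinner (T x) y))\<^sup>2 \<le> Re (cinner (T x) x) * Re (cinner (T y) y)"
proof -
  define a b c where "a = Re (cinner (T x) x)" and "b = Re (cinner (T y) y)"
    and "c = cinner (T x) y"
  have ab: "a \<ge> 0" "b \<ge> 0" using pos V by (auto simp: a_def b_def)
  have key: "0 \<le> a - 2 * t * (cmod c)\<^sup>2 + t\<^sup>2 * (cmod c)\<^sup>2 * b" for t :: real
  proof -
    define w where "w = - complex_of_real t * c"
    have yx: "cinner (T y) x = cnj c"
      using T(2) unfolding c_def selfadjoint_def by (metis cinner_commute)
    have yy: "cinner (T y) y = complex_of_real b"
      unfolding b_def by (rule selfadjoint_cinner_real[OF T(2)])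
    have "x + w *\<^sub>C y \<in> V"
      using V by (simp add: complex_vector.subspace_add complex_vector.subspace_scale)
    then have "0 \<le> Re (cinner (T (x + w *\<^sub>C y)) (x + w *\<^sub>C y))" by (rule pos)
    also have "cinner (T (x + w *\<^sub>C y)) (x + w *\<^sub>C y)
        = cinner (T x) x + cnj w * c + w * cnj c + w * cnj w * b"
      using T(1) by (simp add: bounded_clinear_simps cinner_simps c_def[symmetric] yx yy algebra_simps)
    also have "Re \<dots> = a - 2 * t * (cmod c)\<^sup>2 + t\<^sup>2 * (cmod c)\<^sup>2 * b"
      by (simp only: cmod_power2) (simp add: a_def w_def power2_eq_square algebra_simps)
    finally show ?thesis .
  qed
  have "(cmod c)\<^sup>2 \<le> a * b"
  proof (cases "b = 0")
    case True
    show ?thesis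
    proof (rule ccontr)
      assume "\<not> ?thesis"
      then have "(cmod c)\<^sup>2 > 0" using True by simp
      \<comment> \<open>For \<open>b = 0\<close> the quadratic degenerates to a - 2 t |c|^2; this
        value of \<open>t\<close> makes it - a - 2.\<close>
      then show False using key[of "(a + 1) / (cmod c)\<^sup>2"] True ab by simp
    qed
  next
    case False
    then have "b > 0" using ab by simp
    have "0 \<le> a - 2 * (1 / b) * (cmod c)\<^sup>2 + (1 / b)\<^sup>2 * (cmod c)\<^sup>2 * b" by (rule key)
    also have "\<dots> = a - (cmod c)\<^sup>2 / b" using \<open>b > 0\<close> by (simp add: field_simps power2_eq_square)
    finally show ?thesis using \<open>b > 0\<close> by (simp add: field_simps)
  qed
  then show ?thesis by (simp add: a_def b_def c_def)
qed

lemma positive_op_cauchy_schwarz: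
  assumes "bounded_clinear T" "positive_op T"
  shows "(cmod (cinner (T x) y))\<^sup>2 \<le> Re (cinner (T x) x) * Re (cinner (T y) y)"
  using assms unfolding positive_op_def
  by (intro positive_form_cauchy_schwarz[where V = UNIV]) auto

lemma positive_op_null:
  assumes "bounded_clinear T" "positive_op T" "Re (cinner (T x) x) = 0"
  shows "T x = 0"
  using positive_op_cauchy_schwarz[OF assms(1,2), of x "T x"] assms(3)
  by (simp add: cinner_self)

section \<open>Adjoints\<close>

text \<open>The representing vector z is the minimizer of q x = |x|^2 - 2 Re (f x), which is |x -
  z|^2 up to a constant. A minimizing sequence is Cauchy by the parallelogram law, in which the
  linear part of q drops out.\<close>

lemma riesz_representation:
  fixes f :: "'a :: chilbert_space \<Rightarrow> complex"
  assumes add: "\<And>x y. f (x + y) = f x + f y" and scale: "\<And>c x. f (c *\<^sub>C x) = c * f x"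
    and bound: "\<And>x. cmod (f x) \<le> K * norm x"
  shows "\<exists>z. \<forall>x. f x = cinner x z"
proof -
  define q where "q x = (norm x)\<^sup>2 - 2 * Re (f x)" for x
  have scaleR: "f (r *\<^sub>R x) = r * f x" for r x by (metis scale scaleC_of_real)
  have lower: "- (K\<^sup>2) \<le> q x" for x
  proof -
    have "Re (f x) \<le> K * norm x" using bound[of x] complex_Re_le_cmod[of "f x"] by linarith
    moreover have "0 \<le> (norm x - K)\<^sup>2" by simp
    ultimately show ?thesis unfolding q_def power2_diff by (simp add: mult.commute)
  qed
  define m where "m = (INF x. q x)"
  have bdd: "bdd_below (range q)" using lower by (auto intro!: bdd_belowI2)
  have m_le: "m \<le> q x" for x unfolding m_def using bdd by (auto intro: cINF_lower)
  have "\<exists>x. q x < m + 1 / Suc n" for n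
    using cINF_less_iff[of UNIV q "m + 1 / Suc n"] bdd unfolding m_def by simp
  then obtain s where s: "\<And>n. q (s n) < m + 1 / Suc n" by metis
  have par: "(norm (x - y))\<^sup>2 = 2 * q x + 2 * q y - 4 * q ((1/2) *\<^sub>R (x + y))" for x y
  proof -
    have "(norm ((1/2) *\<^sub>R (x + y)))\<^sup>2 = (norm (x + y))\<^sup>2 / 4"
      by (simp add: power_mult_distrib power_divide)
    moreover have "(norm (x - y))\<^sup>2 + (norm (x + y))\<^sup>2 = 2 * (norm x)\<^sup>2 + 2 * (norm y)\<^sup>2"
      by (simp add: power2_norm_eq_inner inner_simps inner_commute)
    moreover have "Re (f ((1/2) *\<^sub>R (x + y))) = (Re (f x) + Re (f y)) / 2"
      unfolding scaleR add by simp
    ultimately show ?thesis unfolding q_def by simp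
  qed
  have "Cauchy s"
  proof (rule metric_CauchyI)
    fix e :: real assume "e > 0"
    obtain M where M: "4 / e\<^sup>2 < real (Suc M)"
      using reals_Archimedean2[of "4 / e\<^sup>2"] by (metis less_Suc_eq of_nat_less_iff order_less_trans)
    have "dist (s i) (s j) < e" if "i \<ge> M" "j \<ge> M" for i j
    proof -
      have "1 / real (Suc l) \<le> 1 / real (Suc M)" if "l \<ge> M" for l
        using that by (simp add: frac_le)
      then have "q (s i) < m + 1 / Suc M" "q (s j) < m + 1 / Suc M"
        using s[of i] s[of j] that by (smt (verit))+
      then have "(norm (s i - s j))\<^sup>2 < 4 / Suc M"
        unfolding par using m_le[of "(1/2) *\<^sub>R (s i + s j)"] by simp
      also have "\<dots> < e\<^sup>2" using M \<open>e > 0\<close> by (simp add: field_simps)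
      finally show ?thesis
        using \<open>e > 0\<close> by (simp add: dist_norm power_less_imp_less_base)
    qed
    then show "\<exists>M. \<forall>i\<ge>M. \<forall>j\<ge>M. dist (s i) (s j) < e" by blast
  qed
  then obtain z where z: "s \<longlonglongrightarrow> z"
    using Cauchy_convergent_iff convergent_def by blast
  have "bounded_linear f"
    by (rule bounded_linear_intro[where K = K])
      (use add scaleR bound in \<open>auto simp: mult.commute scaleR_conv_of_real\<close>)
  then have "(\<lambda>n. q (s n)) \<longlonglongrightarrow> q z"
    unfolding q_def by (intro tendsto_intros z bounded_linear.tendsto[of f])
  moreover have "(\<lambda>n. m + 1 / Suc n) \<longlonglongrightarrow> m + 0"
    by (intro tendsto_intros LIMSEQ_Suc[OF lim_1_over_n])
  ultimately have "q z \<le> m"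
    using s by (intro LIMSEQ_le[of "\<lambda>n. q (s n)" "q z" "\<lambda>n. m + 1 / Suc n" m]) (auto intro: less_imp_le)
  then have min: "q z \<le> q x" for x using m_le[of x] by simp
  have Re_eq: "Re (f x) = Re (cinner x z)" for x
  proof -
    define d where "d = inner x z - Re (f x)"
    have "0 \<le> 2 * t * d + t\<^sup>2 * (norm x)\<^sup>2" for t :: real
    proof -
      have "q (z + t *\<^sub>R x) = q z + 2 * t * d + t\<^sup>2 * (norm x)\<^sup>2"
        unfolding q_def d_def power2_norm_eq_inner
        by (simp add: inner_simps add scaleR inner_commute power2_eq_square algebra_simps)
      then show ?thesis using min[of "z + t *\<^sub>R x"] by simp
    qed
    note quad = this
    have "d = 0"
    proof (cases "x = 0")
      case True
      have "f 0 = 0" using scaleR[of 0 0] by simp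
      then show ?thesis unfolding d_def True by simp
    next
      case False
      have "0 \<le> 2 * (- d / (norm x)\<^sup>2) * d + (- d / (norm x)\<^sup>2)\<^sup>2 * (norm x)\<^sup>2" by (rule quad)
      also have "\<dots> = - (d\<^sup>2 / (norm x)\<^sup>2)" using False by (simp add: power2_eq_square field_simps)
      finally show ?thesis using False by (simp add: divide_le_0_iff)
    qed
    then show ?thesis by (simp add: d_def Re_cinner)
  qed
  \<comment> \<open>Re (f (i x)) = - Im (f x), so agreement of the real parts at \<open>x\<close>
    and at i x gives both parts.\<close>
  have "f x = cinner x z" for x
    using Re_eq[of x] Re_eq[of "\<i> *\<^sub>C x"] by (simp add: scale cinner_simps complex_eq_iff)
  then show ?thesis by blast
qed

lemma cadjoint_eq:
  fixes T :: "'a :: chilbert_space \<Rightarrow> 'b :: complex_inner"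
  assumes T: "bounded_clinear T"
  shows "cinner (T x) y = cinner x (cadjoint T y)"
proof -
  obtain K where K: "K > 0" "\<And>x. norm (T x) \<le> K * norm x" by (rule bounded_clinear_bounded[OF T]) (rule that)
  have "\<exists>z. \<forall>x. cinner (T x) y = cinner x z" for y
  proof (rule riesz_representation)
    fix x
    have "cmod (cinner (T x) y) \<le> norm (T x) * norm y" by (rule cmod_cinner_le)
    also have "\<dots> \<le> (K * norm x) * norm y" by (intro mult_right_mono K) simp
    finally show "cmod (cinner (T x) y) \<le> (K * norm y) * norm x" by (simp add: mult_ac)
  qed (use T in \<open>auto simp: bounded_clinear_simps cinner_simps\<close>)
  then obtain S where S: "\<forall>x y. cinner (T x) y = cinner x (S y)" by metis
  have "\<forall>x y. cinner (T x) y = cinner x (cadjoint T y)"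
    unfolding cadjoint_def
  proof (rule theI[where P = "\<lambda>S. \<forall>x y. cinner (T x) y = cinner x (S y)", OF S])
    fix S' assume S': "\<forall>x y. cinner (T x) y = cinner x (S' y)"
    show "S' = S"
    proof
      fix y
      have "cinner x (S' y) = cinner x (S y)" for x using S S' by metis
      then show "S' y = S y" by (metis cinner_commute cinner_eqI)
    qed
  qed
  then show ?thesis by blast
qed

lemma cadjoint_eq_left:
  fixes T :: "'a :: chilbert_space \<Rightarrow> 'b :: complex_inner"
  assumes T: "bounded_clinear T"
  shows "cinner (cadjoint T y) x = cinner y (T x)"
  unfolding cinner_commute[of "cadjoint T y"] cadjoint_eq[OF T, symmetric]
  by (rule cinner_commute[symmetric])

lemma bounded_clinear_cadjoint:
  fixes T :: "'a :: chilbert_space \<Rightarrow> 'b :: complex_inner"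
  assumes T: "bounded_clinear T"
  shows "bounded_clinear (cadjoint T)"
proof -
  obtain K where K: "K > 0" "\<And>x. norm (T x) \<le> K * norm x" by (rule bounded_clinear_bounded[OF T]) (rule that)
  show ?thesis
  proof (rule bounded_clinearI)
    fix y
    have "(norm (cadjoint T y))\<^sup>2 = Re (cinner y (T (cadjoint T y)))"
      by (simp add: Re_cinner_self flip: cadjoint_eq_left[OF T])
    also have "\<dots> \<le> norm y * norm (T (cadjoint T y))"
      using abs_Re_cinner_le[of y "T (cadjoint T y)"] by linarith
    also have "\<dots> \<le> norm y * (K * norm (cadjoint T y))"
      by (intro mult_left_mono K) simp
    finally have le: "norm (cadjoint T y) * norm (cadjoint T y) \<le> (K * norm y) * norm (cadjoint T y)"
      by (simp add: power2_eq_square mult_ac)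
    then show "norm (cadjoint T y) \<le> K * norm y"
    proof (cases "norm (cadjoint T y) = 0")
      case True
      then show ?thesis using K(1) by simp
    next
      case False
      then have "0 < norm (cadjoint T y)" by simp
      with le show ?thesis by (rule mult_right_le_imp_le)
    qed
  next
    show "cadjoint T (x + y) = cadjoint T x + cadjoint T y" for x y
      by (rule cinner_eqI) (simp add: cadjoint_eq_left[OF T] cinner_add_left)
    show "cadjoint T (c *\<^sub>C x) = c *\<^sub>C cadjoint T x" for c x
      by (rule cinner_eqI) (simp add: cadjoint_eq_left[OF T] cinner_scaleC_left)
  qed
qed

section \<open>Square roots of positive operators\<close>

fun sqrt_iter :: "('a :: real_normed_vector \<Rightarrow> 'a) \<Rightarrow> nat \<Rightarrow> 'a \<Rightarrow> 'a" where
  "sqrt_iter S 0 x = 0"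
| "sqrt_iter S (Suc n) x = (1/2) *\<^sub>R (S x + sqrt_iter S n (sqrt_iter S n x))"

text \<open>The same iteration for the scalar S = 1. The iterates and their increments are
  polynomials in S with nonnegative coefficients, so for a contraction their norms are dominated by
  these numbers and their increments.\<close>

fun sqrt_bound :: "nat \<Rightarrow> real" where
  "sqrt_bound 0 = 0"
| "sqrt_bound (Suc n) = (1 + (sqrt_bound n)\<^sup>2) / 2"

lemma sqrt_bound_range: "0 \<le> sqrt_bound n" "sqrt_bound n \<le> 1"
  by (induction n) (auto simp: power_le_one)

lemma sqrt_bound_mono: "sqrt_bound n \<le> sqrt_bound (Suc n)"
proof -
  have "0 \<le> (1 - sqrt_bound n)\<^sup>2" by simp
  then show ?thesis by (simp add: power2_diff)
qed

lemma Cauchy_sqrt_bound: "Cauchy sqrt_bound"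
proof -
  have "incseq sqrt_bound" using sqrt_bound_mono incseq_SucI by blast
  then show ?thesis
    by (metis incseq_convergent sqrt_bound_range(2) convergentI convergent_Cauchy)
qed

lemma bounded_clinear_sqrt_iter:
  assumes "bounded_clinear S"
  shows "bounded_clinear (sqrt_iter S n)"
proof (induction n)
  case 0
  show ?case by (rule bounded_clinearI[where K = 0]) auto
next
  case (Suc n)
  have "bounded_linear (\<lambda>x. S x + sqrt_iter S n (sqrt_iter S n x))"
    using assms bounded_clinear_compose[OF Suc Suc] bounded_linear_add
    unfolding bounded_clinear_def by blast
  moreover have "S (c *\<^sub>C x) + sqrt_iter S n (sqrt_iter S n (c *\<^sub>C x))
      = c *\<^sub>C (S x + sqrt_iter S n (sqrt_iter S n x))" for c x
    using assms Suc by (simp add: bounded_clinear_scaleC scaleC_add_right)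
  ultimately have "bounded_clinear (\<lambda>x. S x + sqrt_iter S n (sqrt_iter S n x))"
    by (simp add: bounded_clinear_def)
  from bounded_clinear_scaleR_fun[OF this, of "1/2"] show ?case
    by (subst sqrt_iter.simps(2)[abs_def])
qed

lemma norm_sqrt_iter_le:
  assumes "\<And>x. norm (S x) \<le> norm x"
  shows "norm (sqrt_iter S n x) \<le> sqrt_bound n * norm x"
proof (induction n arbitrary: x)
  case (Suc n)
  have "norm (sqrt_iter S n (sqrt_iter S n x)) \<le> sqrt_bound n * norm (sqrt_iter S n x)" by (rule Suc)
  also have "\<dots> \<le> sqrt_bound n * (sqrt_bound n * norm x)"
    by (intro mult_left_mono Suc sqrt_bound_range)
  finally have "norm (S x + sqrt_iter S n (sqrt_iter S n x)) \<le> norm x + (sqrt_bound n)\<^sup>2 * norm x"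
    using assms[of x] norm_triangle_ineq[of "S x" "sqrt_iter S n (sqrt_iter S n x)"]
    by (simp add: power2_eq_square mult_ac)
  moreover have "norm (sqrt_iter S (Suc n) x) = norm (S x + sqrt_iter S n (sqrt_iter S n x)) / 2"
    unfolding sqrt_iter.simps norm_scaleR by simp
  ultimately show ?case by (simp add: field_simps del: sqrt_iter.simps)
qed simp

text \<open>Y' Y' - Y Y = (Y' - Y) Y' + Y (Y' - Y) for consecutive iterates. The induction
  hypothesis bounds the two terms by (y' - y) y' and y (y' - y), whose sum y'^2 - y^2 is twice the
  next increment of the scalar iteration.\<close>

lemma norm_sqrt_iter_step:
  assumes S: "bounded_clinear S" "\<And>x. norm (S x) \<le> norm x"
  shows "norm (sqrt_iter S (Suc n) x - sqrt_iter S n x)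
    \<le> (sqrt_bound (Suc n) - sqrt_bound n) * norm x"
proof (induction n arbitrary: x)
  case 0
  then show ?case using S(2)[of x] by simp
next
  case (Suc n)
  define Y where "Y n = sqrt_iter S n" for n
  define y where "y n = sqrt_bound n" for n
  have lin: "bounded_clinear (Y n)" for n unfolding Y_def by (rule bounded_clinear_sqrt_iter[OF S(1)])
  have IH: "norm (Y (Suc n) x - Y n x) \<le> (y (Suc n) - y n) * norm x" for x
    using Suc unfolding Y_def y_def .
  have le: "norm (Y n x) \<le> y n * norm x" for n x
    unfolding Y_def y_def by (rule norm_sqrt_iter_le[OF S(2)])
  have d: "0 \<le> y (Suc n) - y n" using sqrt_bound_mono[of n] unfolding y_def by simp
  have Y_Suc: "Y (Suc n) x = (1/2) *\<^sub>R (S x + Y n (Y n x))" for n x unfolding Y_def by simp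
  have "Y (Suc (Suc n)) x - Y (Suc n) x
      = (1/2) *\<^sub>R (Y (Suc n) (Y (Suc n) x) - Y n (Y n x))"
    unfolding Y_Suc[of "Suc n"] Y_Suc[of n x] by (simp add: scaleR_right_diff_distrib scaleR_right_distrib)
  also have "Y (Suc n) (Y (Suc n) x) - Y n (Y n x)
      = (Y (Suc n) (Y (Suc n) x) - Y n (Y (Suc n) x)) + Y n (Y (Suc n) x - Y n x)"
    by (simp add: bounded_clinear_diff[OF lin])
  finally have "norm (Y (Suc (Suc n)) x - Y (Suc n) x)
      \<le> (1/2) * (norm (Y (Suc n) (Y (Suc n) x) - Y n (Y (Suc n) x)) + norm (Y n (Y (Suc n) x - Y n x)))"
    by (simp add: norm_triangle_ineq)
  also have "norm (Y (Suc n) (Y (Suc n) x) - Y n (Y (Suc n) x)) \<le> (y (Suc n) - y n) * (y (Suc n) * norm x)"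
    by (rule order_trans[OF IH]) (intro mult_left_mono le d)
  also have "norm (Y n (Y (Suc n) x - Y n x)) \<le> y n * ((y (Suc n) - y n) * norm x)"
    by (rule order_trans[OF le]) (intro mult_left_mono IH, simp add: y_def sqrt_bound_range)
  also have "(1/2) * ((y (Suc n) - y n) * (y (Suc n) * norm x) + y n * ((y (Suc n) - y n) * norm x))
      = (((y (Suc n))\<^sup>2 - (y n)\<^sup>2) / 2) * norm x"
    by (simp add: field_simps power2_eq_square)
  also have "((y (Suc n))\<^sup>2 - (y n)\<^sup>2) / 2 = y (Suc (Suc n)) - y (Suc n)"
    unfolding y_def sqrt_bound.simps(2)[of "Suc n"] sqrt_bound.simps(2)[of n, symmetric]
    by (simp add: field_simps)
  finally show ?case unfolding Y_def y_def by simp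
qed

lemma norm_sqrt_iter_diff:
  assumes S: "bounded_clinear S" "\<And>x. norm (S x) \<le> norm x" and "m \<le> n"
  shows "norm (sqrt_iter S n x - sqrt_iter S m x) \<le> (sqrt_bound n - sqrt_bound m) * norm x"
  using \<open>m \<le> n\<close>
proof (induction n rule: dec_induct)
  case (step n)
  then show ?case
    using norm_sqrt_iter_step[OF S, of n x]
      norm_triangle_ineq[of "sqrt_iter S (Suc n) x - sqrt_iter S n x" "sqrt_iter S n x - sqrt_iter S m x"]
    by (simp add: algebra_simps)
qed simp

text \<open>Iterates are polynomials in S. In the limit this makes the square root commute with
  everything that commutes with S, which is what uniqueness of the square root rests on.\<close>

lemma sqrt_iter_commute:
  assumes "bounded_clinear C" "\<And>x. C (S x) = S (C x)"
  shows "C (sqrt_iter S n x) = sqrt_iter S n (C x)"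
  by (induction n arbitrary: x) (auto simp: bounded_clinear_simps[OF assms(1)] assms(2))

lemma sqrt_iter_selfadjoint:
  assumes "selfadjoint S"
  shows "cinner (sqrt_iter S n x) y = cinner x (sqrt_iter S n y)"
  using assms unfolding selfadjoint_def
  by (induction n arbitrary: x y) (auto simp: cinner_simps)

text \<open>For a selfadjoint contraction \<open>S\<close>, the limit \<open>Y\<close> of the iteration solves \<open>2 Y = S + Y\<^sup>2\<close>,
  so that \<open>1 - Y\<close> is a square root of \<open>1 - S\<close>.\<close>

lemma sqrt_of_contraction_complement:
  fixes S :: "'a :: chilbert_space \<Rightarrow> 'a"
  assumes S: "bounded_clinear S" "selfadjoint S" "\<And>x. norm (S x) \<le> norm x"
  obtains R where "bounded_clinear R" "positive_op R" "\<And>x. R (R x) = x - S x"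
    "\<forall>C. bounded_clinear C \<longrightarrow> (\<forall>x. C (S x) = S (C x)) \<longrightarrow> (\<forall>x. C (R x) = R (C x))"
proof -
  define Y where "Y n = sqrt_iter S n" for n
  have lin: "bounded_clinear (Y n)" for n unfolding Y_def by (rule bounded_clinear_sqrt_iter[OF S(1)])
  have le: "norm (Y n x) \<le> norm x" for n x
    unfolding Y_def using norm_sqrt_iter_le[OF S(3), of n x] sqrt_bound_range[of n]
    by (smt (verit) mult_left_le_one_le norm_ge_zero)
  have "Cauchy (\<lambda>n. Y n x)" for x
  proof (rule CauchyI)
    fix e :: real assume "e > 0"
    then have "e / (norm x + 1) > 0" by (smt (verit) divide_pos_pos norm_ge_zero)
    then obtain M where M: "\<And>m n. m \<ge> M \<Longrightarrow> n \<ge> M \<Longrightarrow> norm (sqrt_bound m - sqrt_bound n) < e / (norm x + 1)"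
      using CauchyD[OF Cauchy_sqrt_bound] by metis
    have ord: "norm (Y n x - Y m x) < e" if "M \<le> m" "m \<le> n" for m n
    proof -
      have "norm (Y n x - Y m x) \<le> (sqrt_bound n - sqrt_bound m) * norm x"
        unfolding Y_def by (rule norm_sqrt_iter_diff[OF S(1,3) that(2)])
      also have "\<dots> \<le> norm (sqrt_bound n - sqrt_bound m) * (norm x + 1)"
        by (intro mult_mono) auto
      also have "\<dots> < e"
        using M[of n m] that by (simp add: pos_less_divide_eq add_nonneg_pos)
      finally show ?thesis .
    qed
    have "norm (Y m x - Y n x) < e" if "m \<ge> M" "n \<ge> M" for m n
      using ord[of m n] ord[of n m] that by (metis linear norm_minus_commute)
    then show "\<exists>M. \<forall>m\<ge>M. \<forall>n\<ge>M. norm (Y m x - Y n x) < e" by blast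
  qed
  then have "\<forall>x. \<exists>l. (\<lambda>n. Y n x) \<longlonglongrightarrow> l"
    using Cauchy_convergent_iff convergent_def by blast
  then obtain L where L: "\<And>x. (\<lambda>n. Y n x) \<longlonglongrightarrow> L x" by metis
  have Lle: "norm (L x) \<le> norm x" for x
    by (rule LIMSEQ_le_const2[OF tendsto_norm[OF L]]) (use le in auto)
  have Ladd: "L (x + y) = L x + L y" for x y
  proof (rule LIMSEQ_unique[OF L])
    show "(\<lambda>n. Y n (x + y)) \<longlonglongrightarrow> L x + L y"
      unfolding bounded_clinear_add[OF lin] by (intro tendsto_intros L)
  qed
  have commute: "C (L x) = L (C x)" if C: "bounded_clinear C" "\<And>x. C (S x) = S (C x)" for C x
  proof (rule LIMSEQ_unique)
    show "(\<lambda>n. Y n (C x)) \<longlonglongrightarrow> L (C x)" by (rule L)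
    have "bounded_linear C" using C(1) by (simp add: bounded_clinear_def)
    then have "(\<lambda>n. C (Y n x)) \<longlonglongrightarrow> C (L x)" by (rule bounded_linear.tendsto[OF _ L])
    then show "(\<lambda>n. Y n (C x)) \<longlonglongrightarrow> C (L x)"
      unfolding Y_def using sqrt_iter_commute[of C S, OF C] by simp
  qed
  \<comment> \<open>Homogeneity is an instance of \<open>commute\<close>: multiplication by a scalar
    commutes with S.\<close>
  have "L (c *\<^sub>C x) = c *\<^sub>C L x" for c x
  proof (rule commute[symmetric])
    show "bounded_clinear (\<lambda>x. c *\<^sub>C x)"
      by (rule bounded_clinearI[where K = "cmod c"])
        (auto simp: scaleC_add_right norm_scaleC complex_vector.scale_left_commute)
  qed (simp add: bounded_clinear_scaleC[OF S(1)])
  then have Llin: "bounded_clinear L"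
    using Ladd Lle by (intro bounded_clinearI[where K = 1]) auto
  have cinner_tendsto: "(\<lambda>n. cinner (Y n x) y) \<longlonglongrightarrow> cinner (L x) y" for x y
  proof -
    have "bounded_linear (\<lambda>x. cinner x y)"
      by (rule bounded_linear_intro[where K = "norm y"])
        (auto simp: cinner_simps cmod_cinner_le scaleR_conv_of_real)
    then show ?thesis by (rule bounded_linear.tendsto[OF _ L])
  qed
  have Lsa: "cinner (L x) y = cinner x (L y)" for x y
  proof (rule LIMSEQ_unique[OF cinner_tendsto])
    have "(\<lambda>n. cnj (cinner (Y n y) x)) \<longlonglongrightarrow> cnj (cinner (L y) x)"
      by (intro tendsto_intros cinner_tendsto)
    then show "(\<lambda>n. cinner (Y n x) y) \<longlonglongrightarrow> cinner x (L y)"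
      unfolding Y_def cinner_commute[symmetric] sqrt_iter_selfadjoint[OF S(2), symmetric] .
  qed
  have fixpoint: "2 *\<^sub>R L x = S x + L (L x)" for x
  proof (rule LIMSEQ_unique)
    show "(\<lambda>n. 2 *\<^sub>R Y (Suc n) x) \<longlonglongrightarrow> 2 *\<^sub>R L x"
      by (intro tendsto_intros LIMSEQ_Suc[OF L])
    \<comment> \<open>Pointwise convergence of Y n does not by itself give convergence of Y n (Y n
      x). The difference to Y n (L x) tends to 0 because all Y n are contractions.\<close>
    have "(\<lambda>n. Y n (Y n x - L x)) \<longlonglongrightarrow> 0"
    proof (rule tendsto_norm_zero_cancel, rule Lim_null_comparison)
      show "\<forall>\<^sub>F n in sequentially. norm (norm (Y n (Y n x - L x))) \<le> norm (Y n x - L x)"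
        using le by simp
      show "(\<lambda>n. norm (Y n x - L x)) \<longlonglongrightarrow> 0"
        using L by (simp add: LIM_zero tendsto_norm_zero)
    qed
    then have "(\<lambda>n. S x + (Y n (Y n x - L x) + Y n (L x))) \<longlonglongrightarrow> S x + (0 + L (L x))"
      by (intro tendsto_intros L)
    then show "(\<lambda>n. 2 *\<^sub>R Y (Suc n) x) \<longlonglongrightarrow> S x + L (L x)"
      by (simp add: bounded_clinear_diff[OF lin]) (simp add: Y_def)
  qed
  show ?thesis
  proof (rule that)
    show "bounded_clinear (\<lambda>x. x - L x)"
      by (rule bounded_clinear_sub[OF bounded_clinear_id Llin])
    show "positive_op (\<lambda>x. x - L x)"
      unfolding positive_op_def selfadjoint_def
    proof (intro conjI allI)
      show "cinner (x - L x) y = cinner x (y - L y)" for x y by (simp add: cinner_simps Lsa)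
      show "0 \<le> Re (cinner (x - L x) x)" for x
      proof -
        have "Re (cinner (L x) x) \<le> norm (L x) * norm x"
          using abs_Re_cinner_le[of "L x" x] by linarith
        also have "\<dots> \<le> (norm x)\<^sup>2"
          using Lle by (simp add: power2_eq_square mult_right_mono)
        finally show ?thesis by (simp add: cinner_simps Re_cinner_self)
      qed
    qed
    show "(x - L x) - L (x - L x) = x - S x" for x
      using fixpoint[of x] by (simp add: bounded_clinear_diff[OF Llin] scaleR_2 algebra_simps)
    show "\<forall>C. bounded_clinear C \<longrightarrow> (\<forall>x. C (S x) = S (C x)) \<longrightarrow> (\<forall>x. C (x - L x) = C x - L (C x))"
      using commute by (simp add: bounded_clinear_diff)
  qed
qed

text \<open>Scaling by a bound K of T gives S = 1 - T / K, whose form lies between 0 and |x|^2.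
  Cauchy-Schwarz for that form at x and S x yields |S x|^4 <= |x|^2 |S x|^2, so S is a contraction,
  and sqrt K times the square root of 1 - S is the root of T.\<close>

lemma positive_sqrt_exists:
  fixes T :: "'a :: chilbert_space \<Rightarrow> 'a"
  assumes T: "bounded_clinear T" "positive_op T"
  obtains R where "bounded_clinear R" "positive_op R" "\<And>x. R (R x) = T x"
    "\<forall>C. bounded_clinear C \<longrightarrow> (\<forall>x. C (T x) = T (C x)) \<longrightarrow> (\<forall>x. C (R x) = R (C x))"
proof -
  obtain K where K: "K > 0" "\<And>x. norm (T x) \<le> K * norm x" by (rule bounded_clinear_bounded[OF T(1)]) (rule that)
  define S where "S x = x - (1 / K) *\<^sub>R T x" for x
  have sa: "cinner (T x) y = cinner x (T y)" for x y
    using T(2) by (simp add: positive_op_def selfadjoint_def)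
  have Slin: "bounded_clinear S"
    unfolding S_def by (intro bounded_clinear_sub bounded_clinear_id bounded_clinear_scaleR_fun T)
  have Ssa: "selfadjoint S"
    unfolding selfadjoint_def S_def by (simp add: cinner_simps sa)
  have form: "Re (cinner (S x) x) = (norm x)\<^sup>2 - Re (cinner (T x) x) / K" for x
    by (simp add: S_def cinner_simps cinner_self)
  have Spos: "0 \<le> Re (cinner (S x) x)" and Sle: "Re (cinner (S x) x) \<le> (norm x)\<^sup>2" for x
  proof -
    have "Re (cinner (T x) x) \<le> norm (T x) * norm x" using abs_Re_cinner_le[of "T x" x] by linarith
    also have "\<dots> \<le> K * norm x * norm x" by (intro mult_right_mono K) simp
    finally show "0 \<le> Re (cinner (S x) x)"
      unfolding form using K by (simp add: field_simps power2_eq_square)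
    show "Re (cinner (S x) x) \<le> (norm x)\<^sup>2"
      unfolding form using T(2) K by (simp add: positive_op_def)
  qed
  have contr: "norm (S x) \<le> norm x" for x
  proof -
    have "positive_op S" using Ssa Spos by (simp add: positive_op_def)
    from positive_op_cauchy_schwarz[OF Slin this, of x "S x"]
    have "((norm (S x))\<^sup>2)\<^sup>2 \<le> Re (cinner (S x) x) * Re (cinner (S (S x)) (S x))"
      by (simp add: cinner_self norm_power)
    also have "\<dots> \<le> (norm x)\<^sup>2 * (norm (S x))\<^sup>2" by (intro mult_mono Sle Spos) simp
    finally have "(norm (S x))\<^sup>2 * (norm (S x))\<^sup>2 \<le> (norm x)\<^sup>2 * (norm (S x))\<^sup>2"
      by (simp add: power2_eq_square)
    then have "S x = 0 \<or> (norm (S x))\<^sup>2 \<le> (norm x)\<^sup>2"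
      using mult_right_le_imp_le[of "(norm (S x))\<^sup>2" "(norm (S x))\<^sup>2" "(norm x)\<^sup>2"] by fastforce
    then show ?thesis by (auto simp: power2_le_iff_abs_le)
  qed
  obtain Q where Q: "bounded_clinear Q" "positive_op Q" "\<And>x. Q (Q x) = x - S x"
    "\<forall>C. bounded_clinear C \<longrightarrow> (\<forall>x. C (S x) = S (C x)) \<longrightarrow> (\<forall>x. C (Q x) = Q (C x))"
    by (rule sqrt_of_contraction_complement[OF Slin Ssa contr]) (rule that)
  show ?thesis
  proof (rule that)
    show "bounded_clinear (\<lambda>x. sqrt K *\<^sub>R Q x)" by (rule bounded_clinear_scaleR_fun[OF Q(1)])
    show "positive_op (\<lambda>x. sqrt K *\<^sub>R Q x)"
      unfolding positive_op_def selfadjoint_def cinner_scaleR_left cinner_scaleR_right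
    proof (intro conjI allI)
      show "sqrt K * cinner (Q x) y = sqrt K * cinner x (Q y)" for x y
        using Q(2) by (simp add: positive_op_def selfadjoint_def)
      show "0 \<le> Re (sqrt K * cinner (Q x) x)" for x
        using Q(2) K(1) by (simp add: positive_op_def)
    qed
    show "sqrt K *\<^sub>R Q (sqrt K *\<^sub>R Q x) = T x" for x
      using K by (simp add: bounded_clinear_scaleR[OF Q(1)] Q(3) S_def)
    show "\<forall>C. bounded_clinear C \<longrightarrow> (\<forall>x. C (T x) = T (C x))
      \<longrightarrow> (\<forall>x. C (sqrt K *\<^sub>R Q x) = sqrt K *\<^sub>R Q (C x))"
      using Q(4) by (simp add: S_def bounded_clinear_simps)
  qed
qed

text \<open>Uniqueness is what unlocks the definite description. A second root R' commutes with T =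
  R' R', hence with R. For y = R x - R' x this gives (R + R') y = 0, so both nonnegative forms
  vanish at y and R y = R' y = 0; then |y|^2 = <x, (R - R') y> = 0.\<close>

lemma sqrt_op_props:
  fixes T :: "'a :: chilbert_space \<Rightarrow> 'a"
  assumes T: "bounded_clinear T" "positive_op T"
  shows "bounded_clinear (sqrt_op T)" "positive_op (sqrt_op T)" "sqrt_op T (sqrt_op T x) = T x"
proof -
  obtain R where R: "bounded_clinear R" "positive_op R" "\<And>x. R (R x) = T x"
    "\<forall>C. bounded_clinear C \<longrightarrow> (\<forall>x. C (T x) = T (C x)) \<longrightarrow> (\<forall>x. C (R x) = R (C x))"
    by (rule positive_sqrt_exists[OF T]) (rule that)
  have unique: "R' = R" if R': "bounded_clinear R' \<and> positive_op R' \<and> R' \<circ> R' = T" for R'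
  proof
    fix x
    have R'2: "bounded_clinear R'" "positive_op R'" using R' by auto
    have sq: "R' (R' z) = T z" for z using R' by auto
    have comm: "R' (R z) = R (R' z)" for z using R(4) R'2(1) by (simp add: sq[symmetric])
    define y where "y = R x - R' x"
    have "R y + R' y = 0"
      by (simp add: y_def bounded_clinear_diff[OF R(1)] bounded_clinear_diff[OF R'2(1)] comm sq R(3))
    then have "Re (cinner (R y + R' y) y) = 0" by simp
    then have "Re (cinner (R y) y) + Re (cinner (R' y) y) = 0" by (simp add: cinner_add_left)
    moreover have "Re (cinner (R y) y) \<ge> 0" "Re (cinner (R' y) y) \<ge> 0"
      using R(2) R'2(2) by (auto simp: positive_op_def)
    ultimately have "Re (cinner (R y) y) = 0" "Re (cinner (R' y) y) = 0" by linarith+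
    then have "R y = 0" "R' y = 0"
      using positive_op_null R(1,2) R'2 by blast+
    moreover have "cinner y y = cinner x (R y) - cinner x (R' y)"
      using R(2) R'2(2) unfolding positive_op_def selfadjoint_def
      by (metis cinner_diff_left y_def)
    ultimately have "y = 0" by (simp add: cinner_self)
    then show "R' x = R x" by (simp add: y_def)
  qed
  have "bounded_clinear (sqrt_op T) \<and> positive_op (sqrt_op T) \<and> sqrt_op T \<circ> sqrt_op T = T"
    unfolding sqrt_op_def 
  proof (rule theI[where a = R])
    show "bounded_clinear R \<and> positive_op R \<and> R \<circ> R = T"
      using R(1-3) by (auto simp: fun_eq_iff)
  qed (rule unique)
  then show "bounded_clinear (sqrt_op T)" "positive_op (sqrt_op T)" "sqrt_op T (sqrt_op T x) = T x"
    by (blast, blast, metis comp_apply)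
qed


text \<open>The equality of the Gram forms of \<open>abs_op T\<close> and \<open>T\<close> stands in
  for a polar decomposition.\<close>

lemma abs_op_props:
  fixes T :: "'a :: chilbert_space \<Rightarrow> 'b :: complex_inner"
  assumes T: "bounded_clinear T"
  shows "bounded_clinear (abs_op T)" "positive_op (abs_op T)"
    "cinner (abs_op T x) (abs_op T y) = cinner (T x) (T y)" "norm (abs_op T x) = norm (T x)"
proof -
  have lin: "bounded_clinear (cadjoint T \<circ> T)"
    using bounded_clinear_compose[OF bounded_clinear_cadjoint[OF T] T] by (simp add: comp_def)
  have form: "cinner ((cadjoint T \<circ> T) x) y = cinner (T x) (T y)" for x y
    by (simp add: cadjoint_eq_left[OF T])
  have pos: "positive_op (cadjoint T \<circ> T)"
    unfolding positive_op_def selfadjoint_def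
  proof (intro conjI allI)
    show "cinner ((cadjoint T \<circ> T) x) y = cinner x ((cadjoint T \<circ> T) y)" for x y
      by (simp add: cadjoint_eq_left[OF T] cadjoint_eq[OF T, symmetric])
    show "0 \<le> Re (cinner ((cadjoint T \<circ> T) x) x)" for x
      unfolding form Re_cinner_self by simp
  qed
  note props = sqrt_op_props[OF lin pos]
  show "bounded_clinear (abs_op T)" "positive_op (abs_op T)"
    using props unfolding abs_op_def by auto
  show ip: "cinner (abs_op T x) (abs_op T y) = cinner (T x) (T y)" for x y
    using props(2,3) form[of x y] cadjoint_eq[OF T, of x "T y"] unfolding abs_op_def positive_op_def selfadjoint_def by simp
  show "norm (abs_op T x) = norm (T x)"
    by (metis ip Re_cinner_self norm_ge_zero power2_eq_iff_nonneg)
qed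


section \<open>Orthonormal families\<close>

definition orthonormal :: "(nat \<Rightarrow> 'a :: complex_inner) \<Rightarrow> nat \<Rightarrow> bool" where
  "orthonormal e n \<longleftrightarrow> (\<forall>i<n. \<forall>j<n. cinner (e i) (e j) = (if i = j then 1 else 0))"

definition suborthonormal :: "(nat \<Rightarrow> 'a :: complex_inner) \<Rightarrow> nat \<Rightarrow> bool" where
  "suborthonormal e n \<longleftrightarrow>
     (\<forall>i<n. norm (e i) \<le> 1) \<and> (\<forall>i<n. \<forall>j<n. i \<noteq> j \<longrightarrow> cinner (e i) (e j) = 0)"

definition outer_sum ::
    "(nat \<Rightarrow> 'a :: complex_inner) \<Rightarrow> (nat \<Rightarrow> 'b :: complex_inner) \<Rightarrow> nat \<Rightarrow> 'a \<Rightarrow> 'b" where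
  "outer_sum f e n x = (\<Sum>i<n. cinner x (f i) *\<^sub>C e i)"

text \<open>For orthonormal \<open>e\<close> the equation \<open>proj e n x = x\<close> expresses
  that \<open>x\<close> lies in the span of the family; subspaces are handled in this form
  throughout.\<close>

abbreviation proj :: "(nat \<Rightarrow> 'a :: complex_inner) \<Rightarrow> nat \<Rightarrow> 'a \<Rightarrow> 'a" where
  "proj e \<equiv> outer_sum e e"

lemma orthonormal_cinner: "orthonormal e n \<Longrightarrow> i < n \<Longrightarrow> j < n \<Longrightarrow> cinner (e i) (e j) = (if i = j then 1 else 0)"
  by (simp add: orthonormal_def)

lemma orthonormal_norm: "orthonormal e n \<Longrightarrow> i < n \<Longrightarrow> norm (e i) = 1"
  using orthonormal_cinner[of e n i i] Re_cinner_self[of "e i"] norm_ge_zero[of "e i"]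
  by (simp add: power2_eq_1_iff del: norm_ge_zero)

lemma orthonormal_sub: "orthonormal e n \<Longrightarrow> suborthonormal e n"
  by (auto simp: suborthonormal_def orthonormal_norm) (simp add: orthonormal_cinner)

lemma orthonormal_mono: "orthonormal e n \<Longrightarrow> m \<le> n \<Longrightarrow> orthonormal e m"
  by (auto simp: orthonormal_def)

lemma suborthonormal_mono: "suborthonormal e n \<Longrightarrow> m \<le> n \<Longrightarrow> suborthonormal e m"
  by (auto simp: suborthonormal_def)

lemma orthonormal_extend:
  assumes "orthonormal e n" "norm x = 1" "\<And>i. i < n \<Longrightarrow> cinner x (e i) = 0"
  shows "orthonormal (e(n := x)) (Suc n)"
  unfolding orthonormal_def
proof (intro allI impI)
  fix i j assume ij: "i < Suc n" "j < Suc n"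
  have "cinner (e i) x = 0" if "i < n" for i
    using assms(3)[OF that] cinner_commute[of "e i" x] by simp
  then show "cinner ((e(n := x)) i) ((e(n := x)) j) = (if i = j then 1 else 0)"
    using ij assms(2,3) by (auto simp: less_Suc_eq orthonormal_cinner[OF assms(1)] cinner_self orthonormal_norm[OF assms(1)])
qed

lemma outer_sum_add: "outer_sum f e n (x + y) = outer_sum f e n x + outer_sum f e n y"
  by (simp add: outer_sum_def cinner_simps scaleC_add_left sum.distrib)

lemma outer_sum_scaleC: "outer_sum f e n (c *\<^sub>C x) = c *\<^sub>C outer_sum f e n x"
  by (simp add: outer_sum_def cinner_simps complex_vector.scale_sum_right)

lemma outer_sum_diff: "outer_sum f e n (x - y) = outer_sum f e n x - outer_sum f e n y"
  by (simp add: outer_sum_def cinner_simps complex_vector.scale_left_diff_distrib sum_subtractf)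

lemma outer_sum_zero: "outer_sum f e n 0 = 0"
  by (simp add: outer_sum_def)

lemma outer_sum_sum: "outer_sum f e n (\<Sum>i\<in>I. g i) = (\<Sum>i\<in>I. outer_sum f e n (g i))"
  by (induction I rule: infinite_finite_induct) (auto simp: outer_sum_add outer_sum_zero)

lemma cinner_outer_sum_left:
  "cinner (outer_sum f e n x) y = (\<Sum>i<n. cinner x (f i) * cinner (e i) y)"
  by (simp add: outer_sum_def cinner_simps)

lemma cinner_outer_sum_right:
  "cinner y (outer_sum f e n x) = (\<Sum>i<n. cinner y (e i) * cinner (f i) x)"
  by (simp add: outer_sum_def cinner_simps cinner_commute[of "f _" x] mult.commute)

lemma outer_sum_adjoint: "cinner (outer_sum f e n x) y = cinner x (outer_sum e f n y)"
  by (simp add: cinner_outer_sum_left cinner_outer_sum_right)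

lemma norm_suborthonormal_combination:
  assumes "suborthonormal e n"
  shows "(norm (\<Sum>i<n. c i *\<^sub>C e i))\<^sup>2 = (\<Sum>i<n. (cmod (c i))\<^sup>2 * (norm (e i))\<^sup>2)"
proof -
  have "cinner (\<Sum>i<n. c i *\<^sub>C e i) (\<Sum>i<n. c i *\<^sub>C e i)
      = (\<Sum>i<n. \<Sum>j<n. c i * (cnj (c j) * cinner (e i) (e j)))"
    by (simp only: cinner_sum_left cinner_scaleC_left)
      (simp only: cinner_sum_right cinner_scaleC_right sum_distrib_left)
  also have "\<dots> = (\<Sum>i<n. \<Sum>j<n. if j = i then c i * (cnj (c i) * cinner (e i) (e i)) else 0)"
    using assms by (intro sum.cong refl) (auto simp: suborthonormal_def)
  also have "\<dots> = (\<Sum>i<n. complex_of_real ((cmod (c i))\<^sup>2 * (norm (e i))\<^sup>2))"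
    by (intro sum.cong refl) (simp only: sum.delta finite_lessThan cinner_self complex_norm_square of_real_mult mult.assoc if_True)
  finally show ?thesis
    unfolding cinner_self of_real_sum[symmetric] of_real_eq_iff .
qed

lemma norm_orthonormal_combination:
  assumes "orthonormal e n"
  shows "(norm (\<Sum>i<n. c i *\<^sub>C e i))\<^sup>2 = (\<Sum>i<n. (cmod (c i))\<^sup>2)"
  using norm_suborthonormal_combination[OF orthonormal_sub[OF assms]]
  by (simp add: orthonormal_norm[OF assms])

lemma norm_suborthonormal_combination_le:
  assumes "suborthonormal e n"
  shows "(norm (\<Sum>i<n. c i *\<^sub>C e i))\<^sup>2 \<le> (\<Sum>i<n. (cmod (c i))\<^sup>2)"
  unfolding norm_suborthonormal_combination[OF assms]
proof (rule sum_mono)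
  fix i assume "i \<in> {..<n}"
  then have "(norm (e i))\<^sup>2 \<le> 1" using assms by (simp add: suborthonormal_def power_le_one)
  then show "(cmod (c i))\<^sup>2 * (norm (e i))\<^sup>2 \<le> (cmod (c i))\<^sup>2"
    by (simp add: mult_left_le)
qed

lemma bessel:
  assumes "suborthonormal f n"
  shows "(\<Sum>i<n. (cmod (cinner x (f i)))\<^sup>2) \<le> (norm x)\<^sup>2"
proof -
  define p where "p = outer_sum f f n x"
  define b where "b = (\<Sum>i<n. (cmod (cinner x (f i)))\<^sup>2)"
  have "cinner p x = complex_of_real b"
    by (simp add: p_def b_def cinner_outer_sum_left mult_cinner_commute)
  then have "inner x p = b" by (metis Re_cinner Re_complex_of_real inner_commute)
  moreover have "(norm p)\<^sup>2 \<le> b"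
    unfolding p_def b_def outer_sum_def by (rule norm_suborthonormal_combination_le[OF assms])
  moreover have "(norm (x - p))\<^sup>2 = (norm x)\<^sup>2 - 2 * inner x p + (norm p)\<^sup>2"
    by (simp add: power2_norm_eq_inner inner_simps inner_commute)
  moreover have "0 \<le> (norm (x - p))\<^sup>2" by simp
  ultimately show ?thesis unfolding b_def by linarith
qed

lemma norm_outer_sum_le:
  assumes "suborthonormal f n" "suborthonormal e n"
  shows "norm (outer_sum f e n x) \<le> norm x"
proof (rule power2_le_imp_le)
  show "(norm (outer_sum f e n x))\<^sup>2 \<le> (norm x)\<^sup>2"
    unfolding outer_sum_def
    by (rule order_trans[OF norm_suborthonormal_combination_le[OF assms(2)] bessel[OF assms(1)]])
qed simp

lemma cinner_proj:
  assumes "orthonormal e n" "i < n"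
  shows "cinner (proj e n x) (e i) = cinner x (e i)"
proof -
  have "cinner (proj e n x) (e i) = (\<Sum>j<n. if j = i then cinner x (e i) else 0)"
    unfolding cinner_outer_sum_left using assms
    by (intro sum.cong refl) (auto simp: orthonormal_cinner)
  then show ?thesis using assms by simp
qed

lemma proj_base: "orthonormal e n \<Longrightarrow> i < n \<Longrightarrow> proj e n (e i) = e i"
proof -
  assume *: "orthonormal e n" "i < n"
  then have "proj e n (e i) = (\<Sum>j<n. if j = i then e i else 0)"
    unfolding outer_sum_def by (intro sum.cong refl) (auto simp: orthonormal_cinner scaleC_one)
  then show ?thesis using * by simp
qed

lemma proj_proj: "orthonormal e n \<Longrightarrow> proj e n (proj e n x) = proj e n x"
proof -
  assume e: "orthonormal e n"
  have "proj e n (proj e n x) = (\<Sum>i<n. cinner (proj e n x) (e i) *\<^sub>C e i)" by (rule outer_sum_def)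
  also have "\<dots> = (\<Sum>i<n. cinner x (e i) *\<^sub>C e i)"
    by (intro sum.cong refl) (simp add: cinner_proj[OF e])
  finally show ?thesis by (simp add: outer_sum_def)
qed

text \<open>The reflection even preserves the norm, since <P x, x> = |P x|^2.\<close>

lemma reflection_contraction:
  assumes "orthonormal e n"
  shows "norm (2 *\<^sub>R proj e n x - x) \<le> norm x"
proof -
  have "cinner (proj e n x) x = cinner (proj e n x) (proj e n x)"
    using outer_sum_adjoint[of e e n x "proj e n x"] outer_sum_adjoint[of e e n "proj e n x" x]
    by (simp add: proj_proj[OF assms])
  then have "inner (proj e n x) x = inner (proj e n x) (proj e n x)" by (metis Re_cinner)
  then have "(norm (2 *\<^sub>R proj e n x - x))\<^sup>2 = (norm x)\<^sup>2"
    by (simp add: power2_norm_eq_inner inner_simps inner_commute)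
  then show ?thesis by (simp add: power2_eq_iff_nonneg)
qed

lemma cmod_cinner_commute: "cmod (cinner x y) = cmod (cinner y x)"
  by (subst cinner_commute) simp

text \<open>Double counting of |<w i, e j>|^2: summing over j gives 1 for every i, and summing over
  i gives at most 1 for every j by Bessel.\<close>

lemma orthonormal_card_le:
  assumes e: "orthonormal e n" and w: "orthonormal w m" and "\<And>i. i < m \<Longrightarrow> proj e n (w i) = w i"
  shows "m \<le> n"
proof -
  have "real m = (\<Sum>i<m. (norm (proj e n (w i)))\<^sup>2)"
    using assms(3) by (simp add: orthonormal_norm[OF w])
  also have "\<dots> = (\<Sum>i<m. \<Sum>j<n. (cmod (cinner (w i) (e j)))\<^sup>2)"
    by (simp add: outer_sum_def norm_orthonormal_combination[OF e])
  also have "\<dots> = (\<Sum>j<n. \<Sum>i<m. (cmod (cinner (w i) (e j)))\<^sup>2)" by (rule sum.swap)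
  also have "\<dots> = (\<Sum>j<n. \<Sum>i<m. (cmod (cinner (e j) (w i)))\<^sup>2)"
    by (intro sum.cong refl arg_cong[where f = "\<lambda>t. t\<^sup>2"] cmod_cinner_commute)
  also have "\<dots> \<le> (\<Sum>j<n. (norm (e j))\<^sup>2)"
    by (intro sum_mono bessel orthonormal_sub w)
  also have "\<dots> = real n" by (simp add: orthonormal_norm[OF e])
  finally show ?thesis by simp
qed

lemma gram_schmidt:
  fixes B :: "'a :: complex_inner set"
  assumes "finite B"
  shows "\<exists>e n. orthonormal e n \<and> (\<forall>b\<in>B. proj e n b = b)"
  using assms
proof (induction B)
  case empty
  have "orthonormal (\<lambda>_. 0 :: 'a) 0" by (simp add: orthonormal_def)
  then show ?case by blast
next
  case (insert b B)
  then obtain e n where e: "orthonormal e n" and B: "\<forall>b\<in>B. proj e n b = b" by blast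
  define r where "r = b - proj e n b"
  have orth: "cinner r (e i) = 0" if "i < n" for i
    using cinner_proj[OF e that] by (simp add: r_def cinner_diff_left)
  show ?case
  proof (cases "r = 0")
    case True
    then have "proj e n b = b" by (simp add: r_def)
    then show ?thesis using e B by blast
  next
    case False
    define u where "u = (1 / norm r) *\<^sub>R r"
    have u: "norm u = 1" "\<And>i. i < n \<Longrightarrow> cinner u (e i) = 0"
      using False orth by (auto simp: u_def cinner_scaleR_left)
    define e' where "e' = e(n := u)"
    have e': "orthonormal e' (Suc n)" unfolding e'_def by (rule orthonormal_extend[OF e u])
    have fix_mono: "proj e' (Suc n) x = x" if "proj e n x = x" for x
    proof -
      have "proj e' (Suc n) x = proj e n x + cinner x u *\<^sub>C u"
        by (simp add: outer_sum_def e'_def)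
      moreover have "cinner x u = 0"
        using u(2) cinner_outer_sum_left[of e e n x u] that
        by (simp add: cinner_commute[of "e _" u])
      ultimately show ?thesis using that by simp
    qed
    have "proj e' (Suc n) u = u"
      using proj_base[OF e', of n] by (simp add: e'_def)
    moreover have "b = proj e n b + complex_of_real (norm r) *\<^sub>C u"
      using False by (simp add: u_def scaleC_of_real r_def)
    ultimately have "proj e' (Suc n) b = b"
      using fix_mono[OF proj_proj[OF e, of b]] by (metis outer_sum_add outer_sum_scaleC)
    then show ?thesis using e' B fix_mono by blast
  qed
qed

section \<open>Intersecting finite-dimensional subspaces with orthogonal complements\<close>

text \<open>Gaussian elimination: an equation \<open>b\<close> with a nonzero coefficient is solved
  for the unknown \<open>k\<close>, and the remaining equations become a smaller system
  \<open>a'\<close> in the other unknowns.\<close>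

lemma homogeneous_system_solution:
  fixes a :: "'i \<Rightarrow> 'b \<Rightarrow> 'c :: field"
  assumes "finite B" "finite I" "card B < card I"
  shows "\<exists>c. (\<exists>i\<in>I. c i \<noteq> 0) \<and> (\<forall>b\<in>B. (\<Sum>i\<in>I. c i * a i b) = 0)"
  using assms
proof (induction B arbitrary: I a rule: finite_induct)
  case empty
  then obtain i where "i \<in> I" by fastforce
  then show ?case by (intro exI[of _ "\<lambda>_. 1"]) auto
next
  case (insert b B)
  show ?case
  proof (cases "\<forall>i\<in>I. a i b = 0")
    case True
    have "card B < card I" using insert by simp
    then show ?thesis using insert.IH[OF insert.prems(1), of a] True by auto
  next
    case False
    then obtain k where k: "k \<in> I" "a k b \<noteq> 0" by blast
    define I' where "I' = I - {k}"
    define a' where "a' i b' = a i b' - a i b / a k b * a k b'" for i b'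
    have "card B < card I'" "finite I'" using insert k by (auto simp: I'_def)
    then obtain c where c: "\<exists>i\<in>I'. c i \<noteq> 0" "\<forall>b'\<in>B. (\<Sum>i\<in>I'. c i * a' i b') = 0"
      using insert.IH[of I' a'] by blast
    define s where "s = (\<Sum>i\<in>I'. c i * a i b) / a k b"
    define c' where "c' = c(k := - s)"
    have split: "(\<Sum>i\<in>I. c' i * a i b') = (\<Sum>i\<in>I'. c i * a i b') - s * a k b'" for b'
    proof -
      have "(\<Sum>i\<in>I. c' i * a i b') = c' k * a k b' + (\<Sum>i\<in>I'. c' i * a i b')"
        unfolding I'_def by (rule sum.remove[OF insert.prems(1) k(1)])
      also have "(\<Sum>i\<in>I'. c' i * a i b') = (\<Sum>i\<in>I'. c i * a i b')"
        by (intro sum.cong) (auto simp: c'_def I'_def)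
      finally show ?thesis by (simp add: c'_def)
    qed
    have "(\<Sum>i\<in>I. c' i * a i b') = 0" if "b' \<in> B" for b'
    proof -
      have "0 = (\<Sum>i\<in>I'. c i * a' i b')" using c(2) that by simp
      also have "\<dots> = (\<Sum>i\<in>I'. c i * a i b') - s * a k b'"
        by (simp add: a'_def s_def right_diff_distrib sum_subtractf sum_distrib_right
            sum_divide_distrib mult.assoc)
      finally show ?thesis by (simp add: split)
    qed
    moreover have "(\<Sum>i\<in>I. c' i * a i b) = 0" unfolding split using k by (simp add: s_def)
    moreover have "\<exists>i\<in>I. c' i \<noteq> 0" using c(1) by (auto simp: c'_def I'_def)
    ultimately show ?thesis by blast
  qed
qed

lemma orth_compl_span_iff:
  "x \<in> orth_compl (complex_vector.span B) \<longleftrightarrow> (\<forall>b\<in>B. cinner x b = 0)"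
proof
  assume *: "\<forall>b\<in>B. cinner x b = 0"
  have "cinner x y = 0" if "y \<in> complex_vector.span B" for y
    using that by (induction rule: complex_vector.span_induct_alt) (auto simp: cinner_simps *)
  then show "x \<in> orth_compl (complex_vector.span B)" by (simp add: orth_compl_def)
qed (auto simp: orth_compl_def complex_vector.span_base)

text \<open>The dimension count behind the min-max principle: orthogonality to \<open>n\<close>
  spanning vectors amounts to \<open>n\<close> equations in more than \<open>n\<close> unknown
  coefficients.\<close>

lemma combination_in_orth_compl:
  assumes "has_cdim S n" "finite I" "n < card I"
  shows "\<exists>c. (\<exists>i\<in>I. c i \<noteq> 0) \<and> (\<Sum>i\<in>I. c i *\<^sub>C w i) \<in> orth_compl S"
proof -
  obtain B where B: "finite B" "card B = n" "complex_vector.span B = S"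
    using assms(1) unfolding has_cdim_def by blast
  from homogeneous_system_solution[of B I "\<lambda>i b. cinner (w i) b"] B assms
  show ?thesis
    unfolding B(3)[symmetric] orth_compl_span_iff by (simp add: cinner_simps)
qed

lemma has_cdim_span_family:
  assumes "\<And>c. (\<exists>i\<in>I. c i \<noteq> 0) \<Longrightarrow> (\<Sum>i\<in>I. c i *\<^sub>C w i) \<noteq> 0" "finite I"
  shows "has_cdim (complex_vector.span (w ` I)) (card I)"
proof -
  have inj: "inj_on w I"
  proof (rule inj_onI, rule ccontr)
    fix i j assume ij: "i \<in> I" "j \<in> I" "w i = w j" "i \<noteq> j"
    \<comment> \<open>Equal vectors at two indices would cancel with coefficients 1 and -1.\<close>
    define c :: "'a \<Rightarrow> complex" where "c = (\<lambda>_. 0)(i := 1, j := -1)"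
    have "(\<Sum>l\<in>I. c l *\<^sub>C w l) = (\<Sum>l\<in>{i, j}. c l *\<^sub>C w l)"
      using ij assms(2) by (intro sum.mono_neutral_right) (auto simp: c_def)
    also have "\<dots> = 0" using ij by (simp add: c_def scaleC_one)
    finally have "(\<Sum>l\<in>I. c l *\<^sub>C w l) = 0" .
    moreover have "\<exists>l\<in>I. c l \<noteq> 0" using ij by (intro bexI[of _ i]) (simp_all add: c_def)
    ultimately show False using assms(1) by blast
  qed
  have "complex_vector.independent (w ` I)"
    unfolding complex_vector.dependent_finite[OF finite_imageI[OF assms(2)]]
  proof
    assume "\<exists>u. (\<exists>v\<in>w ` I. u v \<noteq> 0) \<and> (\<Sum>v\<in>w ` I. u v *\<^sub>C v) = 0"
    then obtain u where u: "\<exists>v\<in>w ` I. u v \<noteq> 0" "(\<Sum>v\<in>w ` I. u v *\<^sub>C v) = 0" by blast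
    then have "(\<Sum>i\<in>I. u (w i) *\<^sub>C w i) = 0" by (simp add: sum.reindex[OF inj])
    then show False using assms(1)[of "u \<circ> w"] u(1) by auto
  qed
  then show ?thesis
    unfolding has_cdim_def using assms(2) inj by (intro exI[of _ "w ` I"]) (simp add: card_image)
qed

lemma orthonormal_combination_nonzero:
  assumes "orthonormal e n" "\<exists>i\<in>{..<n}. c i \<noteq> 0"
  shows "(\<Sum>i<n. c i *\<^sub>C e i) \<noteq> 0"
proof
  assume "(\<Sum>i<n. c i *\<^sub>C e i) = 0"
  then have "(\<Sum>i<n. (cmod (c i))\<^sup>2) = 0"
    using norm_orthonormal_combination[OF assms(1), of c] by simp
  then show False using assms(2) by (simp add: sum_nonneg_eq_0_iff)
qed

lemma has_cdim_span_orthonormal: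
  assumes "orthonormal e n"
  shows "has_cdim (complex_vector.span (e ` {..<n})) n"
  using has_cdim_span_family[of "{..<n}" e] orthonormal_combination_nonzero[OF assms] by simp

text \<open>Infinite dimension enters all later arguments through this conclusion, which passes
  easily to the direct sum.\<close>

lemma infinite_cdim_orthonormal:
  assumes "infinite_cdim (UNIV :: 'a :: complex_inner set)"
  shows "\<exists>e :: nat \<Rightarrow> 'a. orthonormal e n"
proof (induction n)
  case 0
  show ?case by (simp add: orthonormal_def)
next
  case (Suc n)
  then obtain e :: "nat \<Rightarrow> 'a" where e: "orthonormal e n" by blast
  have "complex_vector.span (e ` {..<n}) \<noteq> UNIV"
    using has_cdim_span_orthonormal[OF e] assms unfolding infinite_cdim_def by metis
  then obtain x where x: "x \<notin> complex_vector.span (e ` {..<n})" by blast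
  have "proj e n x \<in> complex_vector.span (e ` {..<n})"
    unfolding outer_sum_def
    by (intro complex_vector.span_sum complex_vector.span_scale complex_vector.span_base) auto
  with x have r: "x - proj e n x \<noteq> 0" by force
  define u where "u = (1 / norm (x - proj e n x)) *\<^sub>R (x - proj e n x)"
  have "orthonormal (e(n := u)) (Suc n)"
    by (rule orthonormal_extend[OF e])
      (use r in \<open>auto simp: u_def cinner_scaleR_left cinner_diff_left cinner_proj[OF e]\<close>)
  then show ?case by blast
qed

lemma unit_vector_in_orth_compl:
  fixes S :: "'a :: complex_inner set"
  assumes "\<And>n. \<exists>e :: nat \<Rightarrow> 'a. orthonormal e n" "has_cdim S n"
  shows "\<exists>\<psi>\<in>orth_compl S. norm \<psi> = 1"
proof -
  obtain e :: "nat \<Rightarrow> 'a" where e: "orthonormal e (Suc n)" using assms(1) by blast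
  obtain c where c: "\<exists>i\<in>{..<Suc n}. c i \<noteq> 0" "(\<Sum>i<Suc n. c i *\<^sub>C e i) \<in> orth_compl S"
    using combination_in_orth_compl[OF assms(2), of "{..<Suc n}" e] by auto
  define x where "x = (\<Sum>i<Suc n. c i *\<^sub>C e i)"
  have "x \<noteq> 0" unfolding x_def by (rule orthonormal_combination_nonzero[OF e c(1)])
  moreover have "(1 / norm x) *\<^sub>R x \<in> orth_compl S"
    using c(2) unfolding x_def[symmetric] by (simp add: orth_compl_def cinner_scaleR_left)
  ultimately show ?thesis by (intro bexI[of _ "(1 / norm x) *\<^sub>R x"]) auto
qed


section \<open>Bounds for the spectral scale\<close>

lemma spectral_scale_pos_eq:
  "spectral_scale A (int n + 1) = (INF S\<in>{S. has_cdim S n}.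
     SUP \<psi>\<in>{\<psi> \<in> orth_compl S. norm \<psi> = 1}. Re (cinner (A \<psi>) \<psi>))"
proof -
  have "nat (int n + 1) - 1 = n" by linarith
  then show ?thesis unfolding spectral_scale_def by simp
qed

text \<open>Transfers statements on the upper half of the scale to the lower half; a real infimum is
  by definition a negated supremum.\<close>

lemma spectral_scale_neg_eq:
  "spectral_scale A (- (int n + 1)) = - spectral_scale (\<lambda>x. - A x) (int n + 1)"
proof -
  have "nat (- (- (int n + 1))) - 1 = n" by linarith
  then have "spectral_scale A (- (int n + 1)) = (SUP S\<in>{S. has_cdim S n}.
     INF \<psi>\<in>{\<psi> \<in> orth_compl S. norm \<psi> = 1}. Re (cinner (A \<psi>) \<psi>))"
    unfolding spectral_scale_def by simp
  then show ?thesis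
    unfolding spectral_scale_pos_eq by (simp add: Inf_real_def image_image cinner_minus_left)
qed

lemma unit_form_bdd:
  assumes "bounded_clinear A"
  shows "bdd_above ((\<lambda>\<psi>. Re (cinner (A \<psi>) \<psi>)) ` {\<psi> \<in> V. norm \<psi> = 1})"
proof -
  obtain K where K: "\<And>x. norm (A x) \<le> K * norm x"
    using bounded_clinear_bounded[OF assms] by metis
  have "Re (cinner (A \<psi>) \<psi>) \<le> K" if "norm \<psi> = 1" for \<psi>
    using abs_Re_cinner_le[of "A \<psi>" \<psi>] K[of \<psi>] that by simp
  then show ?thesis by (auto intro!: bdd_aboveI2)
qed

text \<open>The span of n + 1 independent vectors meets the orthogonal complement of every
  n-dimensional subspace, so each supremum is at least \<open>d\<close>. Independence is stated
  through coefficients and without orthogonality, because the application to singular values uses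
  images of an orthonormal family under a square root.\<close>

lemma spectral_scale_ge:
  assumes A: "bounded_clinear A"
    and I: "finite I" "card I = Suc n"
    and nz: "\<And>c. \<exists>i\<in>I. c i \<noteq> 0 \<Longrightarrow> (\<Sum>i\<in>I. c i *\<^sub>C w i) \<noteq> 0"
    and form: "\<And>c. d * (norm (\<Sum>i\<in>I. c i *\<^sub>C w i))\<^sup>2
      \<le> Re (cinner (A (\<Sum>i\<in>I. c i *\<^sub>C w i)) (\<Sum>i\<in>I. c i *\<^sub>C w i))"
  shows "d \<le> spectral_scale A (int n + 1)"
  unfolding spectral_scale_pos_eq
proof (rule cINF_greatest)
  \<comment> \<open>Dropping one vector of the family exhibits an n-dimensional subspace, so the
    infimum is over a nonempty set.\<close>
  obtain k where k: "k \<in> I" using I by fastforce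
  have "has_cdim (complex_vector.span (w ` (I - {k}))) (card (I - {k}))"
  proof (rule has_cdim_span_family)
    fix c :: "'b \<Rightarrow> complex" assume c: "\<exists>i\<in>I - {k}. c i \<noteq> 0"
    have "(\<Sum>i\<in>I. (c(k := 0)) i *\<^sub>C w i) = (\<Sum>i\<in>I - {k}. c i *\<^sub>C w i)"
      using I k by (subst sum.remove[of I k]) (auto intro: sum.cong)
    then show "(\<Sum>i\<in>I - {k}. c i *\<^sub>C w i) \<noteq> 0"
      using nz[of "c(k := 0)"] c by fastforce
  qed (use I in simp)
  then show "{S :: 'a set. has_cdim S n} \<noteq> {}" using I k by auto
next
  fix S :: "'a set" assume "S \<in> {S. has_cdim S n}"
  then have S: "has_cdim S n" by simp
  obtain c where c: "\<exists>i\<in>I. c i \<noteq> 0" "(\<Sum>i\<in>I. c i *\<^sub>C w i) \<in> orth_compl S"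
    using combination_in_orth_compl[OF S I(1), of w] I by auto
  define x where "x = (\<Sum>i\<in>I. c i *\<^sub>C w i)"
  have x: "x \<noteq> 0" "d * (norm x)\<^sup>2 \<le> Re (cinner (A x) x)"
    using nz[OF c(1)] form[of c] by (simp_all add: x_def)
  define u where "u = (1 / norm x) *\<^sub>R x"
  have u: "u \<in> orth_compl S" "norm u = 1"
    using c(2) x unfolding x_def[symmetric] by (auto simp: u_def orth_compl_def cinner_scaleR_left)
  have "d \<le> Re (cinner (A x) x) / (norm x)\<^sup>2"
    using x by (simp add: field_simps)
  also have "\<dots> = Re (cinner (A u) u)"
    by (simp add: u_def bounded_clinear_scaleR[OF A] cinner_scaleR_left cinner_scaleR_right
        power2_eq_square)
  also have "\<dots> \<le> (SUP \<psi>\<in>{\<psi> \<in> orth_compl S. norm \<psi> = 1}. Re (cinner (A \<psi>) \<psi>))"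
    by (rule cSUP_upper) (use u unit_form_bdd[OF A] in auto)
  finally show "d \<le> (SUP \<psi>\<in>{\<psi> \<in> orth_compl S. norm \<psi> = 1}. Re (cinner (A \<psi>) \<psi>))" .
qed

lemma bounded_clinear_uminus_fun: "bounded_clinear A \<Longrightarrow> bounded_clinear (\<lambda>x. - A x)"
  using bounded_clinear_scaleR_fun[of A "-1"] by simp

context
  fixes A :: "'a :: complex_inner \<Rightarrow> 'a"
  assumes A: "bounded_clinear A" and inf: "\<And>n. \<exists>e :: nat \<Rightarrow> 'a. orthonormal e n"
begin

text \<open>A single \<open>S\<close> bounds the infimum from above provided the suprema are bounded
  below; this holds because every complement contains a unit vector.\<close>

lemma spectral_scale_le:
  assumes "has_cdim S n" "\<And>\<psi>. \<psi> \<in> orth_compl S \<Longrightarrow> norm \<psi> = 1 \<Longrightarrow> Re (cinner (A \<psi>) \<psi>) \<le> d"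
  shows "spectral_scale A (int n + 1) \<le> d"
  unfolding spectral_scale_pos_eq
proof (rule cINF_lower2)
  obtain K where K: "\<And>x. norm (A x) \<le> K * norm x"
    using bounded_clinear_bounded[OF A] by metis
  show "bdd_below ((\<lambda>S. SUP \<psi>\<in>{\<psi> \<in> orth_compl S. norm \<psi> = 1}. Re (cinner (A \<psi>) \<psi>))
      ` {S. has_cdim S n})"
  proof (rule bdd_belowI2)
    fix S' :: "'a set" assume "S' \<in> {S. has_cdim S n}"
    then obtain u where u: "u \<in> orth_compl S'" "norm u = 1"
      using unit_vector_in_orth_compl[OF inf] by blast
    have "- K \<le> Re (cinner (A u) u)"
      using abs_Re_cinner_le[of "A u" u] K[of u] u by simp
    also have "\<dots> \<le> (SUP \<psi>\<in>{\<psi> \<in> orth_compl S'. norm \<psi> = 1}. Re (cinner (A \<psi>) \<psi>))"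
      by (rule cSUP_upper) (use u unit_form_bdd[OF A] in auto)
    finally show "- K \<le> (SUP \<psi>\<in>{\<psi> \<in> orth_compl S'. norm \<psi> = 1}. Re (cinner (A \<psi>) \<psi>))" .
  qed
  show "S \<in> {S. has_cdim S n}" using assms(1) by simp
  show "(SUP \<psi>\<in>{\<psi> \<in> orth_compl S. norm \<psi> = 1}. Re (cinner (A \<psi>) \<psi>)) \<le> d"
    by (rule cSUP_least) (use unit_vector_in_orth_compl[OF inf assms(1)] assms(2) in auto)
qed

lemma spectral_scale_near_maximizer:
  assumes "has_cdim S n" "\<epsilon> > 0"
  shows "\<exists>\<psi>\<in>orth_compl S. norm \<psi> = 1 \<and> spectral_scale A (int n + 1) - \<epsilon> \<le> Re (cinner (A \<psi>) \<psi>)"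
proof (rule ccontr)
  assume "\<not> ?thesis"
  then have "spectral_scale A (int n + 1) \<le> spectral_scale A (int n + 1) - \<epsilon>"
    by (intro spectral_scale_le[OF assms(1)]) force
  then show False using assms(2) by simp
qed

text \<open>A unit vector of the complement enlarges \<open>S\<close> to dimension exactly n + 1,
  and the complement, hence the supremum, shrinks.\<close>

lemma spectral_scale_antimono:
  "spectral_scale A (int (Suc n) + 1) \<le> spectral_scale A (int n + 1)"
  unfolding spectral_scale_pos_eq[of A n]
proof (rule cINF_greatest)
  show "{S :: 'a set. has_cdim S n} \<noteq> {}" using inf[of n] has_cdim_span_orthonormal by blast
next
  fix S :: "'a set" assume "S \<in> {S. has_cdim S n}"
  then have S: "has_cdim S n" by simp
  obtain u where u: "u \<in> orth_compl S" "norm u = 1"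
    using unit_vector_in_orth_compl[OF inf S] by blast
  obtain B where B: "finite B" "card B = n" "complex_vector.independent B" "complex_vector.span B = S"
    using S unfolding has_cdim_def by blast
  have "u \<notin> S" using u by (force simp: orth_compl_def cinner_self)
  then have "complex_vector.independent (insert u B)" "u \<notin> B"
    using B by (auto simp: complex_vector.independent_insert complex_vector.span_base)
  then have S': "has_cdim (complex_vector.span (insert u B)) (Suc n)"
    unfolding has_cdim_def using B by (intro exI[of _ "insert u B"]) auto
  show "spectral_scale A (int (Suc n) + 1)
      \<le> (SUP \<psi>\<in>{\<psi> \<in> orth_compl S. norm \<psi> = 1}. Re (cinner (A \<psi>) \<psi>))"
  proof (rule spectral_scale_le[OF S'])
    fix \<psi> assume \<psi>: "\<psi> \<in> orth_compl (complex_vector.span (insert u B))" "norm \<psi> = 1"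
    then have "\<psi> \<in> orth_compl S" unfolding B(4)[symmetric] orth_compl_span_iff by simp
    then show "Re (cinner (A \<psi>) \<psi>)
        \<le> (SUP \<psi>\<in>{\<psi> \<in> orth_compl S. norm \<psi> = 1}. Re (cinner (A \<psi>) \<psi>))"
      by (intro cSUP_upper) (use \<psi> unit_form_bdd[OF A] in auto)
  qed
qed

lemma spectral_scale_ge_form:
  assumes "\<And>x. d * (norm x)\<^sup>2 \<le> Re (cinner (A x) x)"
  shows "d \<le> spectral_scale A (int n + 1)"
proof -
  obtain e :: "nat \<Rightarrow> 'a" where e: "orthonormal e (Suc n)" using inf by blast
  show ?thesis
    by (rule spectral_scale_ge[OF A, of "{..<Suc n}" n e])
      (use orthonormal_combination_nonzero[OF e] assms in auto)
qed

lemma spectral_scale_bounded: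
  assumes K: "\<And>x. norm (A x) \<le> K * norm x"
  shows "\<bar>spectral_scale A (int n + 1)\<bar> \<le> K"
proof -
  obtain e :: "nat \<Rightarrow> 'a" where e: "orthonormal e n" using inf by blast
  have "\<bar>Re (cinner (A x) x)\<bar> \<le> K * (norm x)\<^sup>2" for x
  proof -
    have "\<bar>Re (cinner (A x) x)\<bar> \<le> norm (A x) * norm x" by (rule abs_Re_cinner_le)
    also have "\<dots> \<le> K * norm x * norm x" by (intro mult_right_mono K) simp
    finally show ?thesis by (simp add: power2_eq_square)
  qed
  note form = this[unfolded abs_le_iff]
  have "spectral_scale A (int n + 1) \<le> K"
    by (rule spectral_scale_le[OF has_cdim_span_orthonormal[OF e]])
      (metis form mult.right_neutral one_power2)
  moreover have "- K \<le> spectral_scale A (int n + 1)"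
    by (rule spectral_scale_ge_form) (use form in \<open>simp add: minus_le_iff\<close>)
  ultimately show ?thesis by (simp add: abs_le_iff)
qed

text \<open>The next vector is sought in the complement of the span of the k earlier ones. The
  supremum over that complement is one of those whose infimum is the scale value with index k +
  1.\<close>

lemma near_maximizing_orthonormal_family:
  assumes "\<epsilon> > 0"
  shows "\<exists>e. orthonormal e k \<and>
    (\<forall>i<k. spectral_scale A (int i + 1) - \<epsilon> \<le> Re (cinner (A (e i)) (e i)))"
proof (induction k)
  case 0
  show ?case by (simp add: orthonormal_def)
next
  case (Suc k)
  then obtain e where e: "orthonormal e k"
    "\<forall>i<k. spectral_scale A (int i + 1) - \<epsilon> \<le> Re (cinner (A (e i)) (e i))" by blast
  obtain u where u: "u \<in> orth_compl (complex_vector.span (e ` {..<k}))" "norm u = 1"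
    "spectral_scale A (int k + 1) - \<epsilon> \<le> Re (cinner (A u) u)"
    using spectral_scale_near_maximizer[OF has_cdim_span_orthonormal[OF e(1)] assms] by blast
  have "orthonormal (e(k := u)) (Suc k)"
    by (rule orthonormal_extend[OF e(1) u(2)]) (use u(1) in \<open>simp add: orth_compl_span_iff\<close>)
  then show ?case using e(2) u(3) by (intro exI[of _ "e(k := u)"]) (simp add: less_Suc_eq del: fun_upd_apply, simp)
qed

end

section \<open>Decreasing rearrangements\<close>

definition ell2_basis :: "'m \<Rightarrow> 'm ell2" where
  "ell2_basis i = Abs_ell2 (\<lambda>j. if j = i then 1 else 0)"

lemma coord_ell2_basis: "coord (ell2_basis i) j = (if j = i then 1 else 0)"
proof -
  have "(\<lambda>j. (cmod (if j = i then 1 else 0))\<^sup>2) summable_on {i}" by simp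
  then have "(\<lambda>j. (cmod (if j = i then 1 else 0))\<^sup>2) summable_on UNIV"
    by (rule summable_on_cong_neutral[THEN iffD1, rotated -1]) auto
  then show ?thesis unfolding ell2_basis_def by (simp add: coord_Abs_ell2)
qed

lemma cinner_ell2_basis: "cinner x (ell2_basis i) = coord x i"
proof -
  have "cinner x (ell2_basis i) = (\<Sum>\<^sub>\<infinity>j. if j = i then coord x i else 0)"
    unfolding cinner_ell2_def coord_ell2_basis by (intro infsum_cong) auto
  also have "\<dots> = (\<Sum>\<^sub>\<infinity>j\<in>{i}. coord x i)" by (rule infsum_cong_neutral) auto
  finally show ?thesis by simp
qed

lemma orthonormal_ell2_basis: "orthonormal (ell2_basis :: nat \<Rightarrow> nat ell2) n"
  unfolding orthonormal_def by (auto simp: cinner_ell2_basis coord_ell2_basis)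

context
  fixes a :: "'m \<Rightarrow> real" and K :: real
  assumes bound: "\<And>i. \<bar>a i\<bar> \<le> K"
begin

lemma diag_form_summable: "(\<lambda>i. a i * (cmod (coord x i))\<^sup>2) summable_on UNIV"
proof (rule abs_summable_summable, rule summable_on_comparison_test)
  show "(\<lambda>i. K * (cmod (coord x i))\<^sup>2) summable_on UNIV"
    by (intro summable_on_cmult_right coord_summable)
  show "norm (a i * (cmod (coord x i))\<^sup>2) \<le> K * (cmod (coord x i))\<^sup>2" for i
    using bound[of i] by (simp add: abs_mult mult_right_mono)
qed auto

lemma coord_diag_op: "coord (diag_op a x) i = a i * coord x i"
proof -
  have "(\<lambda>i. (cmod (complex_of_real (a i) * coord x i))\<^sup>2) summable_on UNIV"
  proof (rule summable_on_comparison_test)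
    show "(\<lambda>i. K\<^sup>2 * (cmod (coord x i))\<^sup>2) summable_on UNIV"
      by (intro summable_on_cmult_right coord_summable)
    show "(cmod (complex_of_real (a i) * coord x i))\<^sup>2 \<le> K\<^sup>2 * (cmod (coord x i))\<^sup>2" for i
      using power_mono[OF bound[of i] abs_ge_zero, of 2]
      by (simp add: norm_mult power_mult_distrib mult_right_mono)
  qed auto
  then show ?thesis unfolding diag_op_def by (simp add: coord_Abs_ell2)
qed

lemma diag_op_form: "Re (cinner (diag_op a x) x) = (\<Sum>\<^sub>\<infinity>i. a i * (cmod (coord x i))\<^sup>2)"
  unfolding cinner_ell2_def infsum_Re[OF ell2_inner_summable, symmetric]
  unfolding coord_diag_op
  unfolding cmod_power2
  by (intro infsum_cong) (simp add: power2_eq_square algebra_simps)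

lemma bounded_clinear_diag_op: "bounded_clinear (diag_op a)"
proof (rule bounded_clinearI)
  show "diag_op a (x + y) = diag_op a x + diag_op a y" for x y
    by (rule ell2_eqI) (simp add: coord_diag_op coord_simps algebra_simps)
  show "diag_op a (c *\<^sub>C x) = c *\<^sub>C diag_op a x" for c x
    by (rule ell2_eqI) (simp add: coord_diag_op coord_simps)
  show "norm (diag_op a x) \<le> K * norm x" for x
  proof (rule power2_le_imp_le)
    have "(norm (diag_op a x))\<^sup>2 \<le> (\<Sum>\<^sub>\<infinity>i. K\<^sup>2 * (cmod (coord x i))\<^sup>2)"
      unfolding norm_ell2_square
    proof (rule infsum_mono)
      show "(\<lambda>i. (cmod (coord (diag_op a x) i))\<^sup>2) summable_on UNIV" by (rule coord_summable)
      show "(\<lambda>i. K\<^sup>2 * (cmod (coord x i))\<^sup>2) summable_on UNIV"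
        by (rule summable_on_cmult_right[OF coord_summable])
      show "(cmod (coord (diag_op a x) i))\<^sup>2 \<le> K\<^sup>2 * (cmod (coord x i))\<^sup>2" for i
        using power_mono[OF bound[of i] abs_ge_zero, of 2]
        by (simp add: coord_diag_op norm_mult power_mult_distrib mult_right_mono)
    qed
    also have "\<dots> = (K * norm x)\<^sup>2"
      unfolding power_mult_distrib norm_ell2_square
      by (intro infsum_cmult_right coord_summable)
    finally show "(norm (diag_op a x))\<^sup>2 \<le> (K * norm x)\<^sup>2" .
    show "0 \<le> K * norm x" using order_trans[OF abs_ge_zero bound] by simp
  qed
qed

lemma diag_op_form_ge:
  assumes "\<And>i. coord x i \<noteq> 0 \<Longrightarrow> d \<le> a i"
  shows "d * (norm x)\<^sup>2 \<le> Re (cinner (diag_op a x) x)"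
proof -
  have "d * (norm x)\<^sup>2 = (\<Sum>\<^sub>\<infinity>i. d * (cmod (coord x i))\<^sup>2)"
    unfolding norm_ell2_square by (intro infsum_cmult_right[symmetric] coord_summable)
  also have "\<dots> \<le> Re (cinner (diag_op a x) x)"
    unfolding diag_op_form
  proof (rule infsum_mono)
    show "(\<lambda>i. d * (cmod (coord x i))\<^sup>2) summable_on UNIV"
      by (rule summable_on_cmult_right[OF coord_summable])
    show "(\<lambda>i. a i * (cmod (coord x i))\<^sup>2) summable_on UNIV" by (rule diag_form_summable)
    show "d * (cmod (coord x i))\<^sup>2 \<le> a i * (cmod (coord x i))\<^sup>2" for i
    proof (cases "coord x i = 0")
      case False
      then show ?thesis by (intro mult_right_mono assms) simp_all
    qed simp
  qed
  finally show ?thesis .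
qed

end

lemma diag_op_form_le:
  assumes "\<And>i. \<bar>a i\<bar> \<le> K" "\<And>i. coord x i \<noteq> 0 \<Longrightarrow> a i \<le> d"
  shows "Re (cinner (diag_op a x) x) \<le> d * (norm x)\<^sup>2"
proof -
  have "- d * (norm x)\<^sup>2 \<le> Re (cinner (diag_op (\<lambda>i. - a i) x) x)"
  proof (rule diag_op_form_ge)
    show "\<bar>- a i\<bar> \<le> K" for i using assms(1)[of i] by simp
    show "- d \<le> - a i" if "coord x i \<noteq> 0" for i using assms(2)[OF that] by simp
  qed
  moreover have "Re (cinner (diag_op (\<lambda>i. - a i) x) x) = - Re (cinner (diag_op a x) x)"
  proof -
    have "\<bar>- a i\<bar> \<le> K" for i using assms(1)[of i] by simp
    from diag_op_form[where a = "\<lambda>i. - a i" and K = K and x = x, OF this]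
      diag_op_form[where a = a and K = K and x = x, OF assms(1)]
    show ?thesis by (simp add: infsum_uminus)
  qed
  ultimately show ?thesis by simp
qed

text \<open>Tested with the span of the first \<open>n\<close> basis vectors, whose complement sees
  only the entries from \<open>n\<close> on.\<close>

lemma decr_rearr_le:
  fixes a :: "nat \<Rightarrow> real"
  assumes "\<And>i. \<bar>a i\<bar> \<le> K" "\<And>i. n \<le> i \<Longrightarrow> a i \<le> d"
  shows "decr_rearr a n \<le> d"
  unfolding decr_rearr_def
proof (rule spectral_scale_le)
  show "bounded_clinear (diag_op a)" by (rule bounded_clinear_diag_op[OF assms(1)])
  show "\<exists>e :: nat \<Rightarrow> nat ell2. orthonormal e m" for m using orthonormal_ell2_basis by blast
  show "has_cdim (complex_vector.span ((ell2_basis :: nat \<Rightarrow> nat ell2) ` {..<n})) n"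
    by (rule has_cdim_span_orthonormal[OF orthonormal_ell2_basis])
  fix \<psi> :: "nat ell2" assume \<psi>: "\<psi> \<in> orth_compl (complex_vector.span (ell2_basis ` {..<n}))" "norm \<psi> = 1"
  then have zero: "coord \<psi> i = 0" if "i < n" for i
    using that by (simp add: orth_compl_span_iff cinner_ell2_basis)
  have "Re (cinner (diag_op a \<psi>) \<psi>) \<le> d * (norm \<psi>)\<^sup>2"
  proof (rule diag_op_form_le[OF assms(1)])
    fix i assume "coord \<psi> i \<noteq> 0"
    then have "n \<le> i" using zero[of i] by (cases "i < n") auto
    then show "a i \<le> d" by (rule assms(2))
  qed
  then show "Re (cinner (diag_op a \<psi>) \<psi>) \<le> d" using \<psi>(2) by simp
qed

text \<open>On the span of the first n + 1 basis vectors the diagonal form is at least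
  \<open>d\<close>.\<close>

lemma decr_rearr_ge:
  fixes a :: "nat \<Rightarrow> real"
  assumes "\<And>i. \<bar>a i\<bar> \<le> K" "\<And>i. i \<le> n \<Longrightarrow> d \<le> a i"
  shows "d \<le> decr_rearr a n"
  unfolding decr_rearr_def
proof (rule spectral_scale_ge[of _ "{..<Suc n}" n ell2_basis])
  show "bounded_clinear (diag_op a)" by (rule bounded_clinear_diag_op[OF assms(1)])
  show "(\<Sum>i<Suc n. c i *\<^sub>C ell2_basis i) \<noteq> 0" if "\<exists>i\<in>{..<Suc n}. c i \<noteq> 0" for c
    by (rule orthonormal_combination_nonzero[OF orthonormal_ell2_basis that])
  fix c
  define x :: "nat ell2" where "x = (\<Sum>i<Suc n. c i *\<^sub>C ell2_basis i)"
  have "coord x j = (\<Sum>i<Suc n. c i * cinner (ell2_basis i) (ell2_basis j))" for j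
    unfolding cinner_ell2_basis[symmetric] x_def by (simp add: cinner_sum_left cinner_scaleC_left cinner_add_left)
  then have zero: "coord x j = 0" if "j > n" for j
    using that by (simp add: cinner_ell2_basis coord_ell2_basis)
  have "d * (norm x)\<^sup>2 \<le> Re (cinner (diag_op a x) x)"
  proof (rule diag_op_form_ge[OF assms(1)])
    fix i assume "coord x i \<noteq> 0"
    then have "i \<le> n" using zero[of i] by (cases "i \<le> n") auto
    then show "d \<le> a i" by (rule assms(2))
  qed
  then show "d * (norm (\<Sum>i<Suc n. c i *\<^sub>C ell2_basis i))\<^sup>2
      \<le> Re (cinner (diag_op a (\<Sum>i<Suc n. c i *\<^sub>C ell2_basis i)) (\<Sum>i<Suc n. c i *\<^sub>C ell2_basis i))"
    unfolding x_def .
qed auto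


section \<open>Diagonalization of Hermitian forms on finite-dimensional subspaces\<close>

lemma bounded_linear_scaleC_left: "bounded_linear (\<lambda>c. c *\<^sub>C (x :: 'a :: complex_inner))"
proof (rule bounded_linear_intro[where K = "norm x"])
  show "(r *\<^sub>R c) *\<^sub>C x = r *\<^sub>R (c *\<^sub>C x)" for r c
    by (simp add: scaleR_conv_of_real scaleC_of_real[symmetric])
qed (simp_all add: scaleC_add_left norm_scaleC)

lemma bounded_linear_cinner_left: "bounded_linear (\<lambda>x. cinner x y)"
  by (rule bounded_linear_intro[where K = "norm y"])
    (simp_all add: cinner_add_left cinner_scaleR_left cmod_cinner_le scaleR_conv_of_real)

lemma bounded_linear_outer_sum: "bounded_linear (outer_sum f e n)"
  unfolding outer_sum_def
  by (intro bounded_linear_sum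
      bounded_linear_compose[OF bounded_linear_scaleC_left bounded_linear_cinner_left])

text \<open>Closed balls of the ambient space may fail to be compact. A sum of finitely many compact
  discs is compact, and for an orthonormal family it contains all unit vectors of the span.\<close>

lemma compact_bounded_combinations:
  fixes e :: "nat \<Rightarrow> 'a :: complex_inner"
  shows "compact {\<Sum>i<n. c i *\<^sub>C e i |c. \<forall>i<n. cmod (c i) \<le> 1}" (is "compact (?K n)")
proof (induction n)
  case 0
  have "?K 0 = {0}" by auto
  then show ?case by simp
next
  case (Suc n)
  let ?C = "(\<lambda>c. c *\<^sub>C e n) ` cball 0 1"
  have "compact ?C"
    by (intro compact_continuous_image compact_cball linear_continuous_on bounded_linear_scaleC_left)
  then have "compact {x + y |x y. x \<in> ?K n \<and> y \<in> ?C}"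
    by (rule compact_sums[OF Suc])
  moreover have "?K (Suc n) = {x + y |x y. x \<in> ?K n \<and> y \<in> ?C}"
  proof (intro equalityI subsetI)
    fix z assume "z \<in> ?K (Suc n)"
    then obtain c where c: "z = (\<Sum>i<n. c i *\<^sub>C e i) + c n *\<^sub>C e n" "\<forall>i<Suc n. cmod (c i) \<le> 1"
      by auto
    have "(\<Sum>i<n. c i *\<^sub>C e i) \<in> ?K n" using c(2) by auto
    moreover have "c n *\<^sub>C e n \<in> ?C" using c(2) by auto
    ultimately show "z \<in> {x + y |x y. x \<in> ?K n \<and> y \<in> ?C}" using c(1) by blast
  next
    fix z assume "z \<in> {x + y |x y. x \<in> ?K n \<and> y \<in> ?C}"
    then obtain c d where cd: "z = (\<Sum>i<n. c i *\<^sub>C e i) + d *\<^sub>C e n" "\<forall>i<n. cmod (c i) \<le> 1" "cmod d \<le> 1"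
      by auto
    then show "z \<in> ?K (Suc n)"
      by (intro CollectI exI[of _ "c(n := d)"]) (simp add: less_Suc_eq)
  qed
  ultimately show ?case by simp
qed

lemma compact_unit_sphere_section:
  assumes e: "orthonormal e n"
  shows "compact {x. proj e n x = x \<and> (\<forall>l<m. cinner x (\<phi> l) = 0) \<and> norm x = 1}" (is "compact ?V")
proof -
  let ?K = "{\<Sum>i<n. c i *\<^sub>C e i |c. \<forall>i<n. cmod (c i) \<le> 1}"
  have "continuous_on UNIV (proj e n)"
    by (rule linear_continuous_on[OF bounded_linear_outer_sum])
  then have "closed {x. proj e n x = x}"
    by (intro closed_Collect_eq continuous_on_id)
  moreover have "closed {x. \<forall>l<m. cinner x (\<phi> l) = 0}"
  proof -
    have "{x. \<forall>l<m. cinner x (\<phi> l) = 0} = (\<Inter>l\<in>{..<m}. {x. cinner x (\<phi> l) = 0})" by auto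
    moreover have "closed {x. cinner x (\<phi> l) = 0}" for l
      by (intro closed_Collect_eq linear_continuous_on bounded_linear_cinner_left continuous_on_const)
    ultimately show ?thesis by auto
  qed
  moreover have "closed {x :: 'a. norm x = 1}"
    by (intro closed_Collect_eq continuous_intros)
  ultimately have "closed ({x. proj e n x = x} \<inter> {x. \<forall>l<m. cinner x (\<phi> l) = 0} \<inter> {x. norm x = 1})"
    by (intro closed_Int)
  then have "compact (?K \<inter> ({x. proj e n x = x} \<inter> {x. \<forall>l<m. cinner x (\<phi> l) = 0} \<inter> {x. norm x = 1}))"
    by (rule compact_Int_closed[OF compact_bounded_combinations])
  moreover have "?K \<inter> ({x. proj e n x = x} \<inter> {x. \<forall>l<m. cinner x (\<phi> l) = 0} \<inter> {x. norm x = 1}) = ?V"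
  proof -
    have "x \<in> ?K" if "proj e n x = x" "norm x = 1" for x
    proof -
      have "x = (\<Sum>i<n. cinner x (e i) *\<^sub>C e i)" using that(1) by (simp add: outer_sum_def)
      moreover have "cmod (cinner x (e i)) \<le> 1" if "i < n" for i
        using cmod_cinner_le[of x "e i"] orthonormal_norm[OF e that] \<open>norm x = 1\<close> by simp
      ultimately show ?thesis
        by (intro CollectI exI[of _ "\<lambda>i. cinner x (e i)"] conjI allI impI)
    qed
    then show ?thesis by blast
  qed
  ultimately show ?thesis by simp
qed

lemma unit_vector_in_section:
  assumes e: "orthonormal e n" and "m < n"
  shows "\<exists>x. proj e n x = x \<and> (\<forall>l<m. cinner x (\<phi> l) = 0) \<and> norm x = 1"
proof -
  obtain c where c: "\<exists>i\<in>{..<n}. c i \<noteq> 0" "\<forall>l\<in>{..<m}. (\<Sum>i<n. c i * cinner (e i) (\<phi> l)) = 0"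
    using homogeneous_system_solution[of "{..<m}" "{..<n}" "\<lambda>i l. cinner (e i) (\<phi> l)"] assms(2) by auto
  define x where "x = (\<Sum>i<n. c i *\<^sub>C e i)"
  have x: "x \<noteq> 0" unfolding x_def by (rule orthonormal_combination_nonzero[OF e c(1)])
  have fixed: "proj e n x = x"
    unfolding x_def outer_sum_sum outer_sum_scaleC by (intro sum.cong refl) (simp add: proj_base[OF e])
  have orth: "cinner x (\<phi> l) = 0" if "l < m" for l
    using c(2) that by (simp add: x_def cinner_sum_left cinner_scaleC_left)
  define u where "u = complex_of_real (1 / norm x) *\<^sub>C x"
  have "proj e n u = u" unfolding u_def outer_sum_scaleC fixed ..
  moreover have "cinner u (\<phi> l) = 0" if "l < m" for l
    using orth[OF that] by (simp add: u_def cinner_scaleC_left)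
  moreover have "norm u = 1" using x by (simp add: u_def norm_scaleC norm_divide)
  ultimately show ?thesis by blast
qed

lemma section_subspace:
  "complex_vector.subspace {x. proj e n x = x \<and> (\<forall>l<m. cinner x (\<phi> l) = 0)}"
  unfolding complex_vector.subspace_def
  by (simp add: outer_sum_zero outer_sum_add outer_sum_scaleC cinner_add_left cinner_scaleC_left)

text \<open>Otherwise the normalized residual of \<open>x\<close> would give n + 1 orthonormal
  vectors inside the span of \<open>e\<close>.\<close>

lemma proj_fixed_if_maximal:
  assumes e: "orthonormal e n" and \<phi>: "orthonormal \<phi> n" and fixed: "\<And>i. i < n \<Longrightarrow> proj e n (\<phi> i) = \<phi> i"
    and x: "proj e n x = x"
  shows "proj \<phi> n x = x"
proof (rule ccontr)
  assume *: "proj \<phi> n x \<noteq> x"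
  define r where "r = x - proj \<phi> n x"
  have r: "r \<noteq> 0" using * by (simp add: r_def)
  have "proj e n (proj \<phi> n x) = proj \<phi> n x"
    unfolding outer_sum_def[of \<phi>] outer_sum_sum outer_sum_scaleC
    by (intro sum.cong refl) (simp add: fixed)
  then have r_fixed: "proj e n r = r" by (simp add: r_def outer_sum_diff x)
  define u where "u = complex_of_real (1 / norm r) *\<^sub>C r"
  have u_fixed: "proj e n u = u" unfolding u_def outer_sum_scaleC r_fixed ..
  have "norm u = 1" using r by (simp add: u_def norm_scaleC norm_divide)
  moreover have "cinner u (\<phi> i) = 0" if "i < n" for i
    by (simp add: u_def r_def cinner_scaleC_left cinner_diff_left cinner_proj[OF \<phi> that])
  ultimately have "orthonormal (\<phi>(n := u)) (Suc n)" by (rule orthonormal_extend[OF \<phi>])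
  then have "Suc n \<le> n"
    by (rule orthonormal_card_le[OF e]) (auto simp: less_Suc_eq fixed u_fixed)
  then show False by simp
qed

text \<open>Each vector maximizes the Rayleigh quotient over the part of the span orthogonal to its
  predecessors; compactness of the unit sphere there supplies the maximizer.\<close>

lemma successive_maximizers:
  assumes R: "bounded_clinear R" and e: "orthonormal e n" and "m \<le> n"
  shows "\<exists>\<phi>. orthonormal \<phi> m \<and> (\<forall>i<m. proj e n (\<phi> i) = \<phi> i) \<and>
    (\<forall>i<m. \<forall>x. proj e n x = x \<longrightarrow> (\<forall>l<i. cinner x (\<phi> l) = 0) \<longrightarrow>
      Re (cinner (R x) x) \<le> Re (cinner (R (\<phi> i)) (\<phi> i)) * (norm x)\<^sup>2)"
  using \<open>m \<le> n\<close>
proof (induction m)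
  case 0
  show ?case by (simp add: orthonormal_def)
next
  case (Suc m)
  have "m \<le> n" using Suc.prems by simp
  from Suc.IH[OF this] obtain \<phi> where \<phi>: "orthonormal \<phi> m" "\<forall>i<m. proj e n (\<phi> i) = \<phi> i"
    "\<forall>i<m. \<forall>x. proj e n x = x \<longrightarrow> (\<forall>l<i. cinner x (\<phi> l) = 0) \<longrightarrow>
      Re (cinner (R x) x) \<le> Re (cinner (R (\<phi> i)) (\<phi> i)) * (norm x)\<^sup>2"
    by (elim exE conjE) (rule that)
  let ?V = "{x. proj e n x = x \<and> (\<forall>l<m. cinner x (\<phi> l) = 0) \<and> norm x = 1}"
  have "?V \<noteq> {}" using unit_vector_in_section[OF e, of m \<phi>] Suc.prems by auto
  moreover have "continuous_on ?V (\<lambda>x. Re (cinner (R x) x))"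
    unfolding Re_cinner using R
    by (intro continuous_intros linear_continuous_on) (simp add: bounded_clinear_def)
  ultimately have "\<exists>u\<in>?V. \<forall>x\<in>?V. Re (cinner (R x) x) \<le> Re (cinner (R u) u)"
    by (rule continuous_attains_sup[OF compact_unit_sphere_section[OF e]])
  then obtain u where u: "u \<in> ?V" "\<forall>x\<in>?V. Re (cinner (R x) x) \<le> Re (cinner (R u) u)"
    by (elim bexE) (rule that)
  have max: "Re (cinner (R x) x) \<le> Re (cinner (R u) u) * (norm x)\<^sup>2"
    if x: "proj e n x = x" "\<forall>l<m. cinner x (\<phi> l) = 0" for x
  proof (cases "x = 0")
    case False
    define y where "y = complex_of_real (1 / norm x) *\<^sub>C x"
    have "proj e n y = y" unfolding y_def outer_sum_scaleC x(1) ..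
    moreover have "\<forall>l<m. cinner y (\<phi> l) = 0" using x(2) by (simp add: y_def cinner_scaleC_left)
    moreover have "norm y = 1" using False by (simp add: y_def norm_scaleC norm_divide)
    ultimately have "Re (cinner (R y) y) \<le> Re (cinner (R u) u)" by (intro u(2)[rule_format]) simp
    moreover have "Re (cinner (R y) y) = Re (cinner (R x) x) / (norm x)\<^sup>2"
      unfolding y_def scaleC_of_real bounded_clinear_scaleR[OF R]
      by (simp add: cinner_scaleR_left cinner_scaleR_right power2_eq_square)
    ultimately show ?thesis using False by (simp add: field_simps)
  qed (simp add: bounded_clinear_zero[OF R])
  define \<psi> where "\<psi> = \<phi>(m := u)"
  have \<psi>: "\<psi> i = \<phi> i" if "i < m" for i using that by (simp add: \<psi>_def)
  have \<psi>m: "\<psi> m = u" by (simp add: \<psi>_def)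
  have "orthonormal \<psi> (Suc m)"
    unfolding \<psi>_def by (rule orthonormal_extend[OF \<phi>(1)]) (use u(1) in simp_all)
  moreover have "\<forall>i<Suc m. proj e n (\<psi> i) = \<psi> i"
    using \<phi>(2) u(1) by (simp add: less_Suc_eq \<psi> \<psi>m)
  moreover have "\<forall>i<Suc m. \<forall>x. proj e n x = x \<longrightarrow> (\<forall>l<i. cinner x (\<psi> l) = 0) \<longrightarrow>
      Re (cinner (R x) x) \<le> Re (cinner (R (\<psi> i)) (\<psi> i)) * (norm x)\<^sup>2"
  proof (intro allI impI)
    fix i x assume i: "i < Suc m" and x: "proj e n x = x" "\<forall>l<i. cinner x (\<psi> l) = 0"
    have l: "\<forall>l<i. cinner x (\<phi> l) = 0"
    proof (intro allI impI)
      fix l assume "l < i"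
      then show "cinner x (\<phi> l) = 0" using x(2)[rule_format, of l] \<psi>[of l] i by simp
    qed
    show "Re (cinner (R x) x) \<le> Re (cinner (R (\<psi> i)) (\<psi> i)) * (norm x)\<^sup>2"
    proof (cases "i < m")
      case True
      then show ?thesis using \<phi>(3) x(1) l by (simp add: \<psi>)
    next
      case False
      then have "i = m" using i by simp
      then show ?thesis using max x(1) l by (simp add: \<psi>m)
    qed
  qed
  ultimately show ?case by (intro exI[of _ \<psi>] conjI)
qed

text \<open>\<open>R\<close> may leave the span of \<open>e\<close>, so what is diagonalized is its
  form there. If \<phi> i maximizes on the vectors orthogonal to its predecessors, the form of
  \<gamma> i - R is nonnegative on them and vanishes at \<phi> i. Cauchy-Schwarz then kills its
  entries at \<phi> i and every later \<phi> j.\<close>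

lemma hermitian_form_diagonalization:
  assumes R: "bounded_clinear R" "selfadjoint R" and e: "orthonormal e n"
  obtains \<phi> where "orthonormal \<phi> n" "\<forall>i<n. proj e n (\<phi> i) = \<phi> i"
    "\<forall>x. proj e n x = x \<longrightarrow> proj \<phi> n x = x"
    "\<forall>i<n. \<forall>j<n. i \<noteq> j \<longrightarrow> cinner (R (\<phi> i)) (\<phi> j) = 0"
    "\<forall>i j. i \<le> j \<longrightarrow> j < n \<longrightarrow> Re (cinner (R (\<phi> j)) (\<phi> j)) \<le> Re (cinner (R (\<phi> i)) (\<phi> i))"
proof -
  obtain \<phi> where \<phi>: "orthonormal \<phi> n" "\<forall>i<n. proj e n (\<phi> i) = \<phi> i"
    "\<forall>i<n. \<forall>x. proj e n x = x \<longrightarrow> (\<forall>l<i. cinner x (\<phi> l) = 0) \<longrightarrow>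
      Re (cinner (R x) x) \<le> Re (cinner (R (\<phi> i)) (\<phi> i)) * (norm x)\<^sup>2"
    using successive_maximizers[OF R(1) e order_refl] by (elim exE conjE) (rule that)
  define \<gamma> where "\<gamma> i = Re (cinner (R (\<phi> i)) (\<phi> i))" for i
  have orth: "cinner (\<phi> i) (\<phi> j) = (if i = j then 1 else 0)" if "i < n" "j < n" for i j
    by (rule orthonormal_cinner[OF \<phi>(1) that])
  have nrm: "norm (\<phi> i) = 1" if "i < n" for i by (rule orthonormal_norm[OF \<phi>(1) that])
  have upper: "cinner (R (\<phi> i)) (\<phi> j) = 0" if ij: "i < j" "j < n" for i j
  proof -
    define h where "h x = \<gamma> i *\<^sub>R x - R x" for x
    let ?V = "{x. proj e n x = x \<and> (\<forall>l<i. cinner x (\<phi> l) = 0)}"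
    have h: "bounded_clinear h"
      unfolding h_def by (intro bounded_clinear_sub bounded_clinear_scaleR_fun bounded_clinear_id R(1))
    have h_sa: "selfadjoint h"
      using R(2) by (simp add: selfadjoint_def h_def cinner_diff_left cinner_diff_right
          cinner_scaleR_left cinner_scaleR_right)
    have "(cmod (cinner (h (\<phi> i)) (\<phi> j)))\<^sup>2
        \<le> Re (cinner (h (\<phi> i)) (\<phi> i)) * Re (cinner (h (\<phi> j)) (\<phi> j))"
    proof (rule positive_form_cauchy_schwarz[OF h h_sa section_subspace])
      show "\<phi> i \<in> ?V" "\<phi> j \<in> ?V" using \<phi>(2) orth ij by auto
      show "0 \<le> Re (cinner (h z) z)" if "z \<in> ?V" for z
      proof -
        have "Re (cinner (R z) z) \<le> \<gamma> i * (norm z)\<^sup>2"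
          using \<phi>(3) that ij unfolding \<gamma>_def by simp
        then show ?thesis by (simp add: h_def cinner_diff_left cinner_scaleR_left cinner_self)
      qed
    qed
    moreover have "Re (cinner (h (\<phi> i)) (\<phi> i)) = 0"
      using nrm[of i] ij by (simp add: h_def cinner_diff_left cinner_scaleR_left cinner_self \<gamma>_def)
    ultimately have "cinner (h (\<phi> i)) (\<phi> j) = 0" by simp
    then show ?thesis using orth[of i j] ij by (simp add: h_def cinner_diff_left cinner_scaleR_left)
  qed
  have off: "cinner (R (\<phi> i)) (\<phi> j) = 0" if ij: "i < n" "j < n" "i \<noteq> j" for i j
  proof (cases "i < j")
    case True
    then show ?thesis using upper ij by simp
  next
    case False
    then have "cinner (R (\<phi> j)) (\<phi> i) = 0" using upper ij by simp
    moreover have "cinner (R (\<phi> i)) (\<phi> j) = cnj (cinner (R (\<phi> j)) (\<phi> i))"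
      using R(2) cinner_commute[of "\<phi> i" "R (\<phi> j)"] unfolding selfadjoint_def by simp
    ultimately show ?thesis by simp
  qed
  have sorted: "\<gamma> j \<le> \<gamma> i" if ij: "i \<le> j" "j < n" for i j
  proof -
    have "Re (cinner (R (\<phi> j)) (\<phi> j)) \<le> Re (cinner (R (\<phi> i)) (\<phi> i)) * (norm (\<phi> j))\<^sup>2"
      using \<phi>(2,3) ij orth by simp
    then show ?thesis using nrm[of j] ij by (simp add: \<gamma>_def)
  qed
  show ?thesis
  proof (rule that[OF \<phi>(1,2)])
    show "\<forall>x. proj e n x = x \<longrightarrow> proj \<phi> n x = x"
      using proj_fixed_if_maximal[OF e \<phi>(1)] \<phi>(2) by blast
    show "\<forall>i<n. \<forall>j<n. i \<noteq> j \<longrightarrow> cinner (R (\<phi> i)) (\<phi> j) = 0" using off by blast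
    show "\<forall>i j. i \<le> j \<longrightarrow> j < n \<longrightarrow> Re (cinner (R (\<phi> j)) (\<phi> j)) \<le> Re (cinner (R (\<phi> i)) (\<phi> i))"
      using sorted unfolding \<gamma>_def by blast
  qed
qed

lemma diagonal_form_combination:
  assumes R: "bounded_clinear R" and off: "\<And>i j. i \<in> I \<Longrightarrow> j \<in> I \<Longrightarrow> i \<noteq> j \<Longrightarrow> cinner (R (\<phi> i)) (\<phi> j) = 0"
    and "finite I"
  shows "Re (cinner (R (\<Sum>i\<in>I. c i *\<^sub>C \<phi> i)) (\<Sum>i\<in>I. c i *\<^sub>C \<phi> i))
    = (\<Sum>i\<in>I. (cmod (c i))\<^sup>2 * Re (cinner (R (\<phi> i)) (\<phi> i)))"
proof -
  have "cinner (R (\<Sum>i\<in>I. c i *\<^sub>C \<phi> i)) (\<Sum>i\<in>I. c i *\<^sub>C \<phi> i)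
      = (\<Sum>i\<in>I. \<Sum>j\<in>I. c i * (cnj (c j) * cinner (R (\<phi> i)) (\<phi> j)))"
    by (simp only: bounded_clinear_sum[OF R] bounded_clinear_scaleC[OF R] cinner_sum_left cinner_scaleC_left)
      (simp only: cinner_sum_right cinner_scaleC_right sum_distrib_left)
  also have "\<dots> = (\<Sum>i\<in>I. \<Sum>j\<in>I. if j = i then c i * (cnj (c i) * cinner (R (\<phi> i)) (\<phi> i)) else 0)"
    using off by (intro sum.cong refl) auto
  also have "\<dots> = (\<Sum>i\<in>I. complex_of_real ((cmod (c i))\<^sup>2) * cinner (R (\<phi> i)) (\<phi> i))"
    using assms(3) by (intro sum.cong refl) (simp only: sum.delta complex_norm_square mult.assoc if_True)
  finally show ?thesis by (simp add: Re_sum)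
qed

section \<open>Summation by parts\<close>

text \<open>Abel summation as an induction: the partial sum up to \<open>n\<close> is nonnegative,
  so lowering its weight from \<open>s (n - 1)\<close> to \<open>s n\<close> can only decrease
  it.\<close>

lemma sum_mult_antimono_ge:
  fixes s d :: "nat \<Rightarrow> real"
  assumes "\<And>i. Suc i < n \<Longrightarrow> s (Suc i) \<le> s i" "\<And>t. t \<le> n \<Longrightarrow> 0 \<le> (\<Sum>j<t. d j)" "0 < n"
  shows "s (n - 1) * (\<Sum>j<n. d j) \<le> (\<Sum>j<n. s j * d j)"
  using assms
proof (induction n)
  case (Suc n)
  show ?case
  proof (cases "n = 0")
    case False
    have "s n * (\<Sum>j<n. d j) \<le> s (n - 1) * (\<Sum>j<n. d j)"
      using Suc.prems(1)[of "n - 1"] Suc.prems(2)[of n] False by (intro mult_right_mono) simp_all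
    also have "\<dots> \<le> (\<Sum>j<n. s j * d j)"
      using Suc.prems False by (intro Suc.IH) simp_all
    finally show ?thesis by (simp add: distrib_left)
  qed simp
qed simp

lemma sum_mult_antimono_nonneg:
  fixes s d :: "nat \<Rightarrow> real"
  assumes "\<And>i. Suc i < n \<Longrightarrow> s (Suc i) \<le> s i" "\<And>i. i < n \<Longrightarrow> 0 \<le> s i"
    "\<And>t. t \<le> n \<Longrightarrow> 0 \<le> (\<Sum>j<t. d j)"
  shows "0 \<le> (\<Sum>j<n. s j * d j)"
proof (cases "n = 0")
  case False
  then have "0 \<le> s (n - 1) * (\<Sum>j<n. d j)" using assms(2,3) by (intro mult_nonneg_nonneg) simp_all
  also have "\<dots> \<le> (\<Sum>j<n. s j * d j)" using assms(1,3) False by (intro sum_mult_antimono_ge) simp_all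
  finally show ?thesis .
qed simp

text \<open>Here \<open>s\<close> may change sign, as the \<gamma> do; the vanishing total removes
  the term with the last weight.\<close>

lemma sum_mult_antimono_nonneg_total:
  fixes s d :: "nat \<Rightarrow> real"
  assumes "\<And>i. Suc i < n \<Longrightarrow> s (Suc i) \<le> s i"
    "\<And>t. t \<le> n \<Longrightarrow> 0 \<le> (\<Sum>j<t. d j)" "(\<Sum>j<n. d j) = 0"
  shows "0 \<le> (\<Sum>j<n. s j * d j)"
proof (cases "n = 0")
  case False
  then show ?thesis using sum_mult_antimono_ge[of n s d] assms by simp
qed simp

text \<open>For i < k take the matrix with entry 1 at (i, i), entry -1 at (N - 1 - i, i) and zeros
  elsewhere. Its block sums equal the bound assumed for \<open>M\<close>, and its value is the right
  side; both summations by parts compare \<open>M\<close> with it.\<close>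

lemma bilinear_summation_by_parts:
  fixes \<gamma> \<sigma> :: "nat \<Rightarrow> real" and M :: "nat \<Rightarrow> nat \<Rightarrow> real"
  assumes \<gamma>: "\<And>i. Suc i < N \<Longrightarrow> \<gamma> (Suc i) \<le> \<gamma> i"
    and \<sigma>: "\<And>i. Suc i < n \<Longrightarrow> \<sigma> (Suc i) \<le> \<sigma> i" "\<And>i. i < n \<Longrightarrow> 0 \<le> \<sigma> i"
    and kn: "k \<le> n" "2 * k \<le> N"
    and M: "\<And>s t. s \<le> N \<Longrightarrow> t \<le> n \<Longrightarrow> (\<Sum>r<s. \<Sum>j<t. M r j) \<le> real (min (min s (N - s)) (min t k))"
    and M0: "\<And>t. t \<le> n \<Longrightarrow> (\<Sum>r<N. \<Sum>j<t. M r j) = 0"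
  shows "(\<Sum>r<N. \<Sum>j<n. \<gamma> r * \<sigma> j * M r j) \<le> (\<Sum>i<k. (\<gamma> i - \<gamma> (N - 1 - i)) * \<sigma> i)"
proof -
  \<comment> \<open>Column \<open>j\<close> of the extremal matrix paired with \<gamma>; beyond
    \<open>k\<close> the columns vanish.\<close>
  define d where "d j = (if j < k then \<gamma> j - \<gamma> (N - 1 - j) else 0)" for j
  have step: "(\<Sum>r<N. \<gamma> r * (\<Sum>j<t. M r j)) \<le> (\<Sum>j<t. d j)" if t: "t \<le> n" for t
  proof -
    define \<kappa> where "\<kappa> = min t k"
    have \<kappa>: "2 * \<kappa> \<le> N" using kn by (simp add: \<kappa>_def)
    \<comment> \<open>Row sums of the first \<open>t\<close> columns of the extremal matrix. As 2
      \<kappa> <= N, the positive rows at the top and the negative rows at the bottom do not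
      overlap.\<close>
    define m where "m r = (if r < \<kappa> then 1 else 0) - (if N - \<kappa> \<le> r then 1 else 0 :: real)" for r
    have sm: "(\<Sum>r<s. m r) = real (min (min s (N - s)) \<kappa>)" if "s \<le> N" for s
      using that
    proof (induction s)
      case (Suc s)
      then show ?case using \<kappa> by (auto simp: m_def min_def of_nat_diff)
    qed simp
    have "0 \<le> (\<Sum>r<N. \<gamma> r * (m r - (\<Sum>j<t. M r j)))"
    proof (rule sum_mult_antimono_nonneg_total[of N \<gamma>, OF \<gamma>])
      show "0 \<le> (\<Sum>r<s. m r - (\<Sum>j<t. M r j))" if "s \<le> N" for s
        using M[OF that t] sm[OF that] by (simp add: sum_subtractf \<kappa>_def)
      show "(\<Sum>r<N. m r - (\<Sum>j<t. M r j)) = 0"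
        using M0[OF t] sm[of N] by (simp add: sum_subtractf)
    qed
    then have "(\<Sum>r<N. \<gamma> r * (\<Sum>j<t. M r j)) \<le> (\<Sum>r<N. \<gamma> r * m r)"
      by (simp add: right_diff_distrib sum_subtractf)
    also have "(\<Sum>r<N. \<gamma> r * m r)
        = (\<Sum>r<N. if r < \<kappa> then \<gamma> r else 0) - (\<Sum>r<N. if N - \<kappa> \<le> r then \<gamma> r else 0)"
      unfolding sum_subtractf[symmetric] by (intro sum.cong refl) (simp add: m_def)
    also have "(\<Sum>r<N. if r < \<kappa> then \<gamma> r else 0) = (\<Sum>r<\<kappa>. \<gamma> r)"
      using \<kappa> by (intro sum.mono_neutral_cong_right) auto
    also have "(\<Sum>r<N. if N - \<kappa> \<le> r then \<gamma> r else 0) = (\<Sum>r\<in>{N - \<kappa>..<N}. \<gamma> r)"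
      by (intro sum.mono_neutral_cong_right) auto
    also have "\<dots> = (\<Sum>i<\<kappa>. \<gamma> (N - 1 - i))"
      by (rule sum.reindex_bij_witness[of _ "\<lambda>i. N - 1 - i" "\<lambda>r. N - 1 - r"]) (use \<kappa> in auto)
    also have "(\<Sum>r<\<kappa>. \<gamma> r) - (\<Sum>i<\<kappa>. \<gamma> (N - 1 - i)) = (\<Sum>i<\<kappa>. d i)"
      unfolding sum_subtractf[symmetric] by (intro sum.cong) (auto simp: d_def \<kappa>_def)
    also have "\<dots> = (\<Sum>j<t. d j)"
      by (intro sum.mono_neutral_left) (auto simp: d_def \<kappa>_def)
    finally show ?thesis .
  qed
  have "0 \<le> (\<Sum>j<n. \<sigma> j * (d j - (\<Sum>r<N. \<gamma> r * M r j)))"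
  proof (rule sum_mult_antimono_nonneg[of n \<sigma>, OF \<sigma>])
    fix t assume t: "t \<le> n"
    have "(\<Sum>j<t. \<Sum>r<N. \<gamma> r * M r j) = (\<Sum>r<N. \<gamma> r * (\<Sum>j<t. M r j))"
      by (subst sum.swap) (simp add: sum_distrib_left)
    then show "0 \<le> (\<Sum>j<t. d j - (\<Sum>r<N. \<gamma> r * M r j))"
      using step[OF t] by (simp add: sum_subtractf)
  qed
  then have "(\<Sum>j<n. \<sigma> j * (\<Sum>r<N. \<gamma> r * M r j)) \<le> (\<Sum>j<n. \<sigma> j * d j)"
    by (simp add: right_diff_distrib sum_subtractf)
  also have "(\<Sum>j<n. \<sigma> j * d j) = (\<Sum>i<k. (\<gamma> i - \<gamma> (N - 1 - i)) * \<sigma> i)"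
    using kn by (intro sum.mono_neutral_cong_right) (auto simp: d_def)
  also have "(\<Sum>j<n. \<sigma> j * (\<Sum>r<N. \<gamma> r * M r j)) = (\<Sum>r<N. \<Sum>j<n. \<gamma> r * \<sigma> j * M r j)"
    by (subst sum.swap) (simp add: sum_distrib_left mult_ac)
  finally show ?thesis .
qed


section \<open>Lower bounds for singular values and traces\<close>

lemma cadjoint_comp:
  fixes T :: "'a :: chilbert_space \<Rightarrow> 'b :: complex_inner"
  assumes T: "bounded_clinear T"
  shows "bounded_clinear (\<lambda>x. cadjoint T (T x))" "selfadjoint (\<lambda>x. cadjoint T (T x))"
    "cinner (cadjoint T (T x)) y = cinner (T x) (T y)"
proof -
  show "bounded_clinear (\<lambda>x. cadjoint T (T x))"
    by (rule bounded_clinear_compose[OF bounded_clinear_cadjoint[OF T] T])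
  show "selfadjoint (\<lambda>x. cadjoint T (T x))"
    unfolding selfadjoint_def by (simp add: cadjoint_eq_left[OF T] cadjoint_eq[OF T, symmetric])
  show "cinner (cadjoint T (T x)) y = cinner (T x) (T y)" by (rule cadjoint_eq_left[OF T])
qed

text \<open>For \<open>x\<close> in the span of \<open>v\<close> one has \<open>s * norm x \<le> norm (X x)\<close>; with \<open>Q\<close> the square root
  of \<open>abs_op X\<close>, this turns into a lower bound of the form of \<open>abs_op X\<close> at \<open>Q x\<close>.\<close>

lemma singular_values_ge:
  fixes X :: "'a :: chilbert_space \<Rightarrow> 'a"
  assumes X: "bounded_clinear X" and inf: "\<And>n. \<exists>e :: nat \<Rightarrow> 'a. orthonormal e n"
    and v: "orthonormal v (Suc i)"
    and off: "\<And>a b. a \<le> i \<Longrightarrow> b \<le> i \<Longrightarrow> a \<noteq> b \<Longrightarrow> cinner (X (v a)) (X (v b)) = 0"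
    and s: "\<And>a. a \<le> i \<Longrightarrow> s \<le> norm (X (v a))" "0 \<le> s"
  shows "s \<le> singular_values X i"
proof (cases "s = 0")
  \<comment> \<open>For s = 0 the vectors \<open>Q (v a)\<close> may be dependent, and positivity of
    \<open>abs_op X\<close> has to do.\<close>
  case True
  have "0 \<le> spectral_scale (abs_op X) (int i + 1)"
    by (rule spectral_scale_ge_form[OF abs_op_props(1)[OF X] inf])
      (use abs_op_props(2)[OF X] in \<open>simp add: positive_op_def\<close>)
  then show ?thesis using True by (simp add: singular_values_def)
next
  case False
  note R = abs_op_props[OF X]
  \<comment> \<open>Cauchy-Schwarz bounds <|X| x, x> by |X x| |x| from above, the wrong direction
    for a test at x. At Q x the form equals |X x|^2, while |Q x|^2 = <|X| x, x>, and the same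
    inequality becomes useful.\<close>
  define Q where "Q = sqrt_op (abs_op X)"
  have Q: "bounded_clinear Q" "positive_op Q" and QQ: "\<And>x. Q (Q x) = abs_op X x"
    unfolding Q_def by (rule sqrt_op_props[OF R(1,2)])+
  have Q_sa: "cinner (Q x) y = cinner x (Q y)" for x y
    using Q(2) by (simp add: positive_op_def selfadjoint_def)
  have below: "s * norm x \<le> norm (X x)" if x: "x = (\<Sum>a<Suc i. c a *\<^sub>C v a)" for x c
  proof (rule power2_le_imp_le)
    have "(norm (X x))\<^sup>2 = Re (cinner (cadjoint X (X x)) x)"
      by (simp add: cadjoint_comp(3)[OF X] Re_cinner_self)
    also have "\<dots> = (\<Sum>a<Suc i. (cmod (c a))\<^sup>2 * Re (cinner (cadjoint X (X (v a))) (v a)))"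
      unfolding x
      by (rule diagonal_form_combination[OF cadjoint_comp(1)[OF X]])
        (use off in \<open>simp_all add: cadjoint_comp(3)[OF X]\<close>)
    also have "\<dots> = (\<Sum>a<Suc i. (cmod (c a))\<^sup>2 * (norm (X (v a)))\<^sup>2)"
      by (simp only: cadjoint_comp(3)[OF X] Re_cinner_self)
    also have "\<dots> \<ge> (\<Sum>a<Suc i. (cmod (c a))\<^sup>2 * s\<^sup>2)"
      by (intro sum_mono mult_left_mono power_mono s) simp_all
    finally have "(\<Sum>a<Suc i. (cmod (c a))\<^sup>2) * s\<^sup>2 \<le> (norm (X x))\<^sup>2"
      by (simp only: sum_distrib_right)
    then show "(s * norm x)\<^sup>2 \<le> (norm (X x))\<^sup>2"
      unfolding x norm_orthonormal_combination[OF v] power_mult_distrib by (simp only: mult.commute)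
  qed simp
  have comb: "(\<Sum>a<Suc i. c a *\<^sub>C Q (v a)) = Q (\<Sum>a<Suc i. c a *\<^sub>C v a)" for c
    by (simp only: bounded_clinear_sum[OF Q(1)] bounded_clinear_scaleC[OF Q(1)])
  show ?thesis
    unfolding singular_values_def
  proof (rule spectral_scale_ge[OF R(1), of "{..<Suc i}" i "\<lambda>a. Q (v a)"])
    fix c :: "nat \<Rightarrow> complex"
    define x where "x = (\<Sum>a<Suc i. c a *\<^sub>C v a)"
    have low: "s * norm x \<le> norm (X x)" by (rule below[OF x_def])
    show "(\<Sum>a<Suc i. c a *\<^sub>C Q (v a)) \<noteq> 0" if "\<exists>a\<in>{..<Suc i}. c a \<noteq> 0"
    proof
      assume "(\<Sum>a<Suc i. c a *\<^sub>C Q (v a)) = 0"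
      then have "Q x = 0" unfolding comb x_def .
      then have "abs_op X x = 0" using QQ[of x] bounded_clinear_zero[OF Q(1)] by simp
      then have "s * norm x \<le> 0" using low R(4)[of x] by simp
      then have "x = 0" using False s(2) by (simp add: mult_le_0_iff)
      then show False using orthonormal_combination_nonzero[OF v that] by (simp add: x_def)
    qed
    have "s * (norm (Q x))\<^sup>2 \<le> Re (cinner (abs_op X (Q x)) (Q x))"
    proof -
      have "(norm (Q x))\<^sup>2 = Re (cinner (abs_op X x) x)"
        by (simp add: Re_cinner_self[symmetric] QQ[symmetric] Q_sa)
      also have "\<dots> \<le> norm (X x) * norm x"
        using abs_Re_cinner_le[of "abs_op X x" x] R(4)[of x] by simp
      finally have "s * (norm (Q x))\<^sup>2 \<le> s * (norm (X x) * norm x)"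
        using s(2) by (rule mult_left_mono)
      also have "\<dots> = norm (X x) * (s * norm x)" by simp
      also have "\<dots> \<le> norm (X x) * norm (X x)"
        using low by (rule mult_left_mono) simp
      also have "\<dots> = (norm (Q (Q x)))\<^sup>2"
        by (simp add: QQ R(4) power2_eq_square)
      also have "\<dots> = Re (cinner (Q (Q (Q x))) (Q x))"
        by (simp add: Re_cinner_self[symmetric] Q_sa)
      finally show ?thesis unfolding QQ[of "Q x"] .
    qed
    then show "s * (norm (\<Sum>a<Suc i. c a *\<^sub>C Q (v a)))\<^sup>2
        \<le> Re (cinner (abs_op X (\<Sum>a<Suc i. c a *\<^sub>C Q (v a))) (\<Sum>a<Suc i. c a *\<^sub>C Q (v a)))"
      unfolding comb x_def .
  qed simp_all
qed

lemma spectral_scale_ge_diagonal: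
  assumes A: "bounded_clinear A" and \<phi>: "orthonormal \<phi> (Suc i)"
    and off: "\<And>a b. a \<le> i \<Longrightarrow> b \<le> i \<Longrightarrow> a \<noteq> b \<Longrightarrow> cinner (A (\<phi> a)) (\<phi> b) = 0"
    and d: "\<And>a. a \<le> i \<Longrightarrow> d \<le> Re (cinner (A (\<phi> a)) (\<phi> a))"
  shows "d \<le> spectral_scale A (int i + 1)"
proof (rule spectral_scale_ge[OF A, of "{..<Suc i}" i \<phi>])
  fix c :: "nat \<Rightarrow> complex"
  have "d * (norm (\<Sum>a<Suc i. c a *\<^sub>C \<phi> a))\<^sup>2 = (\<Sum>a<Suc i. (cmod (c a))\<^sup>2 * d)"
    unfolding norm_orthonormal_combination[OF \<phi>] sum_distrib_left by (simp only: mult.commute)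
  also have "\<dots> \<le> (\<Sum>a<Suc i. (cmod (c a))\<^sup>2 * Re (cinner (A (\<phi> a)) (\<phi> a)))"
    by (intro sum_mono mult_left_mono d) simp_all
  also have "\<dots> = Re (cinner (A (\<Sum>a<Suc i. c a *\<^sub>C \<phi> a)) (\<Sum>a<Suc i. c a *\<^sub>C \<phi> a))"
    by (rule diagonal_form_combination[OF A, symmetric]) (use off in simp_all)
  finally show "d * (norm (\<Sum>a<Suc i. c a *\<^sub>C \<phi> a))\<^sup>2
      \<le> Re (cinner (A (\<Sum>a<Suc i. c a *\<^sub>C \<phi> a)) (\<Sum>a<Suc i. c a *\<^sub>C \<phi> a))" .
qed (use orthonormal_combination_nonzero[OF \<phi>] in simp_all)

lemma spectral_scale_neg_le_diagonal:
  assumes A: "bounded_clinear A" and \<phi>: "orthonormal \<phi> (Suc i)"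
    and off: "\<And>a b. a \<le> i \<Longrightarrow> b \<le> i \<Longrightarrow> a \<noteq> b \<Longrightarrow> cinner (A (\<phi> a)) (\<phi> b) = 0"
    and d: "\<And>a. a \<le> i \<Longrightarrow> Re (cinner (A (\<phi> a)) (\<phi> a)) \<le> d"
  shows "spectral_scale A (- (int i + 1)) \<le> d"
proof -
  have "- d \<le> spectral_scale (\<lambda>x. - A x) (int i + 1)"
    by (rule spectral_scale_ge_diagonal[OF bounded_clinear_uminus_fun[OF A] \<phi>])
      (use off d in \<open>simp_all add: cinner_minus_left\<close>)
  then show ?thesis unfolding spectral_scale_neg_eq by simp
qed

text \<open>Expand \<open>e i\<close> over \<open>e'\<close> in the second slot, exchange the sums,
  and collect \<open>e' j\<close> in the first slot. It allows a near-maximizing family to be traded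
  for one that diagonalizes another form.\<close>

lemma trace_basis_independent:
  assumes R: "bounded_clinear R"
    and e: "\<And>i. i < k \<Longrightarrow> proj e' k (e i) = e i" and e': "\<And>i. i < k \<Longrightarrow> proj e k (e' i) = e' i"
  shows "(\<Sum>i<k. cinner (R (e i)) (e i)) = (\<Sum>i<k. cinner (R (e' i)) (e' i))"
proof -
  have "(\<Sum>i<k. cinner (R (e i)) (e i)) = (\<Sum>i<k. cinner (R (e i)) (proj e' k (e i)))"
    by (simp add: e)
  also have "\<dots> = (\<Sum>i<k. \<Sum>j<k. cinner (R (e i)) (e' j) * cinner (e' j) (e i))"
    by (simp only: cinner_outer_sum_right)
  also have "\<dots> = (\<Sum>j<k. \<Sum>i<k. cinner (R (e i)) (e' j) * cinner (e' j) (e i))"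
    by (rule sum.swap)
  also have "\<dots> = (\<Sum>j<k. cinner (R (proj e k (e' j))) (e' j))"
    unfolding outer_sum_def bounded_clinear_sum[OF R] bounded_clinear_scaleC[OF R]
      cinner_sum_left cinner_scaleC_left
    by (simp only: mult.commute)
  also have "\<dots> = (\<Sum>j<k. cinner (R (e' j)) (e' j))" by (simp add: e')
  finally show ?thesis .
qed

lemma bounded_clinear_outer_sum: "bounded_clinear (outer_sum f e n)"
  unfolding bounded_clinear_def using bounded_linear_outer_sum outer_sum_scaleC by blast

lemma bounded_clinear_dsum_op:
  assumes A: "bounded_clinear A" and B: "bounded_clinear B"
  shows "bounded_clinear (A \<oplus>\<^sub>o\<^sub>p B)"
proof -
  obtain K where K: "K > 0" "\<And>x. norm (A x) \<le> K * norm x" by (rule bounded_clinear_bounded[OF A]) (rule that)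
  obtain L where L: "L > 0" "\<And>x. norm (B x) \<le> L * norm x" by (rule bounded_clinear_bounded[OF B]) (rule that)
  show ?thesis
  proof (rule bounded_clinearI)
    show "(A \<oplus>\<^sub>o\<^sub>p B) (x + y) = (A \<oplus>\<^sub>o\<^sub>p B) x + (A \<oplus>\<^sub>o\<^sub>p B) y" for x y
      by (simp add: dsum_op_def case_prod_beta bounded_clinear_add[OF A] bounded_clinear_add[OF B])
    show "(A \<oplus>\<^sub>o\<^sub>p B) (c *\<^sub>C x) = c *\<^sub>C (A \<oplus>\<^sub>o\<^sub>p B) x" for c x
      by (simp add: dsum_op_def case_prod_beta scaleC_prod_def bounded_clinear_scaleC[OF A] bounded_clinear_scaleC[OF B])
    show "norm ((A \<oplus>\<^sub>o\<^sub>p B) x) \<le> (K + L) * norm x" for x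
    proof -
      have "norm ((A \<oplus>\<^sub>o\<^sub>p B) x) \<le> norm (A (fst x)) + norm (B (snd x))"
        by (simp add: dsum_op_def case_prod_beta norm_Pair_le)
      also have "\<dots> \<le> K * norm (fst x) + L * norm (snd x)" by (intro add_mono K L)
      also have "\<dots> \<le> K * norm x + L * norm x"
        using norm_fst_le[of "fst x" "snd x"] norm_snd_le[of "snd x" "fst x"] K(1) L(1)
        by (intro add_mono mult_left_mono) simp_all
      finally show ?thesis by (simp add: distrib_right)
    qed
  qed
qed

lemma selfadjoint_dsum_op: "selfadjoint A \<Longrightarrow> selfadjoint B \<Longrightarrow> selfadjoint (A \<oplus>\<^sub>o\<^sub>p B)"
  by (simp add: selfadjoint_def dsum_op_def case_prod_beta cinner_prod_def)

section \<open>Compressions of projections on a direct sum\<close>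

text \<open>\<open>fst (proj \<phi> s (u, 0))\<close> is the upper left block of the projection
  applied to \<open>u\<close>; the analogous lemma for \<open>snd\<close> treats the lower right
  block.\<close>

lemma proj_fst_sum:
  assumes D: "bounded_clinear D"
  shows "cinner (D (fst (proj \<phi> s (u, 0)))) w
    = (\<Sum>r<s. cinner u (fst (\<phi> r)) * cinner (D (fst (\<phi> r))) w)"
  by (simp add: outer_sum_def fst_sum scaleC_prod_def cinner_prod_def bounded_clinear_sum[OF D]
      bounded_clinear_scaleC[OF D] cinner_sum_left cinner_scaleC_left)

lemma proj_snd_sum:
  assumes D: "bounded_clinear D"
  shows "cinner (D (snd (proj \<phi> s (0, u)))) w
    = (\<Sum>r<s. cinner u (snd (\<phi> r)) * cinner (D (snd (\<phi> r))) w)"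
  by (simp add: outer_sum_def snd_sum scaleC_prod_def cinner_prod_def bounded_clinear_sum[OF D]
      bounded_clinear_scaleC[OF D] cinner_sum_left cinner_scaleC_left)

lemma norm_fst_reflection_le:
  assumes "orthonormal \<phi> s"
  shows "norm (2 *\<^sub>R fst (proj \<phi> s (u, 0)) - u) \<le> norm u"
proof -
  have "norm (2 *\<^sub>R fst (proj \<phi> s (u, 0)) - u) = norm (fst (2 *\<^sub>R proj \<phi> s (u, 0) - (u, 0)))" by simp
  also have "\<dots> \<le> norm (2 *\<^sub>R proj \<phi> s (u, 0) - (u, 0))" by (metis norm_fst_le prod.collapse)
  also have "\<dots> \<le> norm (u, 0 :: 'b)" by (rule reflection_contraction[OF assms])
  finally show ?thesis by (simp add: norm_Pair)
qed

lemma norm_snd_reflection_le: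
  assumes "orthonormal \<phi> s"
  shows "norm (2 *\<^sub>R snd (proj \<phi> s (0, u)) - u) \<le> norm u"
proof -
  have "norm (2 *\<^sub>R snd (proj \<phi> s (0, u)) - u) = norm (snd (2 *\<^sub>R proj \<phi> s (0, u) - (0, u)))" by simp
  also have "\<dots> \<le> norm (2 *\<^sub>R proj \<phi> s (0, u) - (0, u))" by (metis norm_snd_le prod.collapse)
  also have "\<dots> \<le> norm (0 :: 'a, u)" by (rule reflection_contraction[OF assms])
  finally show ?thesis by (simp add: norm_Pair)
qed

text \<open>The common centre \<open>z\<close> cancels in 2 p - 2 q, so p - q has norm at most 1;
  estimating \<open>p\<close> and \<open>q\<close> one by one would lose a factor 2.\<close>

lemma half_difference_bound:
  fixes p q v :: "'a :: complex_inner"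
  assumes "norm (2 *\<^sub>R p - z) \<le> 1" "norm (2 *\<^sub>R q - z) \<le> 1" "norm v \<le> 1"
  shows "\<bar>Re (cinner p v - cinner q v)\<bar> \<le> 1"
proof -
  have "norm (2 *\<^sub>R (p - q)) \<le> norm (2 *\<^sub>R p - z) + norm (2 *\<^sub>R q - z)"
    using norm_triangle_ineq4[of "2 *\<^sub>R p - z" "2 *\<^sub>R q - z"] by (simp add: scaleR_right_diff_distrib)
  then have "norm (p - q) \<le> 1" using assms(1,2) by simp
  then have "norm (p - q) * norm v \<le> 1" using assms(3) by (simp add: mult_le_one)
  then show ?thesis
    using abs_Re_cinner_le[of "p - q" v] by (simp add: cinner_diff_left)
qed

text \<open>With \<open>P = proj \<phi> s\<close> and the reflection \<open>2 P - 1\<close>, twice the differences below are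
  differences of compressions of the reflection, which are contractions.\<close>

lemma compression_commutator_bound:
  fixes \<phi> :: "nat \<Rightarrow> 'a :: complex_inner \<times> 'a"
  assumes \<phi>: "orthonormal \<phi> s" and D: "bounded_clinear D" "\<And>x. norm (D x) \<le> norm x"
    and uv: "norm u \<le> 1" "norm v \<le> 1"
  shows "\<bar>Re (cinner (D (fst (proj \<phi> s (u, 0)))) v - cinner (snd (proj \<phi> s (0, D u))) v)\<bar> \<le> 1"
    and "\<bar>Re (cinner (fst (proj \<phi> s (D u, 0))) v - cinner (D (snd (proj \<phi> s (0, u)))) v)\<bar> \<le> 1"
proof -
  have Du: "norm (D u) \<le> 1" using D(2)[of u] uv by linarith
  show "\<bar>Re (cinner (D (fst (proj \<phi> s (u, 0)))) v - cinner (snd (proj \<phi> s (0, D u))) v)\<bar> \<le> 1"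
  proof (rule half_difference_bound[OF _ _ uv(2)])
    \<comment> \<open>Both estimates are centred at \<open>D u\<close>: on one side \<open>D\<close>
      follows the compressed reflection, on the other it precedes it.\<close>
    have "norm (2 *\<^sub>R D (fst (proj \<phi> s (u, 0))) - D u) = norm (D (2 *\<^sub>R fst (proj \<phi> s (u, 0)) - u))"
      by (simp only: bounded_clinear_diff[OF D(1)] bounded_clinear_scaleR[OF D(1)])
    then show "norm (2 *\<^sub>R D (fst (proj \<phi> s (u, 0))) - D u) \<le> 1"
      using D(2)[of "2 *\<^sub>R fst (proj \<phi> s (u, 0)) - u"] norm_fst_reflection_le[OF \<phi>, of u] uv(1) by linarith
    show "norm (2 *\<^sub>R snd (proj \<phi> s (0, D u)) - D u) \<le> 1"
      using norm_snd_reflection_le[OF \<phi>, of "D u"] Du by linarith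
  qed
  show "\<bar>Re (cinner (fst (proj \<phi> s (D u, 0))) v - cinner (D (snd (proj \<phi> s (0, u)))) v)\<bar> \<le> 1"
  proof (rule half_difference_bound[OF _ _ uv(2)])
    have "norm (2 *\<^sub>R D (snd (proj \<phi> s (0, u))) - D u) = norm (D (2 *\<^sub>R snd (proj \<phi> s (0, u)) - u))"
      by (simp only: bounded_clinear_diff[OF D(1)] bounded_clinear_scaleR[OF D(1)])
    then show "norm (2 *\<^sub>R D (snd (proj \<phi> s (0, u))) - D u) \<le> 1"
      using D(2)[of "2 *\<^sub>R snd (proj \<phi> s (0, u)) - u"] norm_snd_reflection_le[OF \<phi>, of u] uv(1) by linarith
    show "norm (2 *\<^sub>R fst (proj \<phi> s (D u, 0)) - D u) \<le> 1"
      using norm_fst_reflection_le[OF \<phi>, of "D u"] Du by linarith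
  qed
qed


section \<open>The coefficient matrix of the pairing\<close>

text \<open>With \<open>Z = \<Sum>\<^sub>i \<langle>-, f i\<rangle> e i\<close> and the basis \<open>\<phi>\<close> of a subspace of the direct sum, \<open>pairing_coeff r j\<close>
  is the real part of the diagonal entry at \<open>\<phi> r\<close> of \<open>U Z \<oplus> - Z U\<close>, where \<open>U = \<langle>-, v j\<rangle> u j\<close>.\<close>

locale pairing =
  fixes e f u v :: "nat \<Rightarrow> 'a :: complex_inner" and \<phi> :: "nat \<Rightarrow> 'a \<times> 'a" and k n N :: nat
  assumes e: "suborthonormal e k" and f: "suborthonormal f k"
    and u: "suborthonormal u n" and v: "suborthonormal v n"
    and \<phi>: "orthonormal \<phi> N"
    and u_fixed: "\<And>j. j < n \<Longrightarrow> proj \<phi> N (u j, 0) = (u j, 0)"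
    and e_fixed: "\<And>i. i < k \<Longrightarrow> proj \<phi> N (0, e i) = (0, e i)"
begin

abbreviation "Z \<equiv> outer_sum f e k"

definition pairing_coeff :: "nat \<Rightarrow> nat \<Rightarrow> real" where
  "pairing_coeff r j = Re (cinner (Z (fst (\<phi> r))) (v j) * cinner (u j) (fst (\<phi> r))
    - cinner (snd (\<phi> r)) (v j) * cinner (Z (u j)) (snd (\<phi> r)))"

lemma norm_Z: "norm (Z x) \<le> norm x"
  by (rule norm_outer_sum_le[OF f e])

lemma proj_embedded_combination:
  "proj \<phi> N (0, \<Sum>i<k. c i *\<^sub>C e i) = (0, \<Sum>i<k. c i *\<^sub>C e i)"
  "proj \<phi> N (\<Sum>j<n. d j *\<^sub>C u j, 0) = (\<Sum>j<n. d j *\<^sub>C u j, 0)"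
proof -
  have 1: "(0, \<Sum>i<k. c i *\<^sub>C e i) = (\<Sum>i<k. c i *\<^sub>C (0 :: 'a, e i))"
    by (simp add: prod_eq_iff fst_sum snd_sum scaleC_prod_def)
  have 2: "(\<Sum>j<n. d j *\<^sub>C u j, 0) = (\<Sum>j<n. d j *\<^sub>C (u j, 0 :: 'a))"
    by (simp add: prod_eq_iff fst_sum snd_sum scaleC_prod_def)
  show "proj \<phi> N (0, \<Sum>i<k. c i *\<^sub>C e i) = (0, \<Sum>i<k. c i *\<^sub>C e i)"
    unfolding 1 outer_sum_sum outer_sum_scaleC by (intro sum.cong refl) (simp add: e_fixed)
  show "proj \<phi> N (\<Sum>j<n. d j *\<^sub>C u j, 0) = (\<Sum>j<n. d j *\<^sub>C u j, 0)"
    unfolding 2 outer_sum_sum outer_sum_scaleC by (intro sum.cong refl) (simp add: u_fixed)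
qed

text \<open>The weights serve two purposes: constant 1 in the bounds for block sums, and \<sigma> in
  the trace identity, where the outer sum becomes a finite-rank copy of X.\<close>

lemma row_sum_eq:
  "(\<Sum>j<t. s j * pairing_coeff r j) =
    Re (cinner (outer_sum v (\<lambda>j. s j *\<^sub>R u j) t (Z (fst (\<phi> r)))) (fst (\<phi> r))
      - cinner (Z (outer_sum v (\<lambda>j. s j *\<^sub>R u j) t (snd (\<phi> r)))) (snd (\<phi> r)))"
proof -
  let ?x = "fst (\<phi> r)" and ?y = "snd (\<phi> r)"
  have 1: "cinner (outer_sum v (\<lambda>j. s j *\<^sub>R u j) t (Z ?x)) ?x
      = (\<Sum>j<t. s j * (cinner (Z ?x) (v j) * cinner (u j) ?x))"
    unfolding cinner_outer_sum_left cinner_scaleR_left by (intro sum.cong refl) (simp only: mult.left_commute)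
  have "cinner (Z (outer_sum v (\<lambda>j. s j *\<^sub>R u j) t ?y)) ?y
      = cinner (outer_sum v (\<lambda>j. s j *\<^sub>R u j) t ?y) (outer_sum e f k ?y)"
    by (rule outer_sum_adjoint)
  also have "\<dots> = (\<Sum>j<t. s j * (cinner ?y (v j) * cinner (u j) (outer_sum e f k ?y)))"
    unfolding cinner_outer_sum_left[of _ _ t] cinner_scaleR_left
    by (intro sum.cong refl) (simp only: mult.left_commute)
  finally have 2: "cinner (Z (outer_sum v (\<lambda>j. s j *\<^sub>R u j) t ?y)) ?y
      = (\<Sum>j<t. s j * (cinner ?y (v j) * cinner (Z (u j)) ?y))"
    by (simp only: outer_sum_adjoint[of f e])
  show ?thesis
    unfolding 1 2 sum_subtractf[symmetric] Re_sum pairing_coeff_def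
    by (intro sum.cong refl) (simp add: right_diff_distrib)
qed

text \<open>Contractions bound the two terms by |x|^2 and |y|^2, where (x, y) = \<phi> r is a unit
  vector.\<close>

lemma row_bound:
  assumes "t \<le> n" "r < N"
  shows "\<bar>\<Sum>j<t. pairing_coeff r j\<bar> \<le> 1"
proof -
  let ?W = "outer_sum v u t" and ?x = "fst (\<phi> r)" and ?y = "snd (\<phi> r)"
  have W: "norm (?W x) \<le> norm x" for x
    by (intro norm_outer_sum_le suborthonormal_mono[OF v assms(1)] suborthonormal_mono[OF u assms(1)])
  have eq: "(\<Sum>j<t. pairing_coeff r j) = Re (cinner (?W (Z ?x)) ?x - cinner (Z (?W ?y)) ?y)"
    using row_sum_eq[of "\<lambda>_. 1" r t] by simp
  have "\<bar>Re (cinner (?W (Z ?x)) ?x)\<bar> \<le> norm ?x * norm ?x"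
    by (rule order_trans[OF abs_Re_cinner_le mult_right_mono[OF order_trans[OF W norm_Z]]]) simp
  moreover have "\<bar>Re (cinner (Z (?W ?y)) ?y)\<bar> \<le> norm ?y * norm ?y"
    by (rule order_trans[OF abs_Re_cinner_le mult_right_mono[OF order_trans[OF norm_Z W]]]) simp
  moreover have "norm ?x * norm ?x + norm ?y * norm ?y = 1"
    using orthonormal_norm[OF \<phi> assms(2)] norm_Pair[of ?x ?y] by (simp add: power2_eq_square)
  ultimately show ?thesis unfolding eq by simp
qed

text \<open>With P11 and P22 the diagonal blocks of \<open>proj \<phi> s\<close>, this is the real
  part of <(Z P11 - P22 Z) (u j), v j>, the shape of the commutator bound.\<close>

lemma column_sum_eq:
  "(\<Sum>r<s. pairing_coeff r j) = Re (cinner (Z (fst (proj \<phi> s (u j, 0)))) (v j)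
    - cinner (snd (proj \<phi> s (0, Z (u j)))) (v j))"
  unfolding proj_fst_sum[OF bounded_clinear_outer_sum] proj_snd_sum[OF bounded_clinear_id] pairing_coeff_def
  by (simp add: sum_subtractf Re_sum mult.commute)

lemma column_bound:
  assumes "s \<le> N" "j < n"
  shows "\<bar>\<Sum>r<s. pairing_coeff r j\<bar> \<le> 1"
  unfolding column_sum_eq
  by (rule compression_commutator_bound(1)[OF orthonormal_mono[OF \<phi> assms(1)] bounded_clinear_outer_sum norm_Z])
    (use u v assms(2) in \<open>simp_all add: suborthonormal_def\<close>)

text \<open>For s = N the projection fixes (u j, 0), and also (0, Z (u j)) because \<open>Z\<close>
  maps into the span of \<open>e\<close>; both terms are then <Z (u j), v j>.\<close>

lemma column_total:
  assumes "j < n"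
  shows "(\<Sum>r<N. pairing_coeff r j) = 0"
proof -
  have "proj \<phi> N (0, Z (u j)) = (0, Z (u j))"
    using proj_embedded_combination(1)[of "\<lambda>i. cinner (u j) (f i)"] by (simp add: outer_sum_def[of f e])
  then show ?thesis unfolding column_sum_eq by (simp add: u_fixed[OF assms])
qed

text \<open>The column bound with exchanged roles: now \<open>Z\<close> is split into its k rank-one
  terms and the outer sum of \<open>v\<close> and \<open>u\<close> is kept whole, so each i < k
  contributes at most 1.\<close>

lemma block_bound_rank:
  assumes "s \<le> N" "t \<le> n"
  shows "(\<Sum>r<s. \<Sum>j<t. pairing_coeff r j) \<le> real k"
proof -
  let ?W = "outer_sum v u t"
  have W: "norm (?W x) \<le> norm x" for x
    by (intro norm_outer_sum_le suborthonormal_mono[OF v assms(2)] suborthonormal_mono[OF u assms(2)])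
  have W_lin: "bounded_clinear ?W" by (rule bounded_clinear_outer_sum)
  have "(\<Sum>r<s. \<Sum>j<t. pairing_coeff r j)
      = (\<Sum>r<s. Re (cinner (?W (Z (fst (\<phi> r)))) (fst (\<phi> r)) - cinner (Z (?W (snd (\<phi> r)))) (snd (\<phi> r))))"
    using row_sum_eq[of "\<lambda>_. 1" _ t] by simp
  also have "\<dots> = (\<Sum>r<s. \<Sum>i<k. Re (cinner (?W (e i)) (fst (\<phi> r)) * cinner (fst (\<phi> r)) (f i)
      - cinner (e i) (snd (\<phi> r)) * cinner (?W (snd (\<phi> r))) (f i)))"
  proof (intro sum.cong refl)
    fix r
    have "cinner (?W (Z (fst (\<phi> r)))) (fst (\<phi> r))
        = (\<Sum>i<k. cinner (fst (\<phi> r)) (f i) * cinner (?W (e i)) (fst (\<phi> r)))"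
      unfolding outer_sum_def[of f e] bounded_clinear_sum[OF W_lin] bounded_clinear_scaleC[OF W_lin]
        cinner_sum_left cinner_scaleC_left ..
    moreover have "cinner (Z (?W (snd (\<phi> r)))) (snd (\<phi> r))
        = (\<Sum>i<k. cinner (?W (snd (\<phi> r))) (f i) * cinner (e i) (snd (\<phi> r)))"
      by (rule cinner_outer_sum_left)
    ultimately show "Re (cinner (?W (Z (fst (\<phi> r)))) (fst (\<phi> r)) - cinner (Z (?W (snd (\<phi> r)))) (snd (\<phi> r)))
        = (\<Sum>i<k. Re (cinner (?W (e i)) (fst (\<phi> r)) * cinner (fst (\<phi> r)) (f i)
          - cinner (e i) (snd (\<phi> r)) * cinner (?W (snd (\<phi> r))) (f i)))"
      by (simp only: Re_sum[symmetric] sum_subtractf mult.commute)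
  qed
  also have "\<dots> = (\<Sum>i<k. \<Sum>r<s. Re (cinner (?W (e i)) (fst (\<phi> r)) * cinner (fst (\<phi> r)) (f i)
      - cinner (e i) (snd (\<phi> r)) * cinner (?W (snd (\<phi> r))) (f i)))"
    by (rule sum.swap)
  also have "\<dots> = (\<Sum>i<k. Re (cinner (fst (proj \<phi> s (?W (e i), 0))) (f i)
      - cinner (?W (snd (proj \<phi> s (0, e i)))) (f i)))"
    unfolding proj_fst_sum[OF bounded_clinear_id] proj_snd_sum[OF W_lin]
    by (simp only: Re_sum[symmetric] sum_subtractf)
  also have "\<dots> \<le> (\<Sum>i<k. 1)"
  proof (rule sum_mono)
    fix i assume "i \<in> {..<k}"
    then have "norm (e i) \<le> 1" "norm (f i) \<le> 1" using e f by (simp_all add: suborthonormal_def)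
    from compression_commutator_bound(2)[OF orthonormal_mono[OF \<phi> assms(1)] W_lin W this]
    show "Re (cinner (fst (proj \<phi> s (?W (e i), 0))) (f i) - cinner (?W (snd (proj \<phi> s (0, e i)))) (f i)) \<le> 1"
      by (simp only: abs_le_iff)
  qed
  finally show ?thesis by simp
qed

lemma block_total:
  assumes "t \<le> n"
  shows "(\<Sum>r<N. \<Sum>j<t. pairing_coeff r j) = 0"
  by (subst sum.swap) (use assms in \<open>simp add: column_total\<close>)

lemma block_bound:
  assumes "s \<le> N" "t \<le> n"
  shows "(\<Sum>r<s. \<Sum>j<t. pairing_coeff r j) \<le> real (min (min s (N - s)) (min t k))"
proof -
  let ?S = "\<Sum>r<s. \<Sum>j<t. pairing_coeff r j"
  have "?S \<le> (\<Sum>r<s. 1)"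
    by (rule sum_mono) (use row_bound[OF assms(2)] assms(1) in \<open>simp add: abs_le_iff\<close>)
  then have 1: "?S \<le> real s" by simp
  \<comment> \<open>The bound N - s comes from the other rows: all rows together sum to 0, and each
    of the last N - s contributes at least -1.\<close>
  have "(\<Sum>r<N. \<Sum>j<t. pairing_coeff r j) = ?S + (\<Sum>r\<in>{s..<N}. \<Sum>j<t. pairing_coeff r j)"
    using assms(1) by (metis sum.atLeastLessThan_concat lessThan_atLeast0 zero_le)
  moreover have "(\<Sum>r\<in>{s..<N}. - 1) \<le> (\<Sum>r\<in>{s..<N}. \<Sum>j<t. pairing_coeff r j)"
  proof (rule sum_mono)
    fix r assume "r \<in> {s..<N}"
    then show "- 1 \<le> (\<Sum>j<t. pairing_coeff r j)"
      using row_bound[OF assms(2), of r] by (simp add: abs_le_iff)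
  qed
  ultimately have 2: "?S \<le> real (N - s)" by (simp add: block_total[OF assms(2)])
  have "?S = (\<Sum>j<t. \<Sum>r<s. pairing_coeff r j)" by (rule sum.swap)
  also have "\<dots> \<le> (\<Sum>j<t. 1)"
  proof (rule sum_mono)
    fix j assume "j \<in> {..<t}"
    then show "(\<Sum>r<s. pairing_coeff r j) \<le> 1"
      using column_bound[OF assms(1), of j] assms(2) by (simp add: abs_le_iff)
  qed
  finally have 3: "?S \<le> real t" by simp
  show ?thesis using 1 2 3 block_bound_rank[OF assms] by (simp add: min_def)
qed

lemma pairing_sum_bound:
  fixes \<gamma> \<sigma> :: "nat \<Rightarrow> real"
  assumes "\<And>i. Suc i < N \<Longrightarrow> \<gamma> (Suc i) \<le> \<gamma> i"
    and "\<And>i. Suc i < n \<Longrightarrow> \<sigma> (Suc i) \<le> \<sigma> i" "\<And>i. i < n \<Longrightarrow> 0 \<le> \<sigma> i"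
    and "k \<le> n" "2 * k \<le> N"
  shows "(\<Sum>r<N. \<Sum>j<n. \<gamma> r * \<sigma> j * pairing_coeff r j) \<le> (\<Sum>i<k. (\<gamma> i - \<gamma> (N - 1 - i)) * \<sigma> i)"
  by (rule bilinear_summation_by_parts[of N \<gamma> n \<sigma> k pairing_coeff, OF assms block_bound block_total])

text \<open>One trace, with the blocks Y Z and - Z Y multiplied by the direct sum, is evaluated
  twice: over the basis \<phi> it gives the right side, and after expanding \<open>Z\<close> into
  rank-one terms it gives the left side.\<close>

lemma pairing_sum_eq:
  fixes A B X :: "'a \<Rightarrow> 'a"
  assumes A: "bounded_clinear A" "selfadjoint A" and B: "bounded_clinear B" "selfadjoint B"
    and X: "bounded_clinear X" and X_sv: "\<And>j. j < n \<Longrightarrow> X (v j) = \<sigma> j *\<^sub>R u j"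
    and v_fixed: "\<And>i. i < k \<Longrightarrow> proj v n (e i) = e i" "\<And>i. i < k \<Longrightarrow> proj v n (B (e i)) = B (e i)"
    and f_fixed: "\<And>i. i < k \<Longrightarrow> proj \<phi> N (f i, 0) = (f i, 0)"
    and Be_fixed: "\<And>i. i < k \<Longrightarrow> proj \<phi> N (0, B (e i)) = (0, B (e i))"
    and diag: "\<And>r s. r < N \<Longrightarrow> s < N \<Longrightarrow> r \<noteq> s \<Longrightarrow> cinner ((A \<oplus>\<^sub>o\<^sub>p B) (\<phi> r)) (\<phi> s) = 0"
    and \<gamma>: "\<And>r. r < N \<Longrightarrow> \<gamma> r = Re (cinner ((A \<oplus>\<^sub>o\<^sub>p B) (\<phi> r)) (\<phi> r))"
  shows "(\<Sum>i<k. Re (cinner (A (X (e i)) - X (B (e i))) (f i)))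
    = (\<Sum>r<N. \<Sum>j<n. \<gamma> r * \<sigma> j * pairing_coeff r j)"
proof -
  \<comment> \<open>\<open>Y\<close> agrees with \<open>X\<close> on the span of \<open>v\<close>,
    in particular at \<open>e i\<close> and \<open>B (e i)\<close>, and its range lies in the span
    of \<open>u\<close>.\<close>
  define Y where "Y = outer_sum v (\<lambda>j. \<sigma> j *\<^sub>R u j) n"
  have Y_lin: "bounded_clinear Y" unfolding Y_def by (rule bounded_clinear_outer_sum)
  have Y_eq: "Y x = X x" if "proj v n x = x" for x
  proof -
    have "X x = X (proj v n x)" by (simp add: that)
    also have "\<dots> = (\<Sum>j<n. cinner x (v j) *\<^sub>C X (v j))"
      unfolding outer_sum_def bounded_clinear_sum[OF X] bounded_clinear_scaleC[OF X] ..
    finally show ?thesis by (simp add: Y_def outer_sum_def X_sv)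
  qed
  let ?x = "\<lambda>r. fst (\<phi> r)" and ?y = "\<lambda>r. snd (\<phi> r)" and ?C = "A \<oplus>\<^sub>o\<^sub>p B"
  define H where "H r = (Y (Z (?x r)), - Z (Y (?y r)))" for r
  have C_sa: "cinner (?C \<xi>) \<eta> = cinner \<xi> (?C \<eta>)" for \<xi> \<eta>
    using selfadjoint_dsum_op[OF A(2) B(2)] unfolding selfadjoint_def by blast
  \<comment> \<open>The \<phi> r diagonalize the form of \<open>?C\<close> on their span without
    being eigenvectors. The expansion of <H r, ?C (\<phi> r)> over \<phi> is legitimate because
    \<open>H r\<close> lies in that span.\<close>
  have H_fixed: "proj \<phi> N (H r) = H r" for r
  proof -
    have "proj \<phi> N (Y (Z (?x r)), 0) = (Y (Z (?x r)), 0)"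
      using proj_embedded_combination(2)[of "\<lambda>j. cinner (Z (?x r)) (v j) * \<sigma> j"]
      by (simp add: Y_def outer_sum_def[of v "\<lambda>j. \<sigma> j *\<^sub>R u j"] scaleC_scaleC[symmetric] scaleC_of_real
          del: complex_vector.scale_scale)
    moreover have "proj \<phi> N (0, - Z (Y (?y r))) = (0, - Z (Y (?y r)))"
      using proj_embedded_combination(1)[of "\<lambda>i. - cinner (Y (?y r)) (f i)"]
      by (simp add: outer_sum_def[of f e] sum_negf)
    moreover have "H r = (Y (Z (?x r)), 0) + (0, - Z (Y (?y r)))" by (simp add: H_def)
    ultimately show ?thesis by (simp only: outer_sum_add)
  qed
  have row: "(\<Sum>j<n. \<gamma> r * \<sigma> j * pairing_coeff r j) = Re (cinner (H r) (?C (\<phi> r)))" if r: "r < N" for r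
  proof -
    have "(\<Sum>j<n. \<gamma> r * \<sigma> j * pairing_coeff r j) = \<gamma> r * Re (cinner (H r) (\<phi> r))"
      using row_sum_eq[of \<sigma> r n]
      by (simp add: sum_distrib_left[symmetric] mult.assoc H_def Y_def cinner_prod_def cinner_minus_left)
    also have "\<dots> = Re (cinner (H r) (?C (\<phi> r)))"
    proof -
      have "cinner (H r) (?C (\<phi> r)) = cinner (proj \<phi> N (H r)) (?C (\<phi> r))" by (simp only: H_fixed)
      also have "\<dots> = (\<Sum>s<N. cinner (H r) (\<phi> s) * cinner (?C (\<phi> s)) (\<phi> r))"
        by (simp only: cinner_outer_sum_left C_sa)
      also have "\<dots> = (\<Sum>s<N. if s = r then cinner (H r) (\<phi> r) * cinner (?C (\<phi> r)) (\<phi> r) else 0)"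
        using diag r by (intro sum.cong refl) auto
      also have "\<dots> = cinner (H r) (\<phi> r) * cinner (?C (\<phi> r)) (\<phi> r)" using r by simp
      also have "cinner (?C (\<phi> r)) (\<phi> r) = complex_of_real (\<gamma> r)"
        unfolding \<gamma>[OF r] by (rule selfadjoint_cinner_real[OF selfadjoint_dsum_op[OF A(2) B(2)]])
      finally show ?thesis by simp
    qed
    finally show ?thesis .
  qed
  have H_C: "cinner (H r) (?C (\<phi> r)) = (\<Sum>i<k. cinner (A (X (e i))) (?x r) * cinner (?x r) (f i)
      - cinner (B (e i)) (?y r) * cinner (Y (?y r)) (f i))" for r
  proof -
    have "cinner (Y (Z (?x r))) (A (?x r)) = (\<Sum>i<k. cinner (?x r) (f i) * cinner (Y (e i)) (A (?x r)))"
      unfolding outer_sum_def[of f e] bounded_clinear_sum[OF Y_lin] bounded_clinear_scaleC[OF Y_lin]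
        cinner_sum_left cinner_scaleC_left ..
    also have "\<dots> = (\<Sum>i<k. cinner (A (X (e i))) (?x r) * cinner (?x r) (f i))"
      using A(2) by (intro sum.cong refl) (simp add: selfadjoint_def Y_eq v_fixed)
    finally have 1: "cinner (Y (Z (?x r))) (A (?x r)) = (\<Sum>i<k. cinner (A (X (e i))) (?x r) * cinner (?x r) (f i))" .
    have "cinner (Z (Y (?y r))) (B (?y r)) = (\<Sum>i<k. cinner (Y (?y r)) (f i) * cinner (e i) (B (?y r)))"
      by (rule cinner_outer_sum_left)
    also have "\<dots> = (\<Sum>i<k. cinner (B (e i)) (?y r) * cinner (Y (?y r)) (f i))"
      using B(2) by (intro sum.cong refl) (simp add: selfadjoint_def)
    finally have 2: "cinner (Z (Y (?y r))) (B (?y r)) = (\<Sum>i<k. cinner (B (e i)) (?y r) * cinner (Y (?y r)) (f i))" .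
    show ?thesis
      by (simp add: H_def dsum_op_def case_prod_beta cinner_prod_def cinner_minus_left 1 2 sum_subtractf)
  qed
  have "(\<Sum>r<N. \<Sum>j<n. \<gamma> r * \<sigma> j * pairing_coeff r j) = (\<Sum>r<N. Re (cinner (H r) (?C (\<phi> r))))"
    using row by (intro sum.cong refl) simp
  also have "\<dots> = Re (\<Sum>r<N. \<Sum>i<k. cinner (A (X (e i))) (?x r) * cinner (?x r) (f i)
      - cinner (B (e i)) (?y r) * cinner (Y (?y r)) (f i))"
    by (simp only: H_C Re_sum)
  also have "(\<Sum>r<N. \<Sum>i<k. cinner (A (X (e i))) (?x r) * cinner (?x r) (f i)
        - cinner (B (e i)) (?y r) * cinner (Y (?y r)) (f i))
      = (\<Sum>i<k. \<Sum>r<N. cinner (A (X (e i))) (?x r) * cinner (?x r) (f i)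
        - cinner (B (e i)) (?y r) * cinner (Y (?y r)) (f i))"
    by (rule sum.swap)
  also have "\<dots> = (\<Sum>i<k. cinner (fst (proj \<phi> N (A (X (e i)), 0))) (f i)
      - cinner (Y (snd (proj \<phi> N (0, B (e i))))) (f i))"
    unfolding proj_fst_sum[OF bounded_clinear_id] proj_snd_sum[OF Y_lin] by (simp only: sum_subtractf)
  also have "\<dots> = (\<Sum>i<k. cinner (A (X (e i)) - X (B (e i))) (f i))"
  proof (intro sum.cong refl)
    fix i assume "i \<in> {..<k}"
    then have i: "i < k" by simp
    \<comment> \<open>\<open>A (X (e i))\<close> may leave the chosen subspace; the projection is
      moved to (f i, 0), which it fixes.\<close>
    have "cinner (fst (proj \<phi> N (A (X (e i)), 0))) (f i) = cinner (proj \<phi> N (A (X (e i)), 0)) (f i, 0 :: 'a)"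
      by (simp add: cinner_prod_def)
    also have "\<dots> = cinner (A (X (e i)), 0 :: 'a) (f i, 0 :: 'a)"
      unfolding outer_sum_adjoint[of \<phi> \<phi>] f_fixed[OF i] ..
    also have "\<dots> = cinner (A (X (e i))) (f i)" by (simp add: cinner_prod_def)
    finally show "cinner (fst (proj \<phi> N (A (X (e i)), 0))) (f i) - cinner (Y (snd (proj \<phi> N (0, B (e i))))) (f i)
        = cinner (A (X (e i)) - X (B (e i))) (f i)"
      by (simp add: Be_fixed[OF i] Y_eq[OF v_fixed(2)[OF i]] cinner_diff_left)
  qed
  finally show ?thesis by (simp only: Re_sum)
qed

end

section \<open>The submajorization\<close>

text \<open>The intermediate sequence \<open>g\<close> is exposed because a nonincreasing sequence
  below the product of spread and singular values is also below the decreasing rearrangement of that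
  product.\<close>

lemma commutator_pairing_bound:
  fixes A B X :: "'a :: chilbert_space \<Rightarrow> 'a"
  assumes inf: "\<And>n. \<exists>e :: nat \<Rightarrow> 'a. orthonormal e n"
    and A: "bounded_clinear A" "selfadjoint A" and B: "bounded_clinear B" "selfadjoint B"
    and X: "bounded_clinear X"
    and e: "orthonormal e k" and f: "suborthonormal f k"
  shows "\<exists>g. (\<forall>i j. i \<le> j \<longrightarrow> j < k \<longrightarrow> g j \<le> g i) \<and>
    (\<forall>i<k. g i \<le> spectral_spread (A \<oplus>\<^sub>o\<^sub>p B) i * singular_values X i) \<and>
    (\<Sum>i<k. Re (cinner (A (X (e i)) - X (B (e i))) (f i))) \<le> (\<Sum>i<k. g i)"
proof -
  let ?C = "A \<oplus>\<^sub>o\<^sub>p B"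
  \<comment> \<open>The vectors \<open>e i\<close> and \<open>B (e i)\<close> are those at which the
    tested commutator evaluates \<open>X\<close>.\<close>
  obtain b n where b: "orthonormal b n" "\<forall>x\<in>e ` {..<k} \<union> (\<lambda>i. B (e i)) ` {..<k}. proj b n x = x"
    using gram_schmidt[of "e ` {..<k} \<union> (\<lambda>i. B (e i)) ` {..<k}"] by auto
  obtain v where v: "orthonormal v n" "\<forall>x. proj b n x = x \<longrightarrow> proj v n x = x"
    "\<forall>i<n. \<forall>j<n. i \<noteq> j \<longrightarrow> cinner (cadjoint X (X (v i))) (v j) = 0"
    "\<forall>i j. i \<le> j \<longrightarrow> j < n \<longrightarrow> Re (cinner (cadjoint X (X (v j))) (v j)) \<le> Re (cinner (cadjoint X (X (v i))) (v i))"
    by (rule hermitian_form_diagonalization[OF cadjoint_comp(1,2)[OF X] b(1)]) (rule that)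
  have v_fixed: "proj v n (e i) = e i" "proj v n (B (e i)) = B (e i)" if "i < k" for i
    using b(2) v(2) that by auto
  define \<sigma> where "\<sigma> j = norm (X (v j))" for j
  \<comment> \<open>For \<sigma> j = 0 division by zero makes \<open>u j\<close> zero, so
    \<open>X_sv\<close> has no exception.\<close>
  define u where "u j = (1 / \<sigma> j) *\<^sub>R X (v j)" for j
  have X_orth: "cinner (X (v i)) (X (v j)) = 0" if "i < n" "j < n" "i \<noteq> j" for i j
    using v(3) that by (simp add: cadjoint_comp(3)[OF X])
  have u: "suborthonormal u n"
    unfolding suborthonormal_def u_def
    by (auto simp: \<sigma>_def cinner_scaleR_left cinner_scaleR_right X_orth)
  have X_sv: "X (v j) = \<sigma> j *\<^sub>R u j" for j by (simp add: u_def \<sigma>_def)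
  have \<sigma>_mono: "\<sigma> j \<le> \<sigma> i" if "i \<le> j" "j < n" for i j
  proof (rule power2_le_imp_le)
    show "(\<sigma> j)\<^sup>2 \<le> (\<sigma> i)\<^sup>2"
      using v(4) that by (simp only: cadjoint_comp(3)[OF X] Re_cinner_self \<sigma>_def)
  qed (simp add: \<sigma>_def)
  have \<sigma>_nonneg: "0 \<le> \<sigma> j" for j by (simp add: \<sigma>_def)
  have kn: "k \<le> n" by (rule orthonormal_card_le[OF v(1) e v_fixed(1)])
  \<comment> \<open>(u j, 0) and (0, e i) capture the ranges of the two blocks, (f i, 0) and (0, B
    (e i)) let the projection drop out of the trace, and (e i, 0) together with (0, e i) makes the
    dimension at least 2 k.\<close>
  define G where "G = (\<lambda>i. (e i, 0 :: 'a)) ` {..<k} \<union> (\<lambda>i. (f i, 0)) ` {..<k} \<union> (\<lambda>j. (u j, 0)) ` {..<n}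
    \<union> (\<lambda>i. (0, e i)) ` {..<k} \<union> (\<lambda>i. (0, B (e i))) ` {..<k}"
  obtain c N where c: "orthonormal c N" "\<forall>\<xi>\<in>G. proj c N \<xi> = \<xi>"
    using gram_schmidt[of G] by (auto simp: G_def)
  have C: "bounded_clinear ?C" "selfadjoint ?C"
    by (rule bounded_clinear_dsum_op[OF A(1) B(1)]) (rule selfadjoint_dsum_op[OF A(2) B(2)])
  obtain \<phi> where \<phi>: "orthonormal \<phi> N" "\<forall>\<xi>. proj c N \<xi> = \<xi> \<longrightarrow> proj \<phi> N \<xi> = \<xi>"
    "\<forall>r<N. \<forall>s<N. r \<noteq> s \<longrightarrow> cinner (?C (\<phi> r)) (\<phi> s) = 0"
    "\<forall>r s. r \<le> s \<longrightarrow> s < N \<longrightarrow> Re (cinner (?C (\<phi> s)) (\<phi> s)) \<le> Re (cinner (?C (\<phi> r)) (\<phi> r))"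
    by (rule hermitian_form_diagonalization[OF C c(1)]) (rule that)
  have "\<forall>\<xi>\<in>G. proj \<phi> N \<xi> = \<xi>" using c(2) \<phi>(2) by blast
  then have fixed: "i < k \<Longrightarrow> proj \<phi> N (e i, 0) = (e i, 0)" "i < k \<Longrightarrow> proj \<phi> N (f i, 0) = (f i, 0)"
    "j < n \<Longrightarrow> proj \<phi> N (u j, 0) = (u j, 0)" "i < k \<Longrightarrow> proj \<phi> N (0, e i) = (0, e i)"
    "i < k \<Longrightarrow> proj \<phi> N (0, B (e i)) = (0, B (e i))" for i j
    by (simp_all add: G_def)
  \<comment> \<open>These 2 k orthonormal vectors keep the first k and the last k of the \<gamma> at
    disjoint positions, so that the gaps are nonnegative.\<close>
  define w where "w l = (if l < k then (e l, 0) else (0, e (l - k)))" for l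
  have w: "orthonormal w (2 * k)"
    unfolding orthonormal_def w_def by (auto simp: cinner_prod_def orthonormal_cinner[OF e])
  have kN: "2 * k \<le> N"
    by (rule orthonormal_card_le[OF \<phi>(1) w]) (simp add: w_def fixed)
  define \<gamma> where "\<gamma> r = Re (cinner (?C (\<phi> r)) (\<phi> r))" for r
  have \<gamma>_mono: "\<gamma> s \<le> \<gamma> r" if "r \<le> s" "s < N" for r s
    using \<phi>(4) that by (simp add: \<gamma>_def)
  interpret P: pairing e f u v \<phi> k n N
    by unfold_locales (use orthonormal_sub[OF e] f u orthonormal_sub[OF v(1)] \<phi>(1) fixed in simp_all)
  define g where "g i = (\<gamma> i - \<gamma> (N - 1 - i)) * \<sigma> i" for i
  have "(\<Sum>i<k. Re (cinner (A (X (e i)) - X (B (e i))) (f i)))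
      = (\<Sum>r<N. \<Sum>j<n. \<gamma> r * \<sigma> j * P.pairing_coeff r j)"
    by (rule P.pairing_sum_eq[OF A B X X_sv v_fixed fixed(2,5)])
      (use \<phi>(3) in \<open>simp_all add: \<gamma>_def\<close>)
  also have "\<dots> \<le> (\<Sum>i<k. g i)"
    unfolding g_def by (rule P.pairing_sum_bound) (use \<gamma>_mono \<sigma>_mono \<sigma>_nonneg kn kN in simp_all)
  finally have total: "(\<Sum>i<k. Re (cinner (A (X (e i)) - X (B (e i))) (f i))) \<le> (\<Sum>i<k. g i)" .
  have gap: "0 \<le> \<gamma> i - \<gamma> (N - 1 - i)" if "i < k" for i
    using \<gamma>_mono[of i "N - 1 - i"] that kN by simp
  have g_mono: "g j \<le> g i" if "i \<le> j" "j < k" for i j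
    unfolding g_def
  proof (rule mult_mono)
    show "\<gamma> j - \<gamma> (N - 1 - j) \<le> \<gamma> i - \<gamma> (N - 1 - i)"
      using \<gamma>_mono[of i j] \<gamma>_mono[of "N - 1 - j" "N - 1 - i"] that kN by (simp add: diff_le_mono2)
    show "\<sigma> j \<le> \<sigma> i" using \<sigma>_mono that kn by simp
    show "0 \<le> \<gamma> i - \<gamma> (N - 1 - i)" using gap that by simp
  qed (rule \<sigma>_nonneg)
  have g_le: "g i \<le> spectral_spread ?C i * singular_values X i" if i: "i < k" for i
  proof -
    have "\<gamma> i \<le> spectral_scale ?C (int i + 1)"
    proof (rule spectral_scale_ge_diagonal[OF C(1) orthonormal_mono[OF \<phi>(1)]])
      show "Suc i \<le> N" using i kN by simp
      show "cinner (?C (\<phi> a)) (\<phi> b) = 0" if "a \<le> i" "b \<le> i" "a \<noteq> b" for a b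
        using \<phi>(3) that i kN by simp
      show "\<gamma> i \<le> Re (cinner (?C (\<phi> a)) (\<phi> a))" if "a \<le> i" for a
        using \<gamma>_mono[of a i] that i kN by (simp add: \<gamma>_def)
    qed
    \<comment> \<open>The reversed basis starts with the smallest \<gamma>, as the lower half of the
      scale requires.\<close>
    moreover have "spectral_scale ?C (- (int i + 1)) \<le> \<gamma> (N - 1 - i)"
    proof (rule spectral_scale_neg_le_diagonal[OF C(1), of "\<lambda>l. \<phi> (N - 1 - l)"])
      show "orthonormal (\<lambda>l. \<phi> (N - 1 - l)) (Suc i)"
        unfolding orthonormal_def
      proof (intro allI impI)
        fix a b assume ab: "a < Suc i" "b < Suc i"
        then have "N - 1 - a < N" "N - 1 - b < N" "(N - 1 - a = N - 1 - b) = (a = b)"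
          using i kN by auto
        then show "cinner (\<phi> (N - 1 - a)) (\<phi> (N - 1 - b)) = (if a = b then 1 else 0)"
          using orthonormal_cinner[OF \<phi>(1), of "N - 1 - a" "N - 1 - b"] by simp
      qed
      show "cinner (?C (\<phi> (N - 1 - a))) (\<phi> (N - 1 - b)) = 0" if "a \<le> i" "b \<le> i" "a \<noteq> b" for a b
      proof -
        have "N - 1 - a < N" "N - 1 - b < N" "N - 1 - a \<noteq> N - 1 - b" using that i kN by auto
        then show ?thesis using \<phi>(3) by blast
      qed
      show "Re (cinner (?C (\<phi> (N - 1 - a))) (\<phi> (N - 1 - a))) \<le> \<gamma> (N - 1 - i)" if "a \<le> i" for a
      proof -
        have "N - 1 - i \<le> N - 1 - a" "N - 1 - a < N" using that i kN by auto
        then show ?thesis using \<gamma>_mono unfolding \<gamma>_def by blast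
      qed
    qed
    ultimately have "\<gamma> i - \<gamma> (N - 1 - i) \<le> spectral_spread ?C i"
      by (simp only: spectral_spread_def)
    moreover have "\<sigma> i \<le> singular_values X i"
    proof (rule singular_values_ge[OF X inf orthonormal_mono[OF v(1)]])
      show "Suc i \<le> n" using i kn by simp
      show "cinner (X (v a)) (X (v b)) = 0" if "a \<le> i" "b \<le> i" "a \<noteq> b" for a b
        using X_orth that i kn by simp
      show "\<sigma> i \<le> norm (X (v a))" if "a \<le> i" for a
        using \<sigma>_mono[of a i] that i kn by (simp add: \<sigma>_def)
    qed (rule \<sigma>_nonneg)
    ultimately show ?thesis
      unfolding g_def using gap[OF i] \<sigma>_nonneg[of i] by (intro mult_mono) simp_all
  qed
  show ?thesis
    by (rule exI[of _ g]) (use g_mono g_le total in blast)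
qed

text \<open>Exact singular vectors may be absent. A family \<open>d\<close> that nearly maximizes
  the form of |T| is rotated within its span to \<open>e\<close>, which makes the
  \<open>T (e i)\<close> orthogonal and leaves the trace of |T| unchanged. Each diagonal entry of
  |T| at \<open>e i\<close> is at most |T (e i)|, the pairing of \<open>T (e i)\<close> with its
  normalization \<open>f i\<close>.\<close>

lemma near_singular_value_sum:
  fixes T :: "'a :: chilbert_space \<Rightarrow> 'a"
  assumes inf: "\<And>n. \<exists>e :: nat \<Rightarrow> 'a. orthonormal e n"
    and T: "bounded_clinear T" and "\<epsilon> > 0"
  obtains e f where "orthonormal e k" "suborthonormal f k"
    "(\<Sum>i<k. singular_values T i) - real k * \<epsilon> \<le> (\<Sum>i<k. Re (cinner (T (e i)) (f i)))"
proof -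
  note R = abs_op_props[OF T]
  obtain d where d: "orthonormal d k"
    "\<forall>i<k. singular_values T i - \<epsilon> \<le> Re (cinner (abs_op T (d i)) (d i))"
    using near_maximizing_orthonormal_family[OF R(1) inf \<open>\<epsilon> > 0\<close>] unfolding singular_values_def by blast
  obtain e where e: "orthonormal e k" "\<forall>i<k. proj d k (e i) = e i"
    "\<forall>x. proj d k x = x \<longrightarrow> proj e k x = x"
    "\<forall>i<k. \<forall>j<k. i \<noteq> j \<longrightarrow> cinner (cadjoint T (T (e i))) (e j) = 0"
    by (rule hermitian_form_diagonalization[OF cadjoint_comp(1,2)[OF T] d(1)]) (rule that)
  define f where "f i = (1 / norm (T (e i))) *\<^sub>R T (e i)" for i
  have f: "suborthonormal f k"
    unfolding suborthonormal_def f_def using e(4)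
    by (auto simp: cinner_scaleR_left cinner_scaleR_right cadjoint_comp(3)[OF T])
  have pair: "Re (cinner (T (e i)) (f i)) = norm (T (e i))" for i
    by (simp add: f_def cinner_scaleR_right cinner_self power2_eq_square)
  have "(\<Sum>i<k. singular_values T i) - real k * \<epsilon> = (\<Sum>i<k. singular_values T i - \<epsilon>)"
    by (simp add: sum_subtractf)
  also have "\<dots> \<le> (\<Sum>i<k. Re (cinner (abs_op T (d i)) (d i)))"
    using d(2) by (intro sum_mono) simp
  also have "\<dots> = (\<Sum>i<k. Re (cinner (abs_op T (e i)) (e i)))"
    unfolding Re_sum[symmetric]
    by (rule arg_cong[where f = Re], rule trace_basis_independent[OF R(1)])
      (use e(2,3) proj_base[OF d(1)] in simp_all)
  also have "\<dots> \<le> (\<Sum>i<k. Re (cinner (T (e i)) (f i)))"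
  proof (rule sum_mono)
    fix i assume "i \<in> {..<k}"
    then have "norm (e i) = 1" using orthonormal_norm[OF e(1)] by simp
    then show "Re (cinner (abs_op T (e i)) (e i)) \<le> Re (cinner (T (e i)) (f i))"
      using abs_Re_cinner_le[of "abs_op T (e i)" "e i"] R(4)[of "e i"] by (simp add: pair)
  qed
  finally show ?thesis by (rule that[OF e(1) f])
qed

lemma singular_values_bounded:
  fixes T :: "'a :: chilbert_space \<Rightarrow> 'a"
  assumes inf: "\<And>n. \<exists>e :: nat \<Rightarrow> 'a. orthonormal e n" and T: "bounded_clinear T"
  obtains K where "\<And>i. \<bar>singular_values T i\<bar> \<le> K"
proof -
  obtain K where K: "K > 0" "\<And>x. norm (abs_op T x) \<le> K * norm x"
    by (rule bounded_clinear_bounded[OF abs_op_props(1)[OF T]]) (rule that)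
  show ?thesis
    by (rule that[of K])
      (simp only: singular_values_def spectral_scale_bounded[OF abs_op_props(1)[OF T] inf K(2)])
qed

lemma decr_rearr_singular_values_le:
  fixes T :: "'a :: chilbert_space \<Rightarrow> 'a"
  assumes inf: "\<And>n. \<exists>e :: nat \<Rightarrow> 'a. orthonormal e n" and T: "bounded_clinear T"
  shows "decr_rearr (singular_values T) n \<le> singular_values T n"
proof -
  obtain K where K: "\<And>i. \<bar>singular_values T i\<bar> \<le> K"
    by (rule singular_values_bounded[OF inf T]) (rule that)
  have "singular_values T (Suc i) \<le> singular_values T i" for i
    unfolding singular_values_def by (rule spectral_scale_antimono[OF abs_op_props(1)[OF T] inf])
  then have "singular_values T i \<le> singular_values T n" if "n \<le> i" for i
    using that by (rule lift_Suc_antimono_le)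
  then show ?thesis by (rule decr_rearr_le[OF K])
qed

text \<open>For fixed k the pairings approach the sum of the first k singular values from below up
  to an arbitrary error. On the left, rearranging a nonincreasing sequence does not increase its
  entries; on the right, the rearrangement is bounded below through \<open>g\<close>.\<close>

theorem corollary4p6:
  fixes A B X :: "'a :: chilbert_space \<Rightarrow> 'a"
  assumes "infinite_cdim (UNIV :: 'a set)"
    and "separable_space (euclidean :: 'a topology)"
    and "bounded_clinear A" and "selfadjoint A"
    and "bounded_clinear B" and "selfadjoint B"
    and "bounded_clinear X"
  shows "singular_values (\<lambda>\<psi>. A (X \<psi>) - X (B \<psi>)) \<prec>\<^sub>w
           (\<lambda>n. spectral_spread (A \<oplus>\<^sub>o\<^sub>p B) n * singular_values X n)"
  unfolding submajorized_def
proof (intro allI impI)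
  fix k :: nat
  let ?C = "A \<oplus>\<^sub>o\<^sub>p B"
  define T where "T = (\<lambda>\<psi>. A (X \<psi>) - X (B \<psi>))"
  define b where "b n = spectral_spread ?C n * singular_values X n" for n
  have inf: "\<exists>e :: nat \<Rightarrow> 'a. orthonormal e n" for n
    by (rule infinite_cdim_orthonormal[OF assms(1)])
  have T: "bounded_clinear T"
    unfolding T_def
    by (rule bounded_clinear_sub[OF bounded_clinear_compose[OF assms(3,7)]
          bounded_clinear_compose[OF assms(7,5)]])
  have C: "bounded_clinear ?C" by (rule bounded_clinear_dsum_op[OF assms(3,5)])
  \<comment> \<open>Min-max for the block operator needs arbitrarily long orthonormal families in
    the direct sum; the first summand already supplies them.\<close>
  have inf2: "\<exists>e :: nat \<Rightarrow> 'a \<times> 'a. orthonormal e n" for n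
  proof -
    obtain e :: "nat \<Rightarrow> 'a" where "orthonormal e n" using inf by blast
    then have "orthonormal (\<lambda>i. (e i, 0 :: 'a)) n" by (simp add: orthonormal_def cinner_prod_def)
    then show ?thesis by blast
  qed
  obtain K where K: "K > 0" "\<And>x. norm (?C x) \<le> K * norm x"
    by (rule bounded_clinear_bounded[OF C]) (rule that)
  have spread_bound: "\<bar>spectral_spread ?C i\<bar> \<le> K + K" for i
  proof -
    have "\<bar>spectral_scale ?C (int i + 1)\<bar> \<le> K" by (rule spectral_scale_bounded[OF C inf2 K(2)])
    moreover have "\<bar>spectral_scale (\<lambda>x. - ?C x) (int i + 1)\<bar> \<le> K"
      by (rule spectral_scale_bounded[OF bounded_clinear_uminus_fun[OF C] inf2]) (simp add: K(2))
    ultimately show ?thesis unfolding spectral_spread_def spectral_scale_neg_eq by linarith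
  qed
  obtain L where L: "\<And>i. \<bar>singular_values X i\<bar> \<le> L"
    by (rule singular_values_bounded[OF inf assms(7)]) (rule that)
  have b_bound: "\<bar>b i\<bar> \<le> (K + K) * L" for i
    unfolding b_def abs_mult using K(1) by (intro mult_mono spread_bound L) simp_all
  have "(\<Sum>i<k. singular_values T i) \<le> (\<Sum>i<k. decr_rearr b i)"
  proof (rule field_le_epsilon)
    fix \<delta> :: real assume "\<delta> > 0"
    define \<epsilon> where "\<epsilon> = \<delta> / (real k + 1)"
    have \<epsilon>: "\<epsilon> > 0" "real k * \<epsilon> \<le> \<delta>" using \<open>\<delta> > 0\<close> by (simp_all add: \<epsilon>_def field_simps)
    obtain e f where ef: "orthonormal e k" "suborthonormal f k"
      "(\<Sum>i<k. singular_values T i) - real k * \<epsilon> \<le> (\<Sum>i<k. Re (cinner (T (e i)) (f i)))"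
      by (rule near_singular_value_sum[OF inf T \<epsilon>(1)]) (rule that)
    have "\<exists>g. (\<forall>i j. i \<le> j \<longrightarrow> j < k \<longrightarrow> g j \<le> g i) \<and> (\<forall>i<k. g i \<le> b i) \<and>
      (\<Sum>i<k. Re (cinner (T (e i)) (f i))) \<le> (\<Sum>i<k. g i)"
      unfolding T_def b_def by (rule commutator_pairing_bound[OF inf assms(3-7) ef(1,2)])
    then obtain g where g: "\<forall>i j. i \<le> j \<longrightarrow> j < k \<longrightarrow> g j \<le> g i" "\<forall>i<k. g i \<le> b i"
      "(\<Sum>i<k. Re (cinner (T (e i)) (f i))) \<le> (\<Sum>i<k. g i)"
      by (elim exE conjE) (rule that)
    have "(\<Sum>i<k. g i) \<le> (\<Sum>i<k. decr_rearr b i)"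
    proof (rule sum_mono)
      fix i assume "i \<in> {..<k}"
      then have i: "i < k" by simp
      show "g i \<le> decr_rearr b i"
      \<comment> \<open>As \<open>g\<close> is nonincreasing, each of b 0, ..., b i is at least
        \<open>g i\<close>.\<close>
      proof (rule decr_rearr_ge[OF b_bound])
        fix l assume "l \<le> i"
        then have "g i \<le> g l" "g l \<le> b l" using g(1,2) i by simp_all
        then show "g i \<le> b l" by (rule order_trans)
      qed
    qed
    then show "(\<Sum>i<k. singular_values T i) \<le> (\<Sum>i<k. decr_rearr b i) + \<delta>"
      using ef(3) g(3) \<epsilon>(2) by linarith
  qed
  moreover have "(\<Sum>i<k. decr_rearr (singular_values T) i) \<le> (\<Sum>i<k. singular_values T i)"
    by (intro sum_mono decr_rearr_singular_values_le[OF inf T])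
  ultimately show "(\<Sum>i<k. decr_rearr (singular_values (\<lambda>\<psi>. A (X \<psi>) - X (B \<psi>))) i)
      \<le> (\<Sum>i<k. decr_rearr (\<lambda>n. spectral_spread ?C n * singular_values X n) i)"
    unfolding T_def b_def by linarith
qed

end
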